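(* Assume hypotheses H1, H2 and H3 (stated in the context). Then there exists a constant $\sigma^2>0$ and, for all $(i,j)\in E\times E$, a function $H_{i,j}:(0,+\infty)\to\mathbb{R}$ such that for all $(i,j)\in E\times E$ and all $\lambda>0$, $$\sqrt{n}\;\mathbb{E}_i\big(e^{\lambda m_n},\,X_n=j\big)\xrightarrow[n\to+\infty]{}\frac{H_{i,j}(\lambda)}{\sqrt{\pi}},$$ where $H_{i,j}(\lambda)>0$ for all $\lambda>0$, and $$\lim_{\lambda\to0^+}\lambda H_{i,j}(\lambda)=\sqrt{\frac{2}{\pi\sigma^2}}\;\nu_j .$$
   Context: Setup. $E$ is a finite set with $N$ elements, $(X_n)_{n\ge0}$ is an irreducible and aperiodic Markov chain on $E$ with transition matrix $P=(p_{i,j})_{i,j\in E}$ and unique invariant probability $\nu=(\nu_i)_{i\in E}$. $(F(i,j,dt))_{i,j\in E}$ is a family of probability measures on $\mathbb{R}$. $(Y_n,X_n)_{n\ge0}$ is a Markov chain on $\mathbb{R}\times E$ with transition probability $$\mathbb{P}(Y_{n+1}\in A,\,X_{n+1}=j\mid Y_n=u,\,X_n=i)=p_{i,j}\,F(i,j,A)$$ for $(u,i)\in\mathbb{R}\times E$, $A\subset\mathbb{R}$ Borel, $j\in E$. $\mathbb{P}_i$ and $\mathbb{E}_i$ denote probability and expectation for this chain started from $(Y_0,X_0)=(0,i)$, and $\mathbb{E}_i(Z,X_n=j)$ means $\mathbb{E}_i(Z\mathbf{1}_{\{X_n=j\}})$. Set $S_0=0$, $S_n=Y_1+\cdots+Y_n$,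 and $m_n=\min(S_0,S_1,\dots,S_n)$. Hypotheses. H1: there exists $\alpha>0$ such that for all $\lambda\in\mathbb{C}$ with $|\mathrm{Re}\,\lambda|\le\alpha$, $\sup_{(i,j)\in E\times E}|\widehat F(i,j,\lambda)|<+\infty$, where $\widehat F(i,j,\lambda)=\int_{\mathbb{R}}e^{\lambda t}F(i,j,dt)$. H2: there exist $n_0\ge1$ and $(i_0,j_0)\in E\times E$ such that the measure $\mathbb{P}_{i_0}(X_{n_0}=j_0,\,S_{n_0}\in dx)$ has a (non-zero) absolutely continuous component with respect to Lebesgue measure on $\mathbb{R}$. H3: $\sum_{(i,j)\in E\times E}\nu_i p_{i,j}\int_{\mathbb{R}}t\,F(i,j,dt)=0$. *)

theory Defs
  imports "HOL-Probability.Probability"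
begin

(* Throughout, the finite state space E is a type of class finite and the entry p_{i,j} of a
   transition matrix is P $ i $ j. *)

definition stochastic_matrix :: "real^'e^'e \<Rightarrow> bool" where
  "stochastic_matrix P \<longleftrightarrow> (\<forall>i j. 0 \<le> P $ i $ j) \<and> (\<forall>i. (\<Sum>j\<in>UNIV. P $ i $ j) = 1)"

(* Matrix power for **; the library's ^ on vectors is not the matrix power. *)
definition n_step :: "real^'e^'e \<Rightarrow> nat \<Rightarrow> real^'e^'e" where
  "n_step P n = (((**) P) ^^ n) (mat 1)"

definition irreducible_matrix :: "real^'e^'e \<Rightarrow> bool" where
  "irreducible_matrix P \<longleftrightarrow> (\<forall>i j. \<exists>n. 0 < n_step P n $ i $ j)"

definition aperiodic_matrix :: "real^'e^'e \<Rightarrow> bool" where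
  "aperiodic_matrix P \<longleftrightarrow> (\<forall>i. Gcd {n. 1 \<le> n \<and> 0 < n_step P n $ i $ i} = 1)"

definition invariant_probability :: "real^'e^'e \<Rightarrow> real^'e \<Rightarrow> bool" where
  "invariant_probability P \<nu> \<longleftrightarrow>
     (\<forall>i. 0 \<le> \<nu> $ i) \<and> (\<Sum>i\<in>UNIV. \<nu> $ i) = 1 \<and> \<nu> v* P = \<nu>"

(* The sigma-algebra on the sample space generated by (Y_0, X_0), ..., (Y_n, X_n). *)
definition past ::
  "'w measure \<Rightarrow> (nat \<Rightarrow> 'w \<Rightarrow> real) \<Rightarrow> (nat \<Rightarrow> 'w \<Rightarrow> 'e) \<Rightarrow> nat \<Rightarrow> 'w measure" where
  "past M Y X n =
     vimage_algebra (space M) (\<lambda>\<omega>. \<lambda>k\<in>{..n}. (Y k \<omega>, X k \<omega>))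
       (PiM {..n} (\<lambda>_. borel \<Otimes>\<^sub>M count_space UNIV))"

(* Under the law M, (Y_n, X_n) is a Markov chain started from (0, i) whose transition
   probability from (u, k) gives A \<times> {j} the mass p_{k,j} F(k, j, A). *)
definition markov_walk ::
  "real^'e^'e \<Rightarrow> ('e \<Rightarrow> 'e \<Rightarrow> real measure) \<Rightarrow> 'w measure \<Rightarrow>
   (nat \<Rightarrow> 'w \<Rightarrow> real) \<Rightarrow> (nat \<Rightarrow> 'w \<Rightarrow> 'e) \<Rightarrow> 'e \<Rightarrow> bool" where
  "markov_walk P F M Y X i \<longleftrightarrow>
     prob_space M \<and>
     (\<forall>n. Y n \<in> borel_measurable M) \<and>
     (\<forall>n. X n \<in> measurable M (count_space UNIV)) \<and>
     (AE \<omega> in M. Y 0 \<omega> = 0 \<and> X 0 \<omega> = i) \<and>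
     (\<forall>n j. \<forall>A\<in>sets borel. AE \<omega> in M.
        real_cond_exp M (past M Y X n)
          (indicator {\<omega> \<in> space M. Y (Suc n) \<omega> \<in> A \<and> X (Suc n) \<omega> = j}) \<omega>
        = P $ X n \<omega> $ j * measure (F (X n \<omega>) j) A)"

definition walk :: "(nat \<Rightarrow> 'w \<Rightarrow> real) \<Rightarrow> nat \<Rightarrow> 'w \<Rightarrow> real" where
  "walk Y n \<omega> = (\<Sum>k=1..n. Y k \<omega>)"

definition running_min :: "(nat \<Rightarrow> 'w \<Rightarrow> real) \<Rightarrow> nat \<Rightarrow> 'w \<Rightarrow> real" where
  "running_min Y n \<omega> = Min ((\<lambda>k. walk Y k \<omega>) ` {0..n})"

definition laplace :: "real measure \<Rightarrow> complex \<Rightarrow> complex" where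
  "laplace \<mu> z = (LINT t|\<mu>. exp (z * complex_of_real t))"

(* Integrability is required explicitly: the Bochner integral of a non-integrable function is 0,
   which would make the supremum finite for the wrong reason. *)
definition H1 :: "('e \<Rightarrow> 'e \<Rightarrow> real measure) \<Rightarrow> bool" where
  "H1 F \<longleftrightarrow> (\<exists>\<alpha>>0. \<forall>z. \<bar>Re z\<bar> \<le> \<alpha> \<longrightarrow>
     (\<forall>i j. integrable (F i j) (\<lambda>t. exp (z * complex_of_real t))) \<and>
     bdd_above (range (\<lambda>(i, j). norm (laplace (F i j) z))))"

(* The absolutely continuous part of the Lebesgue decomposition of \<mu> does not vanish. *)
definition has_ac_component :: "real measure \<Rightarrow> bool" where
  "has_ac_component \<mu> \<longleftrightarrow> (\<exists>\<mu>a \<mu>s.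
     sets \<mu>a = sets borel \<and> sets \<mu>s = sets borel \<and>
     (\<forall>A\<in>sets borel. emeasure \<mu> A = emeasure \<mu>a A + emeasure \<mu>s A) \<and>
     absolutely_continuous lborel \<mu>a \<and>
     (\<exists>N\<in>null_sets lborel. emeasure \<mu>s (UNIV - N) = 0) \<and>
     emeasure \<mu>a UNIV \<noteq> 0)"

(* M i is the law of the chain started from (0, i); the restricted image measure maps A to
   P_i (X_n = j, S_n \<in> A). *)
definition H2 ::
  "('e \<Rightarrow> 'w measure) \<Rightarrow> (nat \<Rightarrow> 'w \<Rightarrow> real) \<Rightarrow> (nat \<Rightarrow> 'w \<Rightarrow> 'e) \<Rightarrow> bool" where
  "H2 M Y X \<longleftrightarrow> (\<exists>n\<ge>1. \<exists>i j. has_ac_component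
     (distr (restrict_space (M i) {\<omega> \<in> space (M i). X n \<omega> = j}) borel (walk Y n)))"

definition H3 :: "real^'e^'e \<Rightarrow> real^'e \<Rightarrow> ('e \<Rightarrow> 'e \<Rightarrow> real measure) \<Rightarrow> bool" where
  "H3 P \<nu> F \<longleftrightarrow> (\<Sum>(i, j)\<in>UNIV. \<nu> $ i * P $ i $ j * (LINT t|F i j. t)) = 0"

end

theory Submission
  imports Defs
begin

text \<open>Write \<open>m\<^sub>n\<close> for the running minimum and, for a starting level \<open>x \<ge> 0\<close>, let \<open>\<tau>\<close> be the first time
at which \<open>x + S\<^sub>n\<close> is negative. The weight \<open>exp (\<lambda> m\<^sub>n)\<close> is the probability that an independent
exponential variable of parameter \<open>\<lambda>\<close> is at least \<open>- m\<^sub>n\<close>; so its expectation is the average of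
\<open>\<P>(\<tau> > n)\<close> over an exponentially distributed level \<open>x\<close> (\<open>exp_running_min_integral\<close>), and everything
rests on the decay of \<open>\<P>(\<tau> > n)\<close>.

That decay is read off from the generating function of \<open>\<P>(\<tau> > n)\<close> near \<open>s = 1\<close>. Let \<open>g\<close> solve the
Poisson equation that makes \<open>S\<^sub>n + g (X\<^sub>n)\<close> a martingale, and let \<open>v\<close> be the stationary mean of its
squared increments. A second Poisson equation gives \<open>q\<close> such that
\<open>exp (- \<theta> (y + g k)) (1 + \<theta>\<^sup>2 q k / 2)\<close> is, up to an error of order \<open>\<theta>\<^sup>3\<close>, an eigenfunction of the
transition operator with eigenvalue \<open>1 + \<theta>\<^sup>2 v / 2\<close> (\<open>defect_bound\<close>). Two correctors thus do the work
of the perturbed Perron eigenvector. Take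
\<open>s = 1 / (1 + \<theta>\<^sup>2 v / 2)\<close>, stop the discounted process at \<open>\<tau>\<close> and expand to first order in \<open>\<theta>\<close>:
\<open>1 - \<E>(s\<^sup>\<tau>)\<close> equals \<open>\<theta> (x + g - \<E>(s\<^sup>\<tau> (x + S\<^sub>\<tau> + g (X\<^sub>\<tau>))))\<close> up to \<open>\<theta>\<^sup>2\<close>. The left side is
\<open>1 - s\<close> times the generating function and \<open>\<theta>\<close> is asymptotic to \<open>sqrt (2 (1 - s) / v)\<close>, so the
generating function behaves like \<open>sqrt (2 / v) V x / sqrt (1 - s)\<close>, where
\<open>V x = x + g - \<E>(x + S\<^sub>\<tau> + g (X\<^sub>\<tau>))\<close> (\<open>scaled_gf_tendsto\<close>). As \<open>\<P>(\<tau> > n)\<close> decreases with \<open>n\<close>, the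
Tauberian theorem \<open>tauberian_inv_sqrt\<close> turns this into \<open>sqrt n \<P>(\<tau> > n) \<longlonglongrightarrow> sqrt (2 / v) V x / sqrt pi\<close>.

The expansion needs exponential moments of the overshoot \<open>x + S\<^sub>\<tau>\<close> that are bounded uniformly in \<open>x\<close>
(\<open>dying_exp_sum_bound\<close>). They follow from a bounded Lyapunov function: the exponential eigenfunction
with a small fixed \<open>\<theta>\<close>, frozen far below 0. The same bound shows that \<open>V x - x\<close> is bounded, and from
this come both the positivity of the limit and its behaviour \<open>1 / \<lambda>\<close> as \<open>\<lambda>\<close> tends to 0.

The terminal state factors out: since \<open>\<E>(exp (\<lambda> m\<^sub>n))\<close> decreases like \<open>1 / sqrt n\<close>, its last \<open>k\<close>
steps change it by \<open>o(1 / sqrt n)\<close>, and during these steps the chain forgets its position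
(\<open>mixing_transfer\<close>). Hence \<open>H i j \<lambda> = \<nu>\<^sub>j h i \<lambda>\<close>. The absolutely continuous component in H2 gives
\<open>v > 0\<close>: if \<open>v\<close> were 0, then \<open>S\<^sub>n\<close> would be a function of \<open>X\<^sub>0\<close> and \<open>X\<^sub>n\<close>.\<close>

section \<open>Convergence of a finite Markov chain and the Poisson equation\<close>

lemma n_step_0 [simp]: "n_step P 0 = mat 1"
  by (simp add: n_step_def)

lemma n_step_Suc: "n_step P (Suc n) = P ** n_step P n"
  by (simp add: n_step_def)

lemma n_step_add: "n_step P (m + n) = n_step P m ** n_step P n"
  by (induction m) (simp_all add: n_step_Suc matrix_mul_assoc)

lemma n_step_1 [simp]: "n_step P (Suc 0) = P"
  by (simp add: n_step_Suc)

lemma stochastic_n_step: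
  assumes "stochastic_matrix P"
  shows "stochastic_matrix (n_step P n)"
proof (induction n)
  case 0
  then show ?case by (auto simp: stochastic_matrix_def mat_def)
next
  case (Suc n)
  have "(\<Sum>j\<in>UNIV. \<Sum>k\<in>UNIV. P $ i $ k * n_step P n $ k $ j) = 1" for i
    using assms Suc
    by (subst sum.swap) (simp add: stochastic_matrix_def flip: sum_distrib_left)
  then show ?case
    using assms Suc
    by (auto simp: stochastic_matrix_def n_step_Suc matrix_matrix_mult_def intro!: sum_nonneg)
qed

lemma invariant_n_step:
  assumes "\<nu> v* P = (\<nu> :: real^'e)"
  shows "\<nu> v* n_step P n = \<nu>"
  using assms
  by (induction n) (simp_all add: n_step_Suc flip: vector_matrix_mul_assoc)

lemma n_step_add_ge:
  assumes "stochastic_matrix P"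
  shows "n_step P m $ i $ k * n_step P n $ k $ j \<le> n_step P (m + n) $ i $ j"
proof -
  have "n_step P m $ i $ k * n_step P n $ k $ j \<le> (\<Sum>k\<in>UNIV. n_step P m $ i $ k * n_step P n $ k $ j)"
    using stochastic_n_step[OF assms] 
    by (intro member_le_sum) (auto simp: stochastic_matrix_def)
  then show ?thesis
    by (simp add: n_step_add matrix_matrix_mult_def)
qed

text \<open>The smallest positive difference \<open>d\<close> of elements of \<open>S \<union> {0}\<close> divides every element, by division with
remainder; hence \<open>d = 1\<close> and there are consecutive elements \<open>b\<close> and \<open>b + 1\<close>. Every \<open>n \<ge> b\<^sup>2\<close> is
\<open>(q - r) b + r (b + 1)\<close> with \<open>n = q b + r\<close>. Applied to the return times of a state, this is where
aperiodicity becomes a statement about all large times.\<close>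

lemma additive_set_Gcd_1_cofinite:
  fixes S :: "nat set"
  assumes add: "\<And>a b. a \<in> S \<Longrightarrow> b \<in> S \<Longrightarrow> a + b \<in> S" and gcd: "Gcd S = 1"
  shows "\<exists>N. \<forall>n\<ge>N. n \<in> S"
proof -
  define T where "T = insert 0 S"
  have addT: "a + b \<in> T" if "a \<in> T" "b \<in> T" for a b
    using that add by (auto simp: T_def)
  have mulT: "k * a \<in> T" if "a \<in> T" for a k
    by (induction k) (use that addT in \<open>auto simp: T_def\<close>)
  have "\<exists>s\<in>S. s > 0"
    using gcd by (metis Gcd_0_iff gr0I zero_neq_one subsetI singletonI)
  then obtain s0 where s0: "s0 \<in> S" "s0 > 0" by auto
  \<comment> \<open>By minimality of \<open>d\<close> below, no remainder \<open>s mod d\<close> can be positive.\<close>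
  define dif where "dif d \<longleftrightarrow> d > 0 \<and> (\<exists>b\<in>T. b + d \<in> T)" for d
  have "dif s0" using s0 by (auto simp: dif_def T_def)
  define d where "d = (LEAST d. dif d)"
  have "dif d" unfolding d_def using \<open>dif s0\<close> by (rule LeastI)
  then obtain b where b: "d > 0" "b \<in> T" "b + d \<in> T" by (auto simp: dif_def)
  have "d dvd s" if "s \<in> S" for s
  proof (rule ccontr)
    assume "\<not> d dvd s"
    then have pos: "s mod d > 0" by (simp add: mod_greater_zero_iff_not_dvd)
    have "s \<in> T" using that by (simp add: T_def)
    then have "s + (s div d) * b \<in> T" using b(2) addT mulT by blast
    moreover have "s + (s div d) * b = (s div d) * (b + d) + s mod d"
      by (simp add: algebra_simps)
    moreover have "(s div d) * (b + d) \<in> T" using b mulT by blast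
    ultimately have "dif (s mod d)" using pos unfolding dif_def by metis
    then have "d \<le> s mod d" unfolding d_def by (rule Least_le)
    then show False using b(1) using mod_less_divisor[OF b(1), of s] by linarith
  qed
  then have "d dvd Gcd S" by (rule Gcd_greatest)
  then have d1: "d = 1" using gcd by simp
  have "n \<in> S" if n: "n \<ge> Suc (b * b)" for n
  proof (cases "b = 0")
    case True
    then have "1 \<in> T" using b d1 by simp
    then have "n * 1 \<in> T" by (rule mulT)
    then show ?thesis using n by (auto simp: T_def)
  next
    case False
    define r q where "r = n mod b" and "q = n div b"
    have nq: "n = q * b + r" by (simp add: r_def q_def)
    have "r < b" using False by (simp add: r_def)
    moreover have "b \<le> q" using n False unfolding q_def
      by (metis Suc_leD div_le_mono nonzero_mult_div_cancel_left)
    ultimately have rq: "r \<le> q" by simp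
    have "n = (q - r) * b + r * (b + d)"
      using rq d1 nq by (simp add: algebra_simps flip: distrib_right)
    also have "\<dots> \<in> T" using b addT mulT by blast
    finally show ?thesis using n by (auto simp: T_def)
  qed
  then show ?thesis by blast
qed

lemma n_step_eventually_positive:
  fixes P :: "real^'e^'e"
  assumes P: "stochastic_matrix P" "irreducible_matrix P" "aperiodic_matrix P"
  shows "\<exists>m\<ge>1. \<forall>i j. 0 < n_step P m $ i $ j"
proof -
  have nn: "0 \<le> n_step P n $ i $ j" for n i j
    using stochastic_n_step[OF P(1)] by (auto simp: stochastic_matrix_def)
  have mul: "0 < n_step P (m + n) $ i $ j" if "0 < n_step P m $ i $ k" "0 < n_step P n $ k $ j" for m n i j k
    using n_step_add_ge[OF P(1)] mult_pos_pos[OF that] order_less_le_trans by blast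
  have "\<exists>N. \<forall>n\<ge>N. n \<in> {n. 1 \<le> n \<and> 0 < n_step P n $ i $ i}" for i
    using P(3) by (intro additive_set_Gcd_1_cofinite) (auto simp: aperiodic_matrix_def intro: mul)
  then obtain N where N: "\<And>i n. n \<ge> N i \<Longrightarrow> 0 < n_step P n $ i $ i"
    by simp metis
  obtain k where k: "\<And>i j. 0 < n_step P (k i j) $ i $ j"
    using P(2) unfolding irreducible_matrix_def by metis
  define m where "m = Suc ((\<Sum>i\<in>UNIV. N i) + (\<Sum>i\<in>UNIV. \<Sum>j\<in>UNIV. k i j))"
  have "0 < n_step P m $ i $ j" for i j
  proof -
    have "N i \<le> (\<Sum>i\<in>UNIV. N i)" by (intro member_le_sum) auto
    moreover have "k i j \<le> (\<Sum>j\<in>UNIV. k i j)" by (intro member_le_sum) auto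
    moreover have "(\<Sum>j\<in>UNIV. k i j) \<le> (\<Sum>i\<in>UNIV. \<Sum>j\<in>UNIV. k i j)"
      by (intro member_le_sum[where f="\<lambda>i. \<Sum>j\<in>UNIV. k i j"]) auto
    ultimately have le: "N i + k i j \<le> m" by (simp add: m_def)
    then have "0 < n_step P ((m - k i j) + k i j) $ i $ j"
      by (intro mul[of _ i i] N k) auto
    then show ?thesis using le by simp
  qed
  then show ?thesis by (intro exI[of _ m]) (auto simp: m_def)
qed

lemma invariant_sum_mult:
  fixes P :: "real^'e^'e"
  assumes "\<nu> v* P = \<nu>"
  shows "(\<Sum>i\<in>UNIV. \<nu> $ i * (P *v f) $ i) = (\<Sum>i\<in>UNIV. \<nu> $ i * f $ i)"
proof -
  have "\<nu> \<bullet> (P *v f) = (\<nu> v* P) \<bullet> f" by (simp add: dot_lmul_matrix)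
  then show ?thesis using assms by (simp add: inner_vec_def)
qed

text \<open>Doeblin's argument: a strictly positive power of \<open>P\<close> dominates \<open>e\<close> times the matrix all of whose rows
are \<open>\<nu>\<close>. On functions with \<open>\<nu>\<close>-mean 0 that part acts as 0, so the power contracts the sup norm by the
factor \<open>1 - e\<close>.\<close>

lemma n_step_centred_tendsto_0:
  fixes P :: "real^'e^'e"
  assumes P: "stochastic_matrix P" and nu: "invariant_probability P \<nu>"
    and m: "m \<ge> 1" "\<And>i j. 0 < n_step P m $ i $ j"
    and f: "(\<Sum>i\<in>UNIV. \<nu> $ i * f $ i) = 0"
  shows "(\<lambda>n. (n_step P n *v f) $ i) \<longlonglongrightarrow> 0"
proof -
  define A where "A = n_step P m"
  define e where "e = Min (range (\<lambda>(i, j). A $ i $ j))"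
  have epos: "e > 0"
    unfolding e_def A_def using m by (subst Min_gr_iff) auto
  have eA: "e \<le> A $ i $ j" for i j
    unfolding e_def by (intro Min_le) auto
  have nu': "0 \<le> \<nu> $ i" "(\<Sum>i\<in>UNIV. \<nu> $ i) = 1" "\<nu> v* P = \<nu>" for i
    using nu by (auto simp: invariant_probability_def)
  have nu1: "\<nu> $ i \<le> 1" for i
    using nu'(2) member_le_sum[of i UNIV "\<lambda>i. \<nu> $ i"] nu'(1) by auto
  have sA: "(\<Sum>j\<in>UNIV. A $ i $ j) = 1" for i
    using stochastic_n_step[OF P] by (auto simp: A_def stochastic_matrix_def)
  have sP: "(\<Sum>j\<in>UNIV. P $ i $ j) = 1" "0 \<le> P $ i $ j" for i j
    using P by (auto simp: stochastic_matrix_def)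
  have Anu: "e * \<nu> $ j \<le> A $ i $ j" for i j
    using mult_left_mono[OF nu1[of j], of e] epos eA[of i j] by linarith
  have "e = (\<Sum>j\<in>UNIV. e * \<nu> $ j)" by (simp add: nu' flip: sum_distrib_left)
  also have "\<dots> \<le> (\<Sum>j\<in>UNIV. A $ undefined $ j)" by (intro sum_mono Anu)
  also have "\<dots> = 1" by (rule sA)
  finally have e1: "e \<le> 1" .
  have contract: "\<bar>(A *v h) $ i\<bar> \<le> (1 - e) * B"
    if h: "(\<Sum>i\<in>UNIV. \<nu> $ i * h $ i) = 0" "\<And>i. \<bar>h $ i\<bar> \<le> B" for h B i
  proof -
    have "(A *v h) $ i = (\<Sum>j\<in>UNIV. (A $ i $ j - e * \<nu> $ j) * h $ j)"
      using h(1) by (simp add: matrix_vector_mult_def left_diff_distrib sum_subtractf mult.assoc flip: sum_distrib_left)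
    also have "\<bar>\<dots>\<bar> \<le> (\<Sum>j\<in>UNIV. (A $ i $ j - e * \<nu> $ j) * B)"
      using Anu h(2) by (intro order.trans[OF sum_abs] sum_mono) (auto simp: abs_mult intro!: mult_mono)
    also have "\<dots> = (1 - e) * B"
      by (simp add: sA nu' sum_subtractf flip: sum_distrib_left sum_distrib_right)
    finally show ?thesis .
  qed
  have contract1: "\<bar>(P *v h) $ i\<bar> \<le> B" if h: "\<And>i. \<bar>h $ i\<bar> \<le> B" for h B i
  proof -
    have "\<bar>(P *v h) $ i\<bar> \<le> (\<Sum>j\<in>UNIV. P $ i $ j * B)"
      unfolding matrix_vector_mult_def using h sP
      by (auto simp: abs_mult intro!: order.trans[OF sum_abs] sum_mono mult_left_mono)
    also have "\<dots> = B" by (simp add: sP flip: sum_distrib_right)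
    finally show ?thesis .
  qed
  define B where "B = norm f"
  have fB: "\<bar>f $ i\<bar> \<le> B" for i by (simp add: B_def component_le_norm_cart)
  have 1: "\<bar>(n_step P (k * m) *v f) $ i\<bar> \<le> (1 - e)^k * B" for k i
  proof (induction k arbitrary: i)
    case 0 then show ?case using fB by simp
  next
    case (Suc k)
    have "n_step P (Suc k * m) *v f = A *v (n_step P (k * m) *v f)"
      by (simp add: n_step_add A_def matrix_vector_mul_assoc)
    moreover have "(\<Sum>i\<in>UNIV. \<nu> $ i * (n_step P (k * m) *v f) $ i) = 0"
      using f invariant_sum_mult[OF invariant_n_step[OF nu'(3)]] by metis
    ultimately show ?case using contract[OF _ Suc.IH] by (simp add: mult.assoc)
  qed
  have 2: "\<bar>(n_step P (r + k * m) *v f) $ i\<bar> \<le> (1 - e)^k * B" for r k i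
  proof (induction r arbitrary: i)
    case 0 then show ?case using 1 by simp
  next
    case (Suc r)
    then show ?case using contract1[OF Suc.IH]
      by (simp add: n_step_Suc flip: matrix_vector_mul_assoc)
  qed
  have 3: "\<bar>(n_step P n *v f) $ i\<bar> \<le> (1 - e)^(n div m) * B" for n
    using 2[of "n mod m" "n div m" i] by simp
  have "(\<lambda>k. (1 - e)^k * B) \<longlonglongrightarrow> 0 * B"
    using epos e1 by (intro tendsto_intros LIMSEQ_power_zero) auto
  moreover have "filterlim (\<lambda>n. n div m) sequentially sequentially"
    unfolding filterlim_at_top
  proof
    fix Z
    show "eventually (\<lambda>n. Z \<le> n div m) sequentially"
      using m(1) by (intro eventually_sequentiallyI[of "Z * m"]) (simp add: less_eq_div_iff_mult_less_eq)
  qed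
  ultimately have "(\<lambda>n. (1 - e)^(n div m) * B) \<longlonglongrightarrow> 0"
    using filterlim_compose by fastforce
  then show ?thesis
    by (rule Lim_null_comparison[rotated]) (use 3 in auto)
qed

lemma n_step_tendsto_invariant:
  fixes P :: "real^'e^'e"
  assumes P: "stochastic_matrix P" "irreducible_matrix P" "aperiodic_matrix P"
    and nu: "invariant_probability P \<nu>"
  shows "(\<lambda>n. n_step P n $ i $ j) \<longlonglongrightarrow> \<nu> $ j"
proof -
  obtain m where m: "m \<ge> 1" "\<And>i j. 0 < n_step P m $ i $ j"
    using n_step_eventually_positive[OF P] by blast
  \<comment> \<open>The indicator of \<open>j\<close>, centred to have \<open>\<nu>\<close>-mean 0.\<close>
  define f :: "real^'e" where "f = axis j 1 - \<nu> $ j *\<^sub>R 1"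
  have fk: "f $ k = of_bool (k = j) - \<nu> $ j" for k
    by (simp add: f_def axis_def)
  have "(\<Sum>i\<in>UNIV. \<nu> $ i * f $ i) = 0"
  proof -
    have "(\<Sum>i\<in>UNIV. \<nu> $ i * of_bool (i = j)) = \<nu> $ j" by (subst sum.remove[of _ j]) auto
    moreover have "(\<Sum>i\<in>UNIV. \<nu> $ i * \<nu> $ j) = \<nu> $ j"
      using nu by (simp add: invariant_probability_def flip: sum_distrib_right)
    ultimately show ?thesis by (simp add: fk right_diff_distrib sum_subtractf)
  qed
  from n_step_centred_tendsto_0[OF P(1) nu m this]
  have "(\<lambda>n. (n_step P n *v f) $ i) \<longlonglongrightarrow> 0" .
  moreover have "(n_step P n *v f) $ i = n_step P n $ i $ j - \<nu> $ j" for n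
  proof -
    have "(\<Sum>k\<in>UNIV. n_step P n $ i $ k * of_bool (k = j)) = n_step P n $ i $ j"
      by (subst sum.remove[of _ j]) auto
    moreover have "(\<Sum>k\<in>UNIV. n_step P n $ i $ k * \<nu> $ j) = \<nu> $ j"
      using stochastic_n_step[OF P(1), of n] by (simp add: stochastic_matrix_def flip: sum_distrib_right)
    ultimately show ?thesis by (simp add: fk matrix_vector_mult_def right_diff_distrib sum_subtractf)
  qed
  ultimately show ?thesis by (simp add: LIM_zero_iff)
qed

lemma invariant_probability_pos:
  fixes P :: "real^'e^'e"
  assumes P: "stochastic_matrix P" "irreducible_matrix P" "aperiodic_matrix P"
    and nu: "invariant_probability P \<nu>"
  shows "0 < \<nu> $ j"
proof -
  obtain m where m: "\<And>i j. 0 < n_step P m $ i $ j"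
    using n_step_eventually_positive[OF P] by blast
  have nu': "0 \<le> \<nu> $ i" "(\<Sum>i\<in>UNIV. \<nu> $ i) = 1" "\<nu> v* P = \<nu>" for i
    using nu by (auto simp: invariant_probability_def)
  obtain k where k: "\<nu> $ k > 0"
    using nu' by (metis less_eq_real_def not_less sum_nonpos zero_less_one)
  have "0 < n_step P m $ k $ j * \<nu> $ k" using m k by simp
  also have "\<dots> \<le> (\<Sum>i\<in>UNIV. n_step P m $ i $ j * \<nu> $ i)"
    using m nu'(1) by (intro member_le_sum[of k UNIV "\<lambda>i. n_step P m $ i $ j * \<nu> $ i"]) (auto simp: less_imp_le)
  also have "\<dots> = (\<nu> v* n_step P m) $ j" by (simp add: vector_matrix_mult_def mult.commute)
  finally show ?thesis by (simp add: invariant_n_step nu')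
qed

text \<open>Adding the mean \<open>\<nu> \<bullet> g\<close> to \<open>g - P *v g\<close> gives an injective linear map, since its kernel consists of
\<open>P\<close>-invariant functions of mean 0, and these are 0 because \<open>P\<^sup>n\<close> sends them to 0 in the limit. In finite
dimension it is onto, and on preimages of mean-0 functions the added term vanishes.\<close>

lemma poisson_equation:
  fixes P :: "real^'e^'e"
  assumes P: "stochastic_matrix P" "irreducible_matrix P" "aperiodic_matrix P"
    and nu: "invariant_probability P \<nu>"
    and f: "(\<Sum>i\<in>UNIV. \<nu> $ i * f $ i) = 0"
  shows "\<exists>g. g - P *v g = f"
proof -
  obtain m where m: "m \<ge> 1" "\<And>i j. 0 < n_step P m $ i $ j"
    using n_step_eventually_positive[OF P] by blast
  have nu': "(\<Sum>i\<in>UNIV. \<nu> $ i) = 1" "\<nu> v* P = \<nu>"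
    using nu by (auto simp: invariant_probability_def)
  define T where "T g = g - P *v g + (\<Sum>i\<in>UNIV. \<nu> $ i * g $ i) *\<^sub>R 1" for g :: "real^'e"
  have nuT: "(\<Sum>i\<in>UNIV. \<nu> $ i * T g $ i) = (\<Sum>i\<in>UNIV. \<nu> $ i * g $ i)" for g
    using invariant_sum_mult[OF nu'(2), of g] nu'(1)
    by (simp add: T_def algebra_simps sum_subtractf sum.distrib)
      (simp flip: sum_distrib_right)
  have lin: "linear T"
    by (intro linearI)
      (auto simp: T_def vec_eq_iff matrix_vector_mult_def algebra_simps sum.distrib sum_distrib_left)
  have inj: "inj T"
    unfolding linear_injective_0[OF lin]
  proof (intro allI impI)
    fix g assume g: "T g = 0"
    then have g0: "(\<Sum>i\<in>UNIV. \<nu> $ i * g $ i) = 0" using nuT[of g] by simp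
    then have Pg: "P *v g = g" using g by (simp add: T_def)
    have "n_step P n *v g = g" for n
      by (induction n) (simp_all add: n_step_Suc Pg flip: matrix_vector_mul_assoc)
    then have "(\<lambda>n. g $ i) \<longlonglongrightarrow> 0" for i
      using n_step_centred_tendsto_0[OF P(1) nu m g0] by simp
    then have "g $ i = 0" for i by (simp add: LIMSEQ_const_iff)
    then show "g = 0" by (simp add: vec_eq_iff)
  qed
  have "surj T" by (rule linear_injective_imp_surjective[OF lin inj refl])
  then obtain g where g: "T g = f" by (metis surjE)
  then have "(\<Sum>i\<in>UNIV. \<nu> $ i * g $ i) = 0" using nuT[of g] f by simp
  then have "g - P *v g = f" using g by (simp add: T_def)
  then show ?thesis by blast
qed

section \<open>A Tauberian theorem with the weight of the inverse square root\<close>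

text \<open>The Taylor coefficients of \<open>1 / sqrt (1 - s)\<close>, which serve as the reference sequence in the Tauberian
theorem.\<close>

definition inv_sqrt_coeff :: "nat \<Rightarrow> real" where
  "inv_sqrt_coeff n = (-1)^n * ((-1/2) gchoose n)"

lemma inv_sqrt_coeff_Suc: "inv_sqrt_coeff (Suc n) = inv_sqrt_coeff n * ((real n + 1/2) / (real n + 1))"
proof -
  have "((-1/2 :: real) gchoose Suc n) = ((-1/2) gchoose n) * - ((real n + 1/2) / (real n + 1))"
    using gbinomial_absorb_comp[of "-1/2::real" n] gbinomial_absorption[of n "-1/2::real"]
      gbinomial_mult_1[of "-1/2::real" n]
    by (simp add: field_simps)
  then show ?thesis by (simp add: inv_sqrt_coeff_def)
qed

lemma inv_sqrt_coeff_pos: "0 < inv_sqrt_coeff n"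
proof (induction n)
  case 0 show ?case by (simp add: inv_sqrt_coeff_def)
next
  case (Suc n) then show ?case by (simp add: inv_sqrt_coeff_Suc)
qed

lemma inv_sqrt_coeff_le_1: "inv_sqrt_coeff n \<le> 1"
proof (induction n)
  case 0 show ?case by (simp add: inv_sqrt_coeff_def)
next
  case (Suc n)
  have "inv_sqrt_coeff n * ((real n + 1/2) / (real n + 1)) \<le> 1 * 1"
    using Suc by (intro mult_mono) auto
  then show ?case by (simp add: inv_sqrt_coeff_Suc)
qed

lemma inv_sqrt_coeff_sums:
  assumes "0 \<le> s" "s < 1"
  shows "(\<lambda>n. inv_sqrt_coeff n * s^n) sums (1 / sqrt (1 - s))"
proof -
  have "(\<lambda>n. ((-1/2) gchoose n) * (-s)^n) sums (1 + (-s)) powr (-1/2)"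
    using assms by (intro gen_binomial_real) auto
  moreover have "(1 + (-s)) powr (-1/2) = 1 / sqrt (1 - s)"
    using assms by (simp add: powr_minus powr_half_sqrt inverse_eq_divide flip: minus_divide_left)
  moreover have "((-1/2) gchoose n) * (-s)^n = inv_sqrt_coeff n * s^n" for n
    by (simp add: inv_sqrt_coeff_def power_minus[of s])
  ultimately show ?thesis by simp
qed

lemma inv_sqrt_coeff_asymp: "(\<lambda>n. sqrt (real n) * inv_sqrt_coeff n) \<longlonglongrightarrow> 1 / sqrt pi"
proof -
  have "(\<lambda>n. ((-1/2) gchoose n) / ((-1)^n / exp ((-1/2 + 1) * of_real (ln (real n))))) \<longlonglongrightarrow>
           inverse (Gamma (- (-1/2)) :: real)"
    by (rule gbinomial_asymptotic)
  moreover have "inverse (Gamma (- (-1/2)) :: real) = 1 / sqrt pi"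
    by (simp add: Gamma_one_half_real inverse_eq_divide)
  moreover have "\<forall>\<^sub>F n in sequentially. ((-1/2) gchoose n) / ((-1)^n / exp ((-1/2 + 1) * of_real (ln (real n))))
     = sqrt (real n) * inv_sqrt_coeff n"
    using eventually_gt_at_top[of 0]
  proof eventually_elim
    case (elim n)
    have "exp ((-1/2 + 1) * of_real (ln (real n))) = sqrt (real n)"
      using elim by (simp add: powr_half_sqrt[symmetric] powr_def)
    then show ?case by (cases "even n") (simp_all add: inv_sqrt_coeff_def mult.commute)
  qed
  ultimately show ?thesis using Lim_transform_eventually by fastforce
qed

lemma summable_bounded_power:
  fixes c :: "nat \<Rightarrow> real"
  assumes "\<And>n. \<bar>c n\<bar> \<le> D" "0 \<le> s" "s < 1"
  shows "summable (\<lambda>n. c n * s^n)"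
proof (rule summable_comparison_test')
  show "summable (\<lambda>n. D * s^n)" using assms by (intro summable_mult summable_geometric) auto
  show "norm (c n * s^n) \<le> D * s^n" if "n \<ge> 0" for n
    using assms by (auto simp: abs_mult intro!: mult_right_mono)
qed

lemma one_minus_exp_ge:
  assumes "N \<ge> 1"
  shows "1 / real N \<le> 2 * (1 - exp (- 1 / real N))"
proof -
  define x where "x = 1 / real N"
  have x: "0 < x" "x \<le> 1" using assms by (auto simp: x_def)
  have "1 + x \<le> exp x" by simp
  then have "exp (-x) \<le> 1 / (1 + x)" using x by (simp add: exp_minus field_simps)
  also have "\<dots> \<le> 1 - x / 2" using x by (simp add: field_simps power2_eq_square)
  finally show ?thesis by (simp add: x_def)
qed

lemma inv_sqrt_le:
  assumes "N \<ge> 1" "k \<ge> 1"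
  shows "1 / sqrt (real N) \<le> sqrt 2 * sqrt (1 - exp (- 1 / real N) ^ k)"
proof -
  have "exp (- 1 / real N) ^ k \<le> exp (- 1 / real N) ^ 1"
    using assms by (intro power_decreasing) auto
  then have "1 / real N \<le> 2 * (1 - exp (- 1 / real N) ^ k)"
    using one_minus_exp_ge[OF assms(1)] by simp
  then have "sqrt (1 / real N) \<le> sqrt (2 * (1 - exp (- 1 / real N) ^ k))" by (rule real_sqrt_le_mono)
  then show ?thesis by (simp only: real_sqrt_divide real_sqrt_mult real_sqrt_one)
qed

lemma exp_inverse_power_at_left:
  assumes "k \<ge> 1"
  shows "filterlim (\<lambda>N. exp (- 1 / real N) ^ k) (at_left 1) sequentially"
proof -
  have "(\<lambda>N. exp (- 1 / real N) ^ k) \<longlonglongrightarrow> (exp 0)^k"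
    by (intro tendsto_intros lim_const_over_n)
  moreover have "\<forall>\<^sub>F N in sequentially. exp (- 1 / real N) ^ k < 1"
    using eventually_gt_at_top[of 0] by eventually_elim (use assms in \<open>auto intro!: power_less_one_iff[THEN iffD2]\<close>)
  then have "\<forall>\<^sub>F N in sequentially. exp (- 1 / real N) ^ k \<in> {..<1} \<and> exp (- 1 / real N) ^ k \<noteq> 1"
    by eventually_elim auto
  ultimately show ?thesis unfolding filterlim_at by simp
qed

text \<open>Karamata's method. With \<open>s = exp (- 1 / N)\<close>, the hypothesis at \<open>s\<^sup>k\<^sup>+\<^sup>1\<close> is the claim for the test
function \<open>f x = x\<^sup>k\<close>, hence for polynomials; the bound on the absolute values carries it over to
uniform limits of polynomials.\<close>

lemma abel_null_continuous:
  fixes c :: "nat \<Rightarrow> real" and f :: "real \<Rightarrow> real"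
  assumes D: "\<And>n. \<bar>c n\<bar> \<le> D"
    and null: "((\<lambda>s. sqrt (1 - s) * (\<Sum>n. c n * s^n)) \<longlongrightarrow> 0) (at_left 1)"
    and K: "\<forall>\<^sub>F N in sequentially. (\<Sum>n. \<bar>c n\<bar> * exp (- 1 / real N) ^ n) / sqrt N \<le> K"
    and f: "continuous_on {0..1} f"
  shows "(\<lambda>N. (\<Sum>n. c n * exp (- 1 / real N) ^ n * f (exp (- 1 / real N) ^ n)) / sqrt N) \<longlonglongrightarrow> 0"
proof -
  let ?x = "\<lambda>N. exp (- 1 / real N)"
  have x: "0 < ?x N" "?x N < 1" if "N \<ge> 1" for N using that by auto
  have x01: "?x N ^ n \<in> {0..1}" for N n by (auto intro!: power_le_one)
  have power_null: "(\<lambda>N. (\<Sum>n. c n * (?x N ^ k) ^ n) / sqrt N) \<longlonglongrightarrow> 0" if k: "k \<ge> 1" for k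
  proof (rule Lim_null_comparison)
    have "(\<lambda>N. sqrt (1 - ?x N ^ k) * (\<Sum>n. c n * (?x N ^ k) ^ n)) \<longlonglongrightarrow> 0"
      by (rule filterlim_compose[OF null exp_inverse_power_at_left[OF k]])
    then show "(\<lambda>N. sqrt 2 * \<bar>sqrt (1 - ?x N ^ k) * (\<Sum>n. c n * (?x N ^ k) ^ n)\<bar>) \<longlonglongrightarrow> 0"
      using tendsto_mult_right_zero tendsto_rabs_zero by blast
    show "\<forall>\<^sub>F N in sequentially. norm ((\<Sum>n. c n * (?x N ^ k) ^ n) / sqrt N)
        \<le> sqrt 2 * \<bar>sqrt (1 - ?x N ^ k) * (\<Sum>n. c n * (?x N ^ k) ^ n)\<bar>"
      using eventually_ge_at_top[of 1]
    proof eventually_elim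
      case (elim N)
      have "1 / sqrt N * \<bar>\<Sum>n. c n * (?x N ^ k) ^ n\<bar> \<le>
          sqrt 2 * sqrt (1 - ?x N ^ k) * \<bar>\<Sum>n. c n * (?x N ^ k) ^ n\<bar>"
        by (intro mult_right_mono inv_sqrt_le elim k) auto
      moreover have "0 \<le> sqrt (1 - ?x N ^ k)" using x01[of N k] by auto
      ultimately show ?case by (simp add: abs_mult)
    qed
  qed
  have poly_null: "(\<lambda>N. (\<Sum>n. c n * ?x N ^ n * p (?x N ^ n)) / sqrt N) \<longlonglongrightarrow> 0"
    if p: "real_polynomial_function p" for p
  proof -
    obtain a m where am: "p = (\<lambda>x. \<Sum>k\<le>m. a k * x^k)"
      using p by (auto simp: real_polynomial_function_iff_sum)
    have "(\<lambda>N. \<Sum>k\<le>m. a k * ((\<Sum>n. c n * (?x N ^ Suc k) ^ n) / sqrt N)) \<longlonglongrightarrow> (\<Sum>k\<le>m. a k * 0)"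
      by (intro tendsto_sum tendsto_mult tendsto_const power_null) auto
    moreover have "\<forall>\<^sub>F N in sequentially. (\<Sum>k\<le>m. a k * ((\<Sum>n. c n * (?x N ^ Suc k) ^ n) / sqrt N)) =
        (\<Sum>n. c n * ?x N ^ n * p (?x N ^ n)) / sqrt N"
      using eventually_ge_at_top[of 1]
    proof eventually_elim
      case (elim N)
      have sm: "summable (\<lambda>n. c n * (?x N ^ Suc k) ^ n)" for k
        using x[OF elim] by (intro summable_bounded_power[OF D]) (auto intro!: power_Suc_less_one simp del: power_Suc)
      have "(\<Sum>k\<le>m. a k * ((\<Sum>n. c n * (?x N ^ Suc k) ^ n) / sqrt N))
          = (\<Sum>k\<le>m. (\<Sum>n. a k * (c n * (?x N ^ Suc k) ^ n))) / sqrt N"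
        by (simp only: suminf_mult[OF sm] sum_divide_distrib times_divide_eq_right)
      also have "(\<Sum>k\<le>m. (\<Sum>n. a k * (c n * (?x N ^ Suc k) ^ n))) = (\<Sum>n. \<Sum>k\<le>m. a k * (c n * (?x N ^ Suc k) ^ n))"
        by (intro suminf_sum[symmetric] summable_mult sm)
      also have "(\<lambda>n. \<Sum>k\<le>m. a k * (c n * (?x N ^ Suc k) ^ n)) = (\<lambda>n. c n * ?x N ^ n * p (?x N ^ n))"
        by (rule ext, simp only: am sum_distrib_left, intro sum.cong refl)
          (simp add: power_mult_distrib power_mult[symmetric] mult_ac)
      finally show ?case .
    qed
    ultimately show ?thesis by (auto elim: Lim_transform_eventually)
  qed
  show ?thesis
  proof (rule LIMSEQ_I)
    fix r :: real assume r: "0 < r"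
    define e where "e = r / (2 * (\<bar>K\<bar> + 1))"
    have e: "0 < e" using r by (auto simp: e_def)
    obtain p where p: "real_polynomial_function p" "\<And>x. x \<in> {0..1} \<Longrightarrow> \<bar>f x - p x\<bar> < e"
      using Stone_Weierstrass_real_polynomial_function[OF _ f e] by auto
    have "\<forall>\<^sub>F N in sequentially. \<bar>(\<Sum>n. c n * ?x N ^ n * p (?x N ^ n)) / sqrt N\<bar> < r / 2"
      using tendstoD[OF poly_null[OF p(1)], of "r/2"] r by (simp add: dist_real_def)
    then have "\<forall>\<^sub>F N in sequentially. norm ((\<Sum>n. c n * ?x N ^ n * f (?x N ^ n)) / sqrt N - 0) < r"
      using K eventually_ge_at_top[of 1]
    proof eventually_elim
      case (elim N)
      note xN = x[OF elim(3)]
      have "compact (f ` {0..1})" by (intro compact_continuous_image f) auto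
      then obtain Bf where Bf: "\<forall>y\<in>{0..1}. \<bar>f y\<bar> \<le> Bf"
        by (auto dest!: compact_imp_bounded simp: bounded_iff)
      have "0 \<le> Bf" using Bf by force
      have D0: "0 \<le> D" using D[of 0] by auto
      have smf: "summable (\<lambda>n. c n * f (?x N ^ n) * ?x N ^ n)"
        using xN D Bf x01 \<open>0 \<le> Bf\<close> D0 by (intro summable_bounded_power[of _ "D * Bf"]) (auto simp: abs_mult intro!: mult_mono)
      have dfp: "\<bar>c n * (f (?x N ^ n) - p (?x N ^ n))\<bar> \<le> \<bar>c n\<bar> * e" for n
        using p(2)[OF x01[of N n]] by (auto simp: abs_mult intro!: mult_left_mono)
      have sm1: "summable (\<lambda>n. c n * (f (?x N ^ n) - p (?x N ^ n)) * ?x N ^ n)"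
        using xN e D order.trans[OF dfp mult_right_mono[OF D]]
        by (intro summable_bounded_power[of _ "D * e"]) (auto simp: mult.commute)
      have sm2: "summable (\<lambda>n. \<bar>c n\<bar> * ?x N ^ n)"
        using xN D by (intro summable_bounded_power[of _ D]) auto
      have smp: "summable (\<lambda>n. c n * ?x N ^ n * p (?x N ^ n))"
        using summable_diff[OF smf sm1] by (simp add: algebra_simps)
      have "(\<Sum>n. c n * ?x N ^ n * f (?x N ^ n)) - (\<Sum>n. c n * ?x N ^ n * p (?x N ^ n))
          = (\<Sum>n. c n * (f (?x N ^ n) - p (?x N ^ n)) * ?x N ^ n)"
        using smf smp by (subst suminf_diff) (simp_all add: algebra_simps)
      also have "\<bar>\<dots>\<bar> \<le> (\<Sum>n. e * (\<bar>c n\<bar> * ?x N ^ n))"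
      proof -
        have "norm (\<Sum>n. c n * (f (?x N ^ n) - p (?x N ^ n)) * ?x N ^ n) \<le> (\<Sum>n. e * (\<bar>c n\<bar> * ?x N ^ n))"
        proof (rule norm_suminf_le[OF _ summable_mult[OF sm2]])
          fix n
          have "norm (c n * (f (?x N ^ n) - p (?x N ^ n)) * ?x N ^ n) =
              \<bar>c n * (f (?x N ^ n) - p (?x N ^ n))\<bar> * ?x N ^ n" by (simp add: abs_mult)
          also have "\<dots> \<le> (\<bar>c n\<bar> * e) * ?x N ^ n" by (intro mult_right_mono dfp) auto
          finally show "norm (c n * (f (?x N ^ n) - p (?x N ^ n)) * ?x N ^ n) \<le> e * (\<bar>c n\<bar> * ?x N ^ n)"
            by (simp only: mult_ac)
        qed
        then show ?thesis by simp
      qed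
      also have "\<dots> = e * (\<Sum>n. \<bar>c n\<bar> * ?x N ^ n)" by (rule suminf_mult[OF sm2])
      finally have "\<bar>(\<Sum>n. c n * ?x N ^ n * f (?x N ^ n)) - (\<Sum>n. c n * ?x N ^ n * p (?x N ^ n))\<bar> / sqrt N
          \<le> e * (\<Sum>n. \<bar>c n\<bar> * ?x N ^ n) / sqrt N" by (intro divide_right_mono) auto
      also have "\<dots> \<le> e * K" using elim(2) e by (simp flip: times_divide_eq_right)
      also have "\<dots> \<le> r / 2"
      proof -
        have "e * K \<le> e * (\<bar>K\<bar> + 1)" using e by (intro mult_left_mono) auto
        also have "\<dots> = r / 2" by (simp add: e_def field_simps)
        finally show ?thesis .
      qed
      finally have "\<bar>(\<Sum>n. c n * ?x N ^ n * f (?x N ^ n)) / sqrt N - (\<Sum>n. c n * ?x N ^ n * p (?x N ^ n)) / sqrt N\<bar> \<le> r / 2"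
        by (simp flip: diff_divide_distrib)
      then show ?case using elim(1) unfolding real_norm_def by linarith
    qed
    then show "\<exists>no. \<forall>n\<ge>no. norm ((\<Sum>na. c na * ?x n ^ na * f (?x n ^ na)) / sqrt n - 0) < r"
      by (simp add: eventually_sequentially)
  qed
qed

text \<open>A continuous test function whose support, at \<open>x = exp (- n / N)\<close>, is the window \<open>p N < n < q N\<close>.\<close>

definition window :: "real \<Rightarrow> real \<Rightarrow> real \<Rightarrow> real" where
  "window p q x = max 0 (min (x - exp (- q)) (exp (- p) - x))"

lemma window_nonneg: "0 \<le> window p q x"
  by (simp add: window_def)

lemma continuous_on_window: "continuous_on A (window p q)"
  unfolding window_def by (intro continuous_intros)

lemma exp_power_eq: "exp (- 1 / real N) ^ n = exp (- (real n / real N))"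
  by (simp flip: exp_of_nat_mult)

lemma window_support:
  assumes "N \<ge> 1" "window p q (exp (- 1 / real N) ^ n) \<noteq> 0"
  shows "p * N < n" "n < q * N"
proof -
  have "exp (- q) < y" "y < exp (- p)" if "window p q y \<noteq> 0" for y
    using that by (auto simp: window_def max_def min_def split: if_splits)
  from this[OF assms(2)] have "exp (- q) < exp (- (real n / real N))" "exp (- (real n / real N)) < exp (- p)"
    unfolding exp_power_eq by blast+
  then have "real n / real N < q" "p < real n / real N" by auto
  then show "p * N < n" "n < q * N" using assms(1) by (auto simp: field_simps)
qed

lemma window_mass:
  assumes pq: "0 \<le> p" "p < q"
  shows "\<exists>c>0. \<forall>\<^sub>F N in sequentially.
    c * real N \<le> (\<Sum>n\<le>nat \<lceil>q * N\<rceil>. exp (- 1 / real N) ^ n * window p q (exp (- 1 / real N) ^ n))"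
proof -
  define d where "d = (q - p) / 3"
  define c1 where "c1 = exp (- q) * min (exp (- (q - d)) - exp (- q)) (exp (- p) - exp (- (p + d)))"
  have d: "0 < d" using pq by (simp add: d_def)
  have c1: "0 < c1" using d by (simp add: c1_def)
  have "\<forall>\<^sub>F N in sequentially. (c1 * d / 2) * real N \<le>
      (\<Sum>n\<le>nat \<lceil>q * N\<rceil>. exp (- 1 / real N) ^ n * window p q (exp (- 1 / real N) ^ n))"
    using eventually_ge_at_top[of "nat \<lceil>2 / d\<rceil>"] eventually_ge_at_top[of 1]
  proof eventually_elim
    case (elim N)
    define u v where "u = nat \<lceil>(p + d) * N\<rceil>" and "v = nat \<lfloor>(q - d) * N\<rfloor>"
    have qd: "q - d = p + d + d" by (simp add: d_def field_simps)
    have N: "2 / d \<le> real N" using elim(1) by linarith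
    then have Nd: "2 \<le> real N * d" using d by (simp add: field_simps)
    have u: "real u \<le> (p + d) * N + 1" "(p + d) * N \<le> real u"
      unfolding u_def using pq d by (auto simp: of_nat_nat ceiling_le_iff)
    have v: "(q - d) * N - 1 \<le> real v" "real v \<le> (q - d) * N"
      unfolding v_def using pq d qd by (auto simp: of_nat_nat)
    have "u \<le> v + 1"
    proof -
      have "real u \<le> real v + 1" using u v Nd qd by (simp add: algebra_simps)
      then show ?thesis by linarith
    qed
    have "(c1 * d / 2) * real N \<le> c1 * (real v + 1 - real u)"
    proof -
      have "(d / 2) * real N \<le> real v + 1 - real u" using u v Nd qd by (simp add: algebra_simps)
      then have "c1 * ((d / 2) * real N) \<le> c1 * (real v + 1 - real u)" using c1 by (intro mult_left_mono) auto
      then show ?thesis by simp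
    qed
    also have "\<dots> = (\<Sum>n\<in>{u..v}. c1)" using \<open>u \<le> v + 1\<close> by (simp add: of_nat_diff)
    also have "\<dots> \<le> (\<Sum>n\<in>{u..v}. exp (- 1 / real N) ^ n * window p q (exp (- 1 / real N) ^ n))"
    proof (rule sum_mono)
      fix n assume "n \<in> {u..v}"
      then have "(p + d) * N \<le> real n" "real n \<le> (q - d) * N" using u v by auto
      then have n: "p + d \<le> real n / N" "real n / N \<le> q - d" using elim(2) by (auto simp: field_simps)
      then have "exp (- (q - d)) \<le> exp (- (real n / N))" "exp (- (real n / N)) \<le> exp (- (p + d))"
        "exp (- q) \<le> exp (- (real n / N))" using d by auto
      then show "c1 \<le> exp (- 1 / real N) ^ n * window p q (exp (- 1 / real N) ^ n)"
      proof -
        assume y: "exp (- (q - d)) \<le> exp (- (real n / N))" "exp (- (real n / N)) \<le> exp (- (p + d))"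
          "exp (- q) \<le> exp (- (real n / N))"
        have "min (exp (- (q - d)) - exp (- q)) (exp (- p) - exp (- (p + d))) \<le>
            window p q (exp (- (real n / real N)))"
          unfolding window_def using y by linarith
        then show ?thesis
          unfolding c1_def exp_power_eq using d y(3) by (intro mult_mono) auto
      qed
    qed
    also have "\<dots> \<le> (\<Sum>n\<le>nat \<lceil>q * N\<rceil>. exp (- 1 / real N) ^ n * window p q (exp (- 1 / real N) ^ n))"
    proof (intro sum_mono2)
      have "v \<le> nat \<lceil>q * N\<rceil>"
      proof -
        have "real v \<le> q * N" using v(2) d by (simp add: algebra_simps) (smt (verit) mult_nonneg_nonneg of_nat_0_le_iff)
        then show ?thesis by linarith
      qed
      then show "{u..v} \<subseteq> {..nat \<lceil>q * N\<rceil>}" by auto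
    qed (auto simp: window_nonneg)
    finally show ?case .
  qed
  then show ?thesis using c1 d by (intro exI[of _ "c1 * d / 2"]) auto
qed

text \<open>The difference between \<open>a\<close> and \<open>L\<close> times the reference coefficients \<open>b\<close> is null for every continuous
test function. With a window just below \<open>N\<close>, monotonicity bounds \<open>a N\<close> from above by the windowed
average of \<open>a\<close>, thus by \<open>L\<close> times that of \<open>b\<close>, which is close to \<open>1 / sqrt (pi N)\<close>. A window just
above \<open>N\<close> bounds \<open>a N\<close> from below.\<close>

theorem tauberian_inv_sqrt:
  fixes a :: "nat \<Rightarrow> real"
  assumes a0: "\<And>n. 0 \<le> a n" and dec: "decseq a"
    and lim: "((\<lambda>s. sqrt (1 - s) * (\<Sum>n. a n * s^n)) \<longlongrightarrow> L) (at_left 1)"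
  shows "(\<lambda>n. sqrt (real n) * a n) \<longlonglongrightarrow> L / sqrt pi"
proof -
  let ?x = "\<lambda>N. exp (- 1 / real N)" and ?b = inv_sqrt_coeff
  have aD: "\<bar>a n\<bar> \<le> a 0" for n using a0 decseqD[OF dec, of 0 n] by auto
  have bD: "\<bar>?b n\<bar> \<le> 1" for n using inv_sqrt_coeff_pos[of n] inv_sqrt_coeff_le_1[of n] by auto
  have ev01: "\<forall>\<^sub>F s :: real in at_left 1. 0 < s \<and> s < 1"
    using eventually_at_left_real[of 0 1] by (auto simp: greaterThanLessThan_iff)
  have sma: "summable (\<lambda>n. a n * s^n)" and smb: "summable (\<lambda>n. ?b n * s^n)" if "0 \<le> s" "s < 1" for s
    using that by (intro summable_bounded_power[OF aD] summable_bounded_power[OF bD]; simp)+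
  have L0: "0 \<le> L"
  proof (rule tendsto_lowerbound[OF lim])
    show "\<forall>\<^sub>F s in at_left 1. 0 \<le> sqrt (1 - s) * (\<Sum>n. a n * s^n)"
      using ev01 by eventually_elim (auto intro!: mult_nonneg_nonneg suminf_nonneg sma a0)
  qed simp
  define c where "c n = a n - L * ?b n" for n
  have cD: "\<bar>c n\<bar> \<le> a 0 + L" for n
  proof -
    have "\<bar>c n\<bar> \<le> \<bar>a n\<bar> + L * \<bar>?b n\<bar>" unfolding c_def using L0
      by (metis abs_mult abs_of_nonneg abs_triangle_ineq4)
    also have "\<dots> \<le> a 0 + L * 1" using L0 by (intro add_mono mult_left_mono aD bD)
    finally show ?thesis by simp
  qed
  have null: "((\<lambda>s. sqrt (1 - s) * (\<Sum>n. c n * s^n)) \<longlongrightarrow> 0) (at_left 1)"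
  proof -
    have "((\<lambda>s. sqrt (1 - s) * (\<Sum>n. a n * s^n) - L) \<longlongrightarrow> L - L) (at_left 1)"
      by (intro tendsto_intros lim)
    moreover have "\<forall>\<^sub>F s in at_left 1. sqrt (1 - s) * (\<Sum>n. a n * s^n) - L = sqrt (1 - s) * (\<Sum>n. c n * s^n)"
      using ev01
    proof eventually_elim
      case (elim s)
      have "(\<Sum>n. c n * s^n) = (\<Sum>n. a n * s^n - L * (?b n * s^n))"
        by (simp add: c_def algebra_simps)
      also have "\<dots> = (\<Sum>n. a n * s^n) - (\<Sum>n. L * (?b n * s^n))"
        using elim by (intro suminf_diff[symmetric] sma summable_mult smb) auto
      also have "(\<Sum>n. L * (?b n * s^n)) = L * (\<Sum>n. ?b n * s^n)"
        using elim by (intro suminf_mult smb) auto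
      also have "(\<Sum>n. ?b n * s^n) = 1 / sqrt (1 - s)"
        using elim inv_sqrt_coeff_sums[of s] by (simp add: sums_iff)
      finally show ?case using elim by (simp add: right_diff_distrib)
    qed
    ultimately show ?thesis using Lim_transform_eventually by fastforce
  qed
  have K: "\<forall>\<^sub>F N in sequentially. (\<Sum>n. \<bar>c n\<bar> * ?x N ^ n) / sqrt N \<le> sqrt 2 * ((L + 1) + L)"
  proof -
    have "(\<lambda>N. sqrt (1 - ?x N ^ 1) * (\<Sum>n. a n * (?x N ^ 1)^n)) \<longlonglongrightarrow> L"
      by (rule filterlim_compose[OF lim exp_inverse_power_at_left]) simp
    then have "\<forall>\<^sub>F N in sequentially. sqrt (1 - ?x N ^ 1) * (\<Sum>n. a n * (?x N ^ 1)^n) < L + 1"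
      by (rule order_tendstoD) simp
    then show ?thesis using eventually_ge_at_top[of 1]
    proof eventually_elim
      case (elim N)
      have x: "0 \<le> ?x N" "?x N < 1" using elim(2) by auto
      have cle: "\<bar>c n\<bar> \<le> a n + L * ?b n" for n
        using a0[of n] L0 inv_sqrt_coeff_pos[of n] by (auto simp: c_def abs_le_iff)
      have sumb: "(\<Sum>n. ?b n * ?x N ^n) = 1 / sqrt (1 - ?x N)"
        using x inv_sqrt_coeff_sums[of "?x N"] by (simp add: sums_iff)
      have sm: "summable (\<lambda>n. \<bar>c n\<bar> * ?x N ^ n)"
        using x cD by (intro summable_bounded_power[of _ "a 0 + L"]) auto
      have "(\<Sum>n. \<bar>c n\<bar> * ?x N ^ n) \<le> (\<Sum>n. a n * ?x N ^ n + L * (?b n * ?x N ^ n))"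
      proof (rule suminf_le[OF _ sm])
        show "summable (\<lambda>n. a n * ?x N ^ n + L * (?b n * ?x N ^ n))"
          by (intro summable_add summable_mult sma smb x)
        fix n
        have "\<bar>c n\<bar> * ?x N ^ n \<le> (a n + L * ?b n) * ?x N ^ n" by (intro mult_right_mono cle) auto
        then show "\<bar>c n\<bar> * ?x N ^ n \<le> a n * ?x N ^ n + L * (?b n * ?x N ^ n)" by (simp add: algebra_simps)
      qed
      also have "\<dots> = (\<Sum>n. a n * ?x N ^ n) + L * (1 / sqrt (1 - ?x N))"
        using suminf_add[OF sma[OF x] summable_mult[OF smb[OF x], of L]] suminf_mult[OF smb[OF x], of L] sumb
        by simp
      finally have le: "(\<Sum>n. \<bar>c n\<bar> * ?x N ^ n) \<le> \<dots>" .
      have "(\<Sum>n. \<bar>c n\<bar> * ?x N ^ n) / sqrt N \<le> ((\<Sum>n. a n * ?x N ^ n) + L * (1 / sqrt (1 - ?x N))) * (1 / sqrt N)"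
        using le by (simp add: divide_right_mono)
      also have "\<dots> \<le> ((\<Sum>n. a n * ?x N ^ n) + L * (1 / sqrt (1 - ?x N))) * (sqrt 2 * sqrt (1 - ?x N ^ 1))"
        using x L0 by (intro mult_left_mono inv_sqrt_le elim add_nonneg_nonneg suminf_nonneg sma)
          (auto simp: a0)
      also have "\<dots> = sqrt 2 * (sqrt (1 - ?x N ^ 1) * (\<Sum>n. a n * (?x N ^ 1)^n) + L)"
        using x by (simp add: field_simps)
      also have "\<dots> \<le> sqrt 2 * ((L + 1) + L)"
        using elim(1) by (intro mult_left_mono) auto
      finally show ?case .
    qed
  qed
  define w where "w p q N n = ?x N ^ n * window p q (?x N ^ n)" for p q :: real and N n :: nat
  define W where "W p q d N = (\<Sum>n\<le>nat \<lceil>q * N\<rceil>. d n * w p q N n)" for p q :: real and d :: "nat \<Rightarrow> real" and N :: nat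
  have w0: "0 \<le> w p q N n" for p q N n by (simp add: w_def window_nonneg)
  have wsupp: "p * N < n \<and> n < q * N" if "N \<ge> 1" "w p q N n \<noteq> 0" for p q N n
    using window_support[of N p q n] that by (auto simp: w_def)
  have Wnull: "(\<lambda>N. sqrt N * (W p q a N - L * W p q ?b N) / W p q (\<lambda>_. 1) N) \<longlonglongrightarrow> 0"
    and Wpos: "\<forall>\<^sub>F N in sequentially. 0 < W p q (\<lambda>_. 1) N" if pq: "0 \<le> p" "p < q" for p q
  proof -
    obtain k where k: "k > 0" "\<forall>\<^sub>F N in sequentially. k * real N \<le> W p q (\<lambda>_. 1) N"
      using window_mass[OF pq] by (auto simp: W_def w_def)
    show "\<forall>\<^sub>F N in sequentially. 0 < W p q (\<lambda>_. 1) N"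
      using k(2) eventually_gt_at_top[of 0]
    proof eventually_elim
      case (elim N)
      then have "0 < k * real N" using k(1) by simp
      then show ?case using elim by linarith
    qed
    have Wc: "(\<lambda>N. W p q c N / sqrt N) \<longlonglongrightarrow> 0"
    proof (rule Lim_transform_eventually)
      show "(\<lambda>N. (\<Sum>n. c n * ?x N ^ n * window p q (?x N ^ n)) / sqrt N) \<longlonglongrightarrow> 0"
        by (rule abel_null_continuous[OF cD null K continuous_on_window])
      show "\<forall>\<^sub>F N in sequentially. (\<Sum>n. c n * ?x N ^ n * window p q (?x N ^ n)) / sqrt N = W p q c N / sqrt N"
        using eventually_ge_at_top[of 1]
      proof eventually_elim
        case (elim N)
        have "(\<Sum>n. c n * w p q N n) = W p q c N"
          unfolding W_def
        proof (rule suminf_finite)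
          fix n assume "n \<notin> {..nat \<lceil>q * real N\<rceil>}"
          then have "q * N \<le> n" by simp linarith
          then show "c n * w p q N n = 0" using wsupp[OF elim, of p q n] by fastforce
        qed simp
        then show ?case by (simp add: w_def mult.assoc)
      qed
    qed
    show "(\<lambda>N. sqrt N * (W p q a N - L * W p q ?b N) / W p q (\<lambda>_. 1) N) \<longlonglongrightarrow> 0"
    proof (rule Lim_null_comparison)
      show "(\<lambda>N. \<bar>W p q c N / sqrt N\<bar> * (1 / k)) \<longlonglongrightarrow> 0"
        using Wc by (intro tendsto_mult_left_zero tendsto_rabs_zero)
      show "\<forall>\<^sub>F N in sequentially. norm (sqrt N * (W p q a N - L * W p q ?b N) / W p q (\<lambda>_. 1) N)
          \<le> \<bar>W p q c N / sqrt N\<bar> * (1 / k)"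
        using k(2) eventually_ge_at_top[of 1]
      proof eventually_elim
        case (elim N)
        have kN: "0 < k * real N" using k elim by simp
        have "W p q a N - L * W p q ?b N = W p q c N"
          by (simp add: W_def c_def left_diff_distrib sum_subtractf sum_distrib_left mult.assoc)
        then have "norm (sqrt N * (W p q a N - L * W p q ?b N) / W p q (\<lambda>_. 1) N) = sqrt N * \<bar>W p q c N\<bar> / W p q (\<lambda>_. 1) N"
          using elim(1) kN by (simp add: abs_mult)
        also have "\<dots> \<le> sqrt N * \<bar>W p q c N\<bar> / (k * real N)"
          using elim kN by (intro divide_left_mono) auto
        also have "\<dots> = \<bar>W p q c N / sqrt N\<bar> * (1 / k)"
          using elim(2) k(1) by (simp add: field_simps flip: power2_eq_square)
        finally show ?case .
      qed
    qed
  qed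
  \<comment> \<open>The window is \<open>(1 - e) N < n < N\<close>; there \<open>a n \<ge> a N\<close> and \<open>b n\<close> is at most about \<open>1 / sqrt (pi (1 - e) N)\<close>.\<close>
  have upper: "\<forall>\<^sub>F N in sequentially. sqrt N * a N < L * (1 / sqrt pi + e) / sqrt (1 - e) + e" if e: "0 < e" "e < 1" for e
  proof -
    define p where "p = 1 - e"
    have p: "0 < p" "p < 1" using e by (auto simp: p_def)
    have "\<forall>\<^sub>F n in sequentially. sqrt n * ?b n < 1 / sqrt pi + e"
      using order_tendstoD(2)[OF inv_sqrt_coeff_asymp] e by simp
    then obtain n0 where n0: "\<And>n. n \<ge> n0 \<Longrightarrow> sqrt n * ?b n < 1 / sqrt pi + e" by (auto simp: eventually_sequentially)
    have "\<forall>\<^sub>F N in sequentially. sqrt N * (W p 1 a N - L * W p 1 ?b N) / W p 1 (\<lambda>_. 1) N < e"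
      using order_tendstoD(2)[OF Wnull[of p 1]] p e by simp
    then show ?thesis
      using Wpos[OF less_imp_le[OF p(1)] p(2)] eventually_ge_at_top[of "nat \<lceil>n0 / p\<rceil>"] eventually_ge_at_top[of 1]
    proof eventually_elim
      case (elim N)
      have W: "0 < W p 1 (\<lambda>_. 1) N" using elim(2) p by simp
      have N0: "n0 \<le> p * N" using elim(3) p by (simp add: field_simps)
      have "a N * W p 1 (\<lambda>_. 1) N = (\<Sum>n\<le>nat \<lceil>1 * real N\<rceil>. a N * w p 1 N n)"
        by (simp add: W_def sum_distrib_left)
      also have "\<dots> \<le> W p 1 a N"
        unfolding W_def
      proof (rule sum_mono)
        fix n show "a N * w p 1 N n \<le> a n * w p 1 N n"
          using wsupp[OF elim(4), of p 1 n] decseqD[OF dec, of n N] w0[of p 1 N n]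
          by (cases "w p 1 N n = 0") (auto intro!: mult_right_mono)
      qed
      finally have A: "a N * W p 1 (\<lambda>_. 1) N \<le> W p 1 a N" .
      have "W p 1 ?b N \<le> (\<Sum>n\<le>nat \<lceil>1 * real N\<rceil>. (1 / sqrt pi + e) / sqrt (p * N) * w p 1 N n)"
        unfolding W_def
      proof (rule sum_mono)
        fix n show "?b n * w p 1 N n \<le> (1 / sqrt pi + e) / sqrt (p * N) * w p 1 N n"
        proof (cases "w p 1 N n = 0")
          case False
          then have n: "p * N < n" using wsupp[OF elim(4)] by blast
          then have "n0 \<le> n" using N0 by linarith
          have pN: "0 < p * N" using p elim(4) by simp
          then have n1: "0 < real n" using n by linarith
          have "?b n \<le> (1 / sqrt pi + e) / sqrt n"
            using n0[OF \<open>n0 \<le> n\<close>] n1 by (simp add: field_simps)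
          also have "\<dots> \<le> (1 / sqrt pi + e) / sqrt (p * N)"
            using n pN n1 e by (intro divide_left_mono) auto
          finally show ?thesis using w0 by (intro mult_right_mono)
        qed simp
      qed
      also have "\<dots> = (1 / sqrt pi + e) / sqrt (p * N) * W p 1 (\<lambda>_. 1) N"
        by (simp add: W_def sum_distrib_left)
      finally have B: "W p 1 ?b N \<le> (1 / sqrt pi + e) / sqrt (p * N) * W p 1 (\<lambda>_. 1) N" .
      have "sqrt N * a N = sqrt N * (a N * W p 1 (\<lambda>_. 1) N) / W p 1 (\<lambda>_. 1) N" using W by simp
      also have "\<dots> \<le> sqrt N * W p 1 a N / W p 1 (\<lambda>_. 1) N"
        using A W by (intro divide_right_mono mult_left_mono) auto
      also have "\<dots> = sqrt N * (W p 1 a N - L * W p 1 ?b N) / W p 1 (\<lambda>_. 1) N + sqrt N * (L * W p 1 ?b N) / W p 1 (\<lambda>_. 1) N"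
        by (simp add: right_diff_distrib diff_divide_distrib)
      also have "sqrt N * (L * W p 1 ?b N) / W p 1 (\<lambda>_. 1) N \<le>
          sqrt N * (L * ((1 / sqrt pi + e) / sqrt (p * N) * W p 1 (\<lambda>_. 1) N)) / W p 1 (\<lambda>_. 1) N"
        using B W L0 by (intro divide_right_mono mult_left_mono) auto
      also have "\<dots> = L * (1 / sqrt pi + e) / sqrt p" using W elim(4) p by (simp add: real_sqrt_mult)
      finally show ?case using elim(1) unfolding p_def by simp
    qed
  qed
  \<comment> \<open>The window is \<open>N < n < (1 + e) N\<close>, with all inequalities reversed.\<close>
  have lower: "\<forall>\<^sub>F N in sequentially. L * (1 / sqrt pi - e) / sqrt (1 + e) - e < sqrt N * a N" if e: "0 < e" "e < 1 / sqrt pi" for e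
  proof -
    define q where "q = 1 + e"
    have q: "1 < q" using e by (auto simp: q_def)
    have "\<forall>\<^sub>F n in sequentially. 1 / sqrt pi - e < sqrt n * ?b n"
      using order_tendstoD(1)[OF inv_sqrt_coeff_asymp] e by simp
    then obtain n0 where n0: "\<And>n. n \<ge> n0 \<Longrightarrow> 1 / sqrt pi - e < sqrt n * ?b n" by (auto simp: eventually_sequentially)
    have "\<forall>\<^sub>F N in sequentially. - e < sqrt N * (W 1 q a N - L * W 1 q ?b N) / W 1 q (\<lambda>_. 1) N"
      using order_tendstoD(1)[OF Wnull[of 1 q]] q e by simp
    then show ?thesis
      using Wpos[OF zero_le_one q] eventually_ge_at_top[of n0] eventually_ge_at_top[of 1]
    proof eventually_elim
      case (elim N)
      have W: "0 < W 1 q (\<lambda>_. 1) N" using elim(2) q by simp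
      have "W 1 q a N \<le> (\<Sum>n\<le>nat \<lceil>q * real N\<rceil>. a N * w 1 q N n)"
        unfolding W_def
      proof (rule sum_mono)
        fix n show "a n * w 1 q N n \<le> a N * w 1 q N n"
          using wsupp[OF elim(4), of 1 q n] decseqD[OF dec, of N n] w0[of 1 q N n]
          by (cases "w 1 q N n = 0") (auto intro!: mult_right_mono)
      qed
      also have "\<dots> = a N * W 1 q (\<lambda>_. 1) N" by (simp add: W_def sum_distrib_left)
      finally have A: "W 1 q a N \<le> a N * W 1 q (\<lambda>_. 1) N" .
      have "(1 / sqrt pi - e) / sqrt (q * N) * W 1 q (\<lambda>_. 1) N = (\<Sum>n\<le>nat \<lceil>q * real N\<rceil>. (1 / sqrt pi - e) / sqrt (q * N) * w 1 q N n)"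
        by (simp add: W_def sum_distrib_left)
      also have "\<dots> \<le> W 1 q ?b N"
        unfolding W_def
      proof (rule sum_mono)
        fix n show "(1 / sqrt pi - e) / sqrt (q * N) * w 1 q N n \<le> ?b n * w 1 q N n"
        proof (cases "w 1 q N n = 0")
          case False
          then have n: "real N < real n" "n < q * N" using wsupp[OF elim(4), of 1 q n] by auto
          then have n1: "n0 \<le> n" "0 < real n" using elim by linarith+
          have "(1 / sqrt pi - e) / sqrt (q * N) \<le> (1 / sqrt pi - e) / sqrt n"
            using n n1 e by (intro divide_left_mono) auto
          also have "\<dots> \<le> ?b n"
            using n0[OF n1(1)] n1 by (simp add: field_simps)
          finally show ?thesis using w0 by (intro mult_right_mono)
        qed simp
      qed
      finally have B: "(1 / sqrt pi - e) / sqrt (q * N) * W 1 q (\<lambda>_. 1) N \<le> W 1 q ?b N" .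
      have "L * (1 / sqrt pi - e) / sqrt q = sqrt N * (L * ((1 / sqrt pi - e) / sqrt (q * N) * W 1 q (\<lambda>_. 1) N)) / W 1 q (\<lambda>_. 1) N"
        using W elim(4) q by (simp add: real_sqrt_mult)
      also have "\<dots> \<le> sqrt N * (L * W 1 q ?b N) / W 1 q (\<lambda>_. 1) N"
        using B W L0 by (intro divide_right_mono mult_left_mono) auto
      also have "\<dots> = sqrt N * W 1 q a N / W 1 q (\<lambda>_. 1) N - sqrt N * (W 1 q a N - L * W 1 q ?b N) / W 1 q (\<lambda>_. 1) N"
        by (simp add: right_diff_distrib diff_divide_distrib)
      also have "sqrt N * W 1 q a N / W 1 q (\<lambda>_. 1) N \<le> sqrt N * (a N * W 1 q (\<lambda>_. 1) N) / W 1 q (\<lambda>_. 1) N"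
        using A W by (intro divide_right_mono mult_left_mono) auto
      also have "\<dots> = sqrt N * a N" using W by simp
      finally show ?case using elim(1) unfolding q_def by simp
    qed
  qed
  show ?thesis
  proof (rule order_tendstoI)
    fix y assume y: "y < L / sqrt pi"
    have "((\<lambda>e. L * (1 / sqrt pi - e) / sqrt (1 + e) - e) \<longlongrightarrow> L * (1 / sqrt pi - 0) / sqrt (1 + 0) - 0) (at_right 0)"
      by (intro tendsto_intros) auto
    then have "\<forall>\<^sub>F e in at_right 0. y < L * (1 / sqrt pi - e) / sqrt (1 + e) - e"
      using y by (intro order_tendstoD) auto
    moreover have "\<forall>\<^sub>F e in at_right (0::real). e \<in> {0<..<1 / sqrt pi}"
      by (rule eventually_at_right_real) simp
    ultimately have "\<forall>\<^sub>F e in at_right 0. e \<in> {0<..<1 / sqrt pi} \<and> y < L * (1 / sqrt pi - e) / sqrt (1 + e) - e"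
      by eventually_elim auto
    then obtain e where e: "e \<in> {0<..<1 / sqrt pi}" "y < L * (1 / sqrt pi - e) / sqrt (1 + e) - e"
      using eventually_happens trivial_limit_at_right_real by blast
    then show "\<forall>\<^sub>F n in sequentially. y < sqrt n * a n"
      using lower[of e] by (auto elim!: eventually_mono)
  next
    fix y assume y: "L / sqrt pi < y"
    have "((\<lambda>e. L * (1 / sqrt pi + e) / sqrt (1 - e) + e) \<longlongrightarrow> L * (1 / sqrt pi + 0) / sqrt (1 - 0) + 0) (at_right 0)"
      by (intro tendsto_intros) auto
    then have "\<forall>\<^sub>F e in at_right 0. L * (1 / sqrt pi + e) / sqrt (1 - e) + e < y"
      using y by (intro order_tendstoD) auto
    moreover have "\<forall>\<^sub>F e in at_right (0::real). e \<in> {0<..<1}"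
      by (rule eventually_at_right_real) simp
    ultimately have "\<forall>\<^sub>F e in at_right 0. e \<in> {0<..<1} \<and> L * (1 / sqrt pi + e) / sqrt (1 - e) + e < y"
      by eventually_elim auto
    then obtain e where e: "e \<in> {0<..<1}" "L * (1 / sqrt pi + e) / sqrt (1 - e) + e < y"
      using eventually_happens trivial_limit_at_right_real by blast
    then show "\<forall>\<^sub>F n in sequentially. sqrt n * a n < y"
      using upper[of e] by (auto elim!: eventually_mono)
  qed
qed

section \<open>The Markov property of an additive walk\<close>

locale additive_walk =
  fixes P :: "real^'e^'e" and F :: "'e \<Rightarrow> 'e \<Rightarrow> real measure"
    and M :: "'w measure" and Y :: "nat \<Rightarrow> 'w \<Rightarrow> real" and X :: "nat \<Rightarrow> 'w \<Rightarrow> 'e" and i :: 'e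
  assumes stoch: "stochastic_matrix P"
    and F_prob: "\<And>k j. prob_space (F k j)" and F_sets: "\<And>k j. sets (F k j) = sets borel"
    and law: "markov_walk P F M Y X i"
begin

sublocale prob_space M
  using law by (simp add: markov_walk_def)

lemma P_nonneg: "0 \<le> P $ k $ j" and P_sum: "(\<Sum>j\<in>UNIV. P $ k $ j) = 1"
  using stoch by (auto simp: stochastic_matrix_def)

lemma Y_meas [measurable]: "Y n \<in> borel_measurable M"
  and X_meas [measurable]: "X n \<in> measurable M (count_space UNIV)"
  and start: "AE \<omega> in M. Y 0 \<omega> = 0 \<and> X 0 \<omega> = i"
  using law by (auto simp: markov_walk_def)

lemma F_meas [measurable_cong]: "sets (F k j) = sets borel" by (rule F_sets)

lemma F_space [simp]: "space (F k j) = UNIV"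
  using sets_eq_imp_space_eq[OF F_sets] by simp

lemma past_map_meas:
  "(\<lambda>\<omega>. \<lambda>k\<in>{..n}. (Y k \<omega>, X k \<omega>)) \<in> measurable M (PiM {..n} (\<lambda>_. borel \<Otimes>\<^sub>M count_space UNIV))"
  by measurable

lemma space_past [simp]: "space (past M Y X n) = space M"
  by (simp add: past_def)

lemma subalgebra_past: "subalgebra M (past M Y X n)"
proof -
  have "(\<lambda>\<omega>. \<lambda>k\<in>{..n}. (Y k \<omega>, X k \<omega>)) \<in> space M \<rightarrow> space (PiM {..n} (\<lambda>_. borel \<Otimes>\<^sub>M count_space UNIV))"
    using measurable_space[OF past_map_meas[of n]] by blast
  from sets_vimage_algebra2[OF this] show ?thesis
    unfolding subalgebra_def past_def using measurable_sets[OF past_map_meas[of n]] by auto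
qed

lemma sets_past: "B \<in> sets (past M Y X n) \<Longrightarrow> B \<in> sets M"
  using subalgebra_past[of n] by (auto simp: subalgebra_def)

lemma meas_past: "f \<in> measurable (past M Y X n) N \<Longrightarrow> f \<in> measurable M N"
  using measurable_from_subalg[OF subalgebra_past] .

lemma pair_meas_past:
  assumes "k \<le> n"
  shows "(\<lambda>\<omega>. (Y k \<omega>, X k \<omega>)) \<in> measurable (past M Y X n) (borel \<Otimes>\<^sub>M count_space UNIV)"
proof -
  let ?f = "\<lambda>\<omega>. \<lambda>k\<in>{..n}. (Y k \<omega>, X k \<omega>)"
  have "?f \<in> measurable (past M Y X n) (PiM {..n} (\<lambda>_. borel \<Otimes>\<^sub>M count_space UNIV))"
    unfolding past_def using measurable_space[OF past_map_meas[of n]]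
    by (intro measurable_vimage_algebra1) blast
  from measurable_compose[OF this measurable_component_singleton[of k]]
  show ?thesis using assms by simp
qed

lemma Y_past: "k \<le> n \<Longrightarrow> Y k \<in> borel_measurable (past M Y X n)"
  using measurable_compose[OF pair_meas_past measurable_fst] by simp

lemma X_past: "k \<le> n \<Longrightarrow> X k \<in> measurable (past M Y X n) (count_space UNIV)"
  using measurable_compose[OF pair_meas_past measurable_snd] by simp

text \<open>The defining conditional probabilities, integrated over an event of the past.\<close>

lemma next_step_rectangle:
  assumes B: "B \<in> sets (past M Y X n)" and A: "A \<in> sets borel"
  shows "emeasure M {\<omega> \<in> B. X n \<omega> = k \<and> X (Suc n) \<omega> = j \<and> Y (Suc n) \<omega> \<in> A} =
    ennreal (P $ k $ j) * emeasure M {\<omega> \<in> B. X n \<omega> = k} * emeasure (F k j) A"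
proof -
  interpret sub: sigma_finite_subalgebra M "past M Y X n"
    by (intro finite_measure_subalgebra_is_sigma_finite)
      (simp add: finite_measure_subalgebra_def finite_measure_subalgebra_axioms_def subalgebra_past finite_measure_axioms)
  interpret Fkj: prob_space "F k j" by (rule F_prob)
  have BM [measurable]: "B \<in> sets M" using B by (rule sets_past)
  have BS: "B \<subseteq> space M" using sets.sets_into_space[OF BM] .
  define C where "C = {\<omega> \<in> B. X n \<omega> = k}"
  have "{\<omega> \<in> space (past M Y X n). X n \<omega> = k} \<in> sets (past M Y X n)"
    using X_past[of n n] by measurable
  then have "B \<inter> {\<omega> \<in> space (past M Y X n). X n \<omega> = k} \<in> sets (past M Y X n)"
    using B by blast
  also have "B \<inter> {\<omega> \<in> space (past M Y X n). X n \<omega> = k} = C" using BS by (auto simp: C_def)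
  finally have C: "C \<in> sets (past M Y X n)" .
  have CM [measurable]: "C \<in> sets M" using C by (rule sets_past)
  have AM [measurable]: "A \<in> sets borel" by fact
  define I where "I = {\<omega> \<in> space M. Y (Suc n) \<omega> \<in> A \<and> X (Suc n) \<omega> = j}"
  have IM [measurable]: "I \<in> sets M" unfolding I_def by measurable
  have cond: "AE \<omega> in M. real_cond_exp M (past M Y X n) (indicator I) \<omega>
        = P $ X n \<omega> $ j * measure (F (X n \<omega>) j) A"
    using law A unfolding markov_walk_def I_def by blast
  have int: "integrable M (indicator I :: _ \<Rightarrow> real)"
    by (intro integrable_real_indicator) (auto simp: emeasure_eq_measure)
  have "measure M (C \<inter> I) = (\<integral>\<omega>\<in>C. indicator I \<omega> \<partial>M)"
    by (simp add: set_lebesgue_integral_def flip: indicator_inter_arith)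
  also have "\<dots> = (\<integral>\<omega>\<in>C. real_cond_exp M (past M Y X n) (indicator I) \<omega> \<partial>M)"
    by (rule sub.real_cond_exp_intA[OF int C])
  also have "\<dots> = (\<integral>\<omega>. indicator C \<omega> * (P $ k $ j * measure (F k j) A) \<partial>M)"
    unfolding set_lebesgue_integral_def
  proof (rule integral_cong_AE)
    show "AE x in M. indicat_real C x *\<^sub>R real_cond_exp M (past M Y X n) (indicat_real I) x =
        indicator C x * (P $ k $ j * measure (F k j) A)"
      using cond by eventually_elim (auto simp: C_def indicator_def)
  qed measurable
  also have "\<dots> = P $ k $ j * measure M C * measure (F k j) A" by simp
  finally have "measure M (C \<inter> I) = P $ k $ j * measure M C * measure (F k j) A" .
  moreover have "C \<inter> I = {\<omega> \<in> B. X n \<omega> = k \<and> X (Suc n) \<omega> = j \<and> Y (Suc n) \<omega> \<in> A}"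
    using BS by (auto simp: C_def I_def)
  ultimately show ?thesis
    by (simp add: emeasure_eq_measure Fkj.emeasure_eq_measure ennreal_mult P_nonneg flip: C_def)
qed

text \<open>On \<open>X\<^sub>n = k\<close> and \<open>X\<^sub>n\<^sub>+\<^sub>1 = j\<close> the next increment is independent of the past: the joint law of a variable
\<open>R\<close> of the past and of the increment agrees with a product measure on rectangles, hence everywhere.\<close>

lemma next_step_product:
  fixes \<phi> :: "real \<Rightarrow> real \<Rightarrow> ennreal"
  assumes B: "B \<in> sets (past M Y X n)" and R: "R \<in> borel_measurable (past M Y X n)"
    and [measurable]: "case_prod \<phi> \<in> borel_measurable (borel \<Otimes>\<^sub>M borel)"
  shows "(\<integral>\<^sup>+\<omega>. \<phi> (R \<omega>) (Y (Suc n) \<omega>) * indicator {\<omega> \<in> B. X n \<omega> = k \<and> X (Suc n) \<omega> = j} \<omega> \<partial>M) =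
    (\<integral>\<^sup>+\<omega>. P $ k $ j * (\<integral>\<^sup>+t. \<phi> (R \<omega>) t \<partial>F k j) * indicator {\<omega> \<in> B. X n \<omega> = k} \<omega> \<partial>M)"
proof -
  interpret Fkj: prob_space "F k j" by (rule F_prob)
  have [measurable]: "R \<in> borel_measurable M" using R by (rule meas_past)
  have [measurable]: "B \<in> sets M" using B by (rule sets_past)
  have BS: "B \<subseteq> space M" using sets.sets_into_space[OF \<open>B \<in> sets M\<close>] .
  define C where "C = {\<omega> \<in> B. X n \<omega> = k}"
  define D where "D = {\<omega> \<in> B. X n \<omega> = k \<and> X (Suc n) \<omega> = j}"
  have "C = B \<inter> {\<omega> \<in> space M. X n \<omega> = k}" "D = B \<inter> {\<omega> \<in> space M. X n \<omega> = k \<and> X (Suc n) \<omega> = j}"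
    using BS by (auto simp: C_def D_def)
  then have [measurable]: "C \<in> sets M" "D \<in> sets M" by simp_all
  define M1 where "M1 = distr (density M (\<lambda>\<omega>. ennreal (P $ k $ j) * indicator C \<omega>)) borel R"
  define M2 where "M2 = distr (density M (indicator D)) (borel \<Otimes>\<^sub>M borel) (\<lambda>\<omega>. (R \<omega>, Y (Suc n) \<omega>))"
  have M1: "emeasure M1 A = P $ k $ j * emeasure M (C \<inter> R -` A)" if [measurable]: "A \<in> sets borel" for A
  proof -
    have "emeasure M1 A = (\<integral>\<^sup>+\<omega>. ennreal (P $ k $ j) * indicator C \<omega> * indicator (R -` A \<inter> space M) \<omega> \<partial>M)"
      unfolding M1_def by (simp add: emeasure_distr emeasure_density)
    also have "\<dots> = (\<integral>\<^sup>+\<omega>. ennreal (P $ k $ j) * indicator (C \<inter> (R -` A \<inter> space M)) \<omega> \<partial>M)"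
      by (intro nn_integral_cong) (auto simp: indicator_def)
    also have "\<dots> = P $ k $ j * emeasure M (C \<inter> (R -` A \<inter> space M))"
      by (simp add: nn_integral_cmult)
    also have "C \<inter> (R -` A \<inter> space M) = C \<inter> R -` A" using BS by (auto simp: C_def)
    finally show ?thesis .
  qed
  have "finite_measure M1"
  proof (rule finite_measureI)
    show "emeasure M1 (space M1) \<noteq> \<infinity>"
      using M1[of UNIV] by (simp add: M1_def emeasure_eq_measure ennreal_mult_eq_top_iff)
  qed
  then have sf: "sigma_finite_measure M1" by (rule finite_measure.axioms(1))
  have "M1 \<Otimes>\<^sub>M F k j = M2"
  proof (rule pair_measure_eqI[OF sf])
    show "sigma_finite_measure (F k j)" by unfold_locales
    show "sets (M1 \<Otimes>\<^sub>M F k j) = sets M2"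
      unfolding M1_def M2_def by (simp, intro sets_pair_measure_cong) (simp_all add: F_sets)
  next
    fix A1 A2 assume A1': "A1 \<in> sets M1" and A2': "A2 \<in> sets (F k j)"
    have A1 [measurable]: "A1 \<in> sets borel" using A1' by (simp add: M1_def)
    have A2 [measurable]: "A2 \<in> sets borel" using A2' by (simp add: F_sets)
    have "{\<omega> \<in> space (past M Y X n). R \<omega> \<in> A1} \<in> sets (past M Y X n)"
      using R by measurable
    then have "B \<inter> {\<omega> \<in> space (past M Y X n). R \<omega> \<in> A1} \<in> sets (past M Y X n)"
      using B by blast
    also have "B \<inter> {\<omega> \<in> space (past M Y X n). R \<omega> \<in> A1} = {\<omega> \<in> B. R \<omega> \<in> A1}" using BS by auto
    finally have BA: "{\<omega> \<in> B. R \<omega> \<in> A1} \<in> sets (past M Y X n)" .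
    have "emeasure M2 (A1 \<times> A2) =
        (\<integral>\<^sup>+\<omega>. indicator D \<omega> * indicator ((\<lambda>\<omega>. (R \<omega>, Y (Suc n) \<omega>)) -` (A1 \<times> A2) \<inter> space M) \<omega> \<partial>M)"
      unfolding M2_def by (simp add: emeasure_distr emeasure_density)
    also have "\<dots> = (\<integral>\<^sup>+\<omega>. indicator (D \<inter> ((\<lambda>\<omega>. (R \<omega>, Y (Suc n) \<omega>)) -` (A1 \<times> A2) \<inter> space M)) \<omega> \<partial>M)"
      by (intro nn_integral_cong) (auto simp: indicator_def)
    also have "\<dots> = emeasure M (D \<inter> ((\<lambda>\<omega>. (R \<omega>, Y (Suc n) \<omega>)) -` (A1 \<times> A2) \<inter> space M))"
      by (intro nn_integral_indicator) measurable
    also have "D \<inter> ((\<lambda>\<omega>. (R \<omega>, Y (Suc n) \<omega>)) -` (A1 \<times> A2) \<inter> space M) =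
        {\<omega> \<in> {\<omega> \<in> B. R \<omega> \<in> A1}. X n \<omega> = k \<and> X (Suc n) \<omega> = j \<and> Y (Suc n) \<omega> \<in> A2}"
      using BS by (auto simp: D_def)
    also have "emeasure M \<dots> = P $ k $ j * emeasure M {\<omega> \<in> {\<omega> \<in> B. R \<omega> \<in> A1}. X n \<omega> = k} * emeasure (F k j) A2"
      by (rule next_step_rectangle[OF BA A2])
    also have "{\<omega> \<in> {\<omega> \<in> B. R \<omega> \<in> A1}. X n \<omega> = k} = C \<inter> R -` A1" by (auto simp: C_def)
    finally show "emeasure M1 A1 * emeasure (F k j) A2 = emeasure M2 (A1 \<times> A2)"
      by (simp add: M1[OF A1])
  qed
  note eq = this
  have "(\<integral>\<^sup>+\<omega>. \<phi> (R \<omega>) (Y (Suc n) \<omega>) * indicator D \<omega> \<partial>M) = (\<integral>\<^sup>+p. case_prod \<phi> p \<partial>M2)"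
    unfolding M2_def by (simp add: nn_integral_distr nn_integral_density mult.commute)
  also have "\<dots> = (\<integral>\<^sup>+p. case_prod \<phi> p \<partial>(M1 \<Otimes>\<^sub>M F k j))" by (simp add: eq)
  also have "\<dots> = (\<integral>\<^sup>+r. \<integral>\<^sup>+t. \<phi> r t \<partial>F k j \<partial>M1)"
  proof -
    have [measurable_cong]: "sets M1 = sets borel" by (simp add: M1_def)
    show ?thesis by (subst Fkj.nn_integral_fst[symmetric]) simp_all
  qed
  also have "\<dots> = (\<integral>\<^sup>+\<omega>. P $ k $ j * (\<integral>\<^sup>+t. \<phi> (R \<omega>) t \<partial>F k j) * indicator C \<omega> \<partial>M)"
    unfolding M1_def by (subst nn_integral_distr, simp, simp, subst nn_integral_density)
      (simp_all add: ac_simps)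
  finally show ?thesis by (simp add: C_def D_def)
qed

lemma next_step_nn:
  fixes \<phi> :: "'e \<Rightarrow> 'e \<Rightarrow> real \<Rightarrow> real \<Rightarrow> ennreal"
  assumes B: "B \<in> sets (past M Y X n)" and R: "R \<in> borel_measurable (past M Y X n)"
    and meas [measurable]: "\<And>k j. case_prod (\<phi> k j) \<in> borel_measurable (borel \<Otimes>\<^sub>M borel)"
  shows "(\<integral>\<^sup>+\<omega>. \<phi> (X n \<omega>) (X (Suc n) \<omega>) (R \<omega>) (Y (Suc n) \<omega>) * indicator B \<omega> \<partial>M) =
    (\<integral>\<^sup>+\<omega>. (\<Sum>j\<in>UNIV. P $ X n \<omega> $ j * (\<integral>\<^sup>+t. \<phi> (X n \<omega>) j (R \<omega>) t \<partial>F (X n \<omega>) j)) * indicator B \<omega> \<partial>M)"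
proof -
  have [measurable]: "R \<in> borel_measurable M" using R by (rule meas_past)
  have BM [measurable]: "B \<in> sets M" using B by (rule sets_past)
  have BS: "B \<subseteq> space M" using sets.sets_into_space[OF BM] .
  interpret Fkj: prob_space "F k j" for k j by (rule F_prob)
  have [measurable]: "{\<omega> \<in> B. X n \<omega> = k \<and> X (Suc n) \<omega> = j} \<in> sets M" "{\<omega> \<in> B. X n \<omega> = k} \<in> sets M" for k j
  proof -
    have "{\<omega> \<in> B. X n \<omega> = k} = B \<inter> {\<omega> \<in> space M. X n \<omega> = k}"
       "{\<omega> \<in> B. X n \<omega> = k \<and> X (Suc n) \<omega> = j} = B \<inter> {\<omega> \<in> space M. X n \<omega> = k \<and> X (Suc n) \<omega> = j}"
    using BS by auto
    then show "{\<omega> \<in> B. X n \<omega> = k \<and> X (Suc n) \<omega> = j} \<in> sets M" "{\<omega> \<in> B. X n \<omega> = k} \<in> sets M" by simp_all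
  qed
  have "(\<integral>\<^sup>+\<omega>. \<phi> (X n \<omega>) (X (Suc n) \<omega>) (R \<omega>) (Y (Suc n) \<omega>) * indicator B \<omega> \<partial>M) =
    (\<integral>\<^sup>+\<omega>. (\<Sum>k\<in>UNIV. \<Sum>j\<in>UNIV. \<phi> k j (R \<omega>) (Y (Suc n) \<omega>) * indicator {\<omega> \<in> B. X n \<omega> = k \<and> X (Suc n) \<omega> = j} \<omega>) \<partial>M)"
  proof (rule nn_integral_cong)
    fix \<omega>
    have "(\<Sum>k\<in>UNIV. \<Sum>j\<in>UNIV. \<phi> k j (R \<omega>) (Y (Suc n) \<omega>) * indicator {\<omega> \<in> B. X n \<omega> = k \<and> X (Suc n) \<omega> = j} \<omega>)
       = (\<Sum>k\<in>{X n \<omega>}. \<Sum>j\<in>{X (Suc n) \<omega>}. \<phi> k j (R \<omega>) (Y (Suc n) \<omega>) * indicator {\<omega> \<in> B. X n \<omega> = k \<and> X (Suc n) \<omega> = j} \<omega>)"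
      by (intro sum.mono_neutral_cong_right) (auto simp: indicator_def intro!: sum.neutral sum.mono_neutral_cong_right)
    then show "\<phi> (X n \<omega>) (X (Suc n) \<omega>) (R \<omega>) (Y (Suc n) \<omega>) * indicator B \<omega> =
      (\<Sum>k\<in>UNIV. \<Sum>j\<in>UNIV. \<phi> k j (R \<omega>) (Y (Suc n) \<omega>) * indicator {\<omega> \<in> B. X n \<omega> = k \<and> X (Suc n) \<omega> = j} \<omega>)"
      by (simp add: indicator_def)
  qed
  also have "\<dots> = (\<Sum>k\<in>UNIV. \<Sum>j\<in>UNIV. \<integral>\<^sup>+\<omega>. \<phi> k j (R \<omega>) (Y (Suc n) \<omega>) * indicator {\<omega> \<in> B. X n \<omega> = k \<and> X (Suc n) \<omega> = j} \<omega> \<partial>M)"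
    by (subst nn_integral_sum, simp, intro sum.cong refl nn_integral_sum) simp
  also have "\<dots> = (\<Sum>k\<in>UNIV. \<Sum>j\<in>UNIV. \<integral>\<^sup>+\<omega>. P $ k $ j * (\<integral>\<^sup>+t. \<phi> k j (R \<omega>) t \<partial>F k j) * indicator {\<omega> \<in> B. X n \<omega> = k} \<omega> \<partial>M)"
    by (intro sum.cong refl next_step_product B R meas)
  also have "\<dots> = (\<integral>\<^sup>+\<omega>. (\<Sum>k\<in>UNIV. \<Sum>j\<in>UNIV. P $ k $ j * (\<integral>\<^sup>+t. \<phi> k j (R \<omega>) t \<partial>F k j) * indicator {\<omega> \<in> B. X n \<omega> = k} \<omega>) \<partial>M)"
    by (subst nn_integral_sum, simp, intro sum.cong refl, subst nn_integral_sum, simp, rule refl)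
  also have "\<dots> = (\<integral>\<^sup>+\<omega>. (\<Sum>j\<in>UNIV. P $ X n \<omega> $ j * (\<integral>\<^sup>+t. \<phi> (X n \<omega>) j (R \<omega>) t \<partial>F (X n \<omega>) j)) * indicator B \<omega> \<partial>M)"
  proof (rule nn_integral_cong)
    fix \<omega>
    have "(\<Sum>k\<in>UNIV. \<Sum>j\<in>UNIV. P $ k $ j * (\<integral>\<^sup>+t. \<phi> k j (R \<omega>) t \<partial>F k j) * indicator {\<omega> \<in> B. X n \<omega> = k} \<omega>)
       = (\<Sum>k\<in>{X n \<omega>}. \<Sum>j\<in>UNIV. P $ k $ j * (\<integral>\<^sup>+t. \<phi> k j (R \<omega>) t \<partial>F k j) * indicator {\<omega> \<in> B. X n \<omega> = k} \<omega>)"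
      by (intro sum.mono_neutral_cong_right) (auto simp: indicator_def intro!: sum.neutral)
    then show "(\<Sum>k\<in>UNIV. \<Sum>j\<in>UNIV. P $ k $ j * (\<integral>\<^sup>+t. \<phi> k j (R \<omega>) t \<partial>F k j) * indicator {\<omega> \<in> B. X n \<omega> = k} \<omega>)
      = (\<Sum>j\<in>UNIV. P $ X n \<omega> $ j * (\<integral>\<^sup>+t. \<phi> (X n \<omega>) j (R \<omega>) t \<partial>F (X n \<omega>) j)) * indicator B \<omega>"
      by (simp add: indicator_def sum_distrib_right)
  qed
  finally show ?thesis .
qed

text \<open>The Markov property in the form that is used later: what has been observed up to time \<open>n\<close> stays
frozen in \<open>R\<close> and \<open>B\<close>, and the next step is integrated out.\<close>

lemma next_step:
  fixes \<phi> :: "'e \<Rightarrow> 'e \<Rightarrow> real \<Rightarrow> real \<Rightarrow> real"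
  assumes B: "B \<in> sets (past M Y X n)" and R: "R \<in> borel_measurable (past M Y X n)"
    and meas [measurable]: "\<And>k j. case_prod (\<phi> k j) \<in> borel_measurable (borel \<Otimes>\<^sub>M borel)"
    and nonneg: "\<And>k j r t. 0 \<le> \<phi> k j r t"
    and int: "\<And>k j r. integrable (F k j) (\<phi> k j r)"
    and bound: "\<And>\<omega>. \<omega> \<in> B \<Longrightarrow> (\<Sum>j\<in>UNIV. P $ X n \<omega> $ j * (\<integral>t. \<phi> (X n \<omega>) j (R \<omega>) t \<partial>F (X n \<omega>) j)) \<le> C"
  shows "integrable M (\<lambda>\<omega>. \<phi> (X n \<omega>) (X (Suc n) \<omega>) (R \<omega>) (Y (Suc n) \<omega>) * indicator B \<omega>)" (is "integrable M ?f")
    and "integrable M (\<lambda>\<omega>. (\<Sum>j\<in>UNIV. P $ X n \<omega> $ j * (\<integral>t. \<phi> (X n \<omega>) j (R \<omega>) t \<partial>F (X n \<omega>) j)) * indicator B \<omega>)" (is "integrable M ?g")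
    and "(\<integral>\<omega>. \<phi> (X n \<omega>) (X (Suc n) \<omega>) (R \<omega>) (Y (Suc n) \<omega>) * indicator B \<omega> \<partial>M) =
      (\<integral>\<omega>. (\<Sum>j\<in>UNIV. P $ X n \<omega> $ j * (\<integral>t. \<phi> (X n \<omega>) j (R \<omega>) t \<partial>F (X n \<omega>) j)) * indicator B \<omega> \<partial>M)"
proof -
  interpret Fkj: prob_space "F k j" for k j by (rule F_prob)
  have [measurable]: "R \<in> borel_measurable M" using R by (rule meas_past)
  have BM [measurable]: "B \<in> sets M" using B by (rule sets_past)
  have fm [measurable]: "?f \<in> borel_measurable M"
    using measurable_compose_countable[of "\<lambda>k \<omega>. \<phi> k (X (Suc n) \<omega>) (R \<omega>) (Y (Suc n) \<omega>)" M borel "X n"]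
      measurable_compose_countable[of "\<lambda>j \<omega>. \<phi> k j (R \<omega>) (Y (Suc n) \<omega>)" M borel "X (Suc n)" for k]
    by measurable
  have g1: "(\<lambda>\<omega>. \<Sum>j\<in>UNIV. P $ k $ j * (\<integral>t. \<phi> k j (R \<omega>) t \<partial>F k j)) \<in> borel_measurable M" for k
    by measurable
  have gm [measurable]: "?g \<in> borel_measurable M"
    using measurable_compose_countable[OF g1 X_meas[of n]] by measurable
  have g0: "0 \<le> (\<Sum>j\<in>UNIV. P $ k $ j * (\<integral>t. \<phi> k j r t \<partial>F k j))" for k r
    by (intro sum_nonneg mult_nonneg_nonneg P_nonneg integral_nonneg_AE) (simp add: nonneg)
  show gi: "integrable M ?g"
    by (rule integrable_const_bound[where B="\<bar>C\<bar>"])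
      (use g0 bound in \<open>auto simp: indicator_def abs_of_nonneg intro!: AE_I2 intro: order.trans[OF _ abs_ge_self]\<close>)
  have "(\<integral>\<^sup>+\<omega>. ennreal (?f \<omega>) \<partial>M) = (\<integral>\<^sup>+\<omega>. ennreal (\<phi> (X n \<omega>) (X (Suc n) \<omega>) (R \<omega>) (Y (Suc n) \<omega>)) * indicator B \<omega> \<partial>M)"
    by (intro nn_integral_cong) (auto simp: indicator_def)
  also have "\<dots> = (\<integral>\<^sup>+\<omega>. (\<Sum>j\<in>UNIV. P $ X n \<omega> $ j * (\<integral>\<^sup>+t. ennreal (\<phi> (X n \<omega>) j (R \<omega>) t) \<partial>F (X n \<omega>) j)) * indicator B \<omega> \<partial>M)"
    by (rule next_step_nn[OF B R]) measurable
  also have "\<dots> = (\<integral>\<^sup>+\<omega>. ennreal (?g \<omega>) \<partial>M)"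
    by (intro nn_integral_cong)
      (auto simp: indicator_def nn_integral_eq_integral int nonneg P_nonneg sum_nonneg integral_nonneg_AE
        simp flip: ennreal_mult sum_ennreal)
  also have "\<dots> = ennreal (\<integral>\<omega>. ?g \<omega> \<partial>M)"
    using g0 by (intro nn_integral_eq_integral gi) (auto simp: indicator_def)
  finally have eq: "(\<integral>\<^sup>+\<omega>. ennreal (?f \<omega>) \<partial>M) = ennreal (\<integral>\<omega>. ?g \<omega> \<partial>M)" .
  show fi: "integrable M ?f"
    by (rule integrableI_nonneg) (use eq nonneg in \<open>auto simp: fm indicator_def\<close>)
  have "ennreal (\<integral>\<omega>. ?f \<omega> \<partial>M) = ennreal (\<integral>\<omega>. ?g \<omega> \<partial>M)"
    using eq nonneg by (subst nn_integral_eq_integral[symmetric, OF fi]) (auto simp: indicator_def)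
  then show "(\<integral>\<omega>. ?f \<omega> \<partial>M) = (\<integral>\<omega>. ?g \<omega> \<partial>M)"
    by (subst (asm) ennreal_inj) (use nonneg g0 in \<open>auto intro!: integral_nonneg_AE simp: indicator_def\<close>)
qed

end

section \<open>Survival of the walk and approximate exponential eigenfunctions\<close>

lemma pow_le_exp:
  fixes y c :: real
  assumes "0 \<le> y" "0 < c"
  shows "y ^ n \<le> (1 / c) ^ n * exp (real n * c * y)"
proof -
  have "c * y \<le> exp (c * y)" using exp_ge_add_one_self[of "c * y"] by linarith
  then have "y \<le> (1 / c) * exp (c * y)" using assms by (simp add: field_simps)
  then have "y ^ n \<le> ((1 / c) * exp (c * y)) ^ n" using assms by (intro power_mono)
  also have "\<dots> = (1 / c) ^ n * exp (real n * c * y)"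
    by (simp add: power_mult_distrib power_divide exp_of_nat_mult mult.assoc)
  finally show ?thesis .
qed

text \<open>The powers of \<open>u\<close> in the Taylor remainder are absorbed in the exponential: each of the at most three
factors costs \<open>exp (a \<bar>u\<bar> / 6)\<close> and \<open>\<theta> \<le> a / 2\<close> leaves room for them.\<close>

lemma exp_taylor_remainder:
  fixes u a \<theta> :: real
  assumes a: "0 < a" and th: "0 \<le> \<theta>" "\<theta> \<le> a / 2" and n: "1 \<le> n" "n \<le> 3"
  shows "\<bar>exp (- \<theta> * u) - (\<Sum>k<n. (- \<theta> * u) ^ k / fact k)\<bar> \<le> (\<theta> * (6 / a)) ^ n * exp (a * \<bar>u\<bar>)"
proof -
  obtain m where m: "n = Suc m" using n(1) by (cases n) auto
  have "\<bar>exp (- \<theta> * u) - (\<Sum>k<n. (- \<theta> * u) ^ k / fact k)\<bar> \<le> exp \<bar>- \<theta> * u\<bar> * (\<bar>- \<theta> * u\<bar> ^ n) / fact m"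
    using Taylor_exp_field[of "- \<theta> * u" m] unfolding m lessThan_Suc_atMost by simp
  also have "\<dots> \<le> exp \<bar>- \<theta> * u\<bar> * (\<bar>- \<theta> * u\<bar> ^ n) / 1"
    by (intro divide_left_mono) auto
  also have "\<dots> = \<theta> ^ n * (exp (\<theta> * \<bar>u\<bar>) * \<bar>u\<bar> ^ n)"
    using th by (simp add: abs_mult power_mult_distrib)
  also have "exp (\<theta> * \<bar>u\<bar>) * \<bar>u\<bar> ^ n \<le> exp (a / 2 * \<bar>u\<bar>) * ((1 / (a / 6)) ^ n * exp (real n * (a / 6) * \<bar>u\<bar>))"
    using a mult_right_mono[OF th(2) abs_ge_zero[of u]] by (intro mult_mono pow_le_exp) auto
  also have "\<dots> = (6 / a) ^ n * exp (a / 2 * \<bar>u\<bar> + real n * (a / 6) * \<bar>u\<bar>)"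
    by (simp add: exp_add)
  also have "a / 2 * \<bar>u\<bar> + real n * (a / 6) * \<bar>u\<bar> \<le> a * \<bar>u\<bar>"
  proof -
    have "real n * (a / 6) \<le> 3 * (a / 6)" using a n by (intro mult_right_mono) auto
    then have "a / 2 + real n * (a / 6) \<le> a" by linarith
    then have "(a / 2 + real n * (a / 6)) * \<bar>u\<bar> \<le> a * \<bar>u\<bar>" by (intro mult_right_mono) auto
    then show ?thesis by (simp add: algebra_simps)
  qed
  finally have "\<bar>exp (- \<theta> * u) - (\<Sum>k<n. (- \<theta> * u) ^ k / fact k)\<bar> \<le> \<theta> ^ n * ((6 / a) ^ n * exp (a * \<bar>u\<bar>))"
    using a th by (simp add: mult_left_mono)
  then show ?thesis by (simp only: power_mult_distrib mult.assoc)
qed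

context additive_walk
begin

text \<open>With the first time \<open>\<tau>\<close> at which \<open>x + S\<^sub>n\<close> is negative, \<open>alive x n\<close> is the event \<open>\<tau> > n\<close> and, for
\<open>dying\<close> below, \<open>dying x n\<close> is the event \<open>\<tau> = n + 1\<close>.\<close>

definition alive :: "real \<Rightarrow> nat \<Rightarrow> 'w set" where
  "alive x n = {\<omega> \<in> space M. \<forall>k\<le>n. 0 \<le> x + walk Y k \<omega>}"

definition dying :: "real \<Rightarrow> nat \<Rightarrow> 'w set" where
  "dying x n = {\<omega> \<in> alive x n. x + walk Y (Suc n) \<omega> < 0}"

text \<open>The transition operator of the pair \<open>(X\<^sub>n, x + S\<^sub>n)\<close>, without killing.\<close>

definition step_op :: "('e \<Rightarrow> real \<Rightarrow> real) \<Rightarrow> 'e \<Rightarrow> real \<Rightarrow> real" where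
  "step_op \<psi> k y = (\<Sum>j\<in>UNIV. P $ k $ j * (\<integral>t. \<psi> j (y + t) \<partial>F k j))"

lemma walk_Suc: "walk Y (Suc n) \<omega> = walk Y n \<omega> + Y (Suc n) \<omega>"
  by (simp add: walk_def)

lemma walk_0 [simp]: "walk Y 0 \<omega> = 0"
  by (simp add: walk_def)

lemma walk_past: "k \<le> n \<Longrightarrow> walk Y k \<in> borel_measurable (past M Y X n)"
  unfolding walk_def[abs_def] by (intro borel_measurable_sum Y_past) auto

lemma walk_meas [measurable]: "walk Y n \<in> borel_measurable M"
  using meas_past[OF walk_past[OF order.refl]] .

lemma alive_past: "alive x n \<in> sets (past M Y X n)"
proof -
  have *: "{\<omega> \<in> space (past M Y X n). 0 \<le> x + walk Y k \<omega>} \<in> sets (past M Y X n)" if "k \<le> n" for k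
  proof -
    have [measurable]: "walk Y k \<in> borel_measurable (past M Y X n)" using walk_past[OF that] .
    show ?thesis by measurable
  qed
  have "(\<Inter>k\<in>{..n}. {\<omega> \<in> space (past M Y X n). 0 \<le> x + walk Y k \<omega>}) \<in> sets (past M Y X n)"
    by (intro sets.finite_INT) (auto simp del: space_past intro: *)
  also have "(\<Inter>k\<in>{..n}. {\<omega> \<in> space (past M Y X n). 0 \<le> x + walk Y k \<omega>}) = alive x n"
    by (auto simp: alive_def)
  finally show ?thesis .
qed

lemma alive_meas [measurable]: "alive x n \<in> sets M"
  using sets_past[OF alive_past] .

lemma alive_Suc: "alive x (Suc n) = alive x n - dying x n"
  by (auto simp: alive_def dying_def le_Suc_eq not_less)

lemma dying_subset: "dying x n \<subseteq> alive x n"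
  by (auto simp: dying_def)

lemma alive_Suc_subset: "alive x (Suc n) \<subseteq> alive x n"
  by (auto simp: alive_Suc)

lemma dying_meas [measurable]: "dying x n \<in> sets M"
proof -
  have "dying x n = alive x n - alive x (Suc n)" using alive_Suc[of x n] dying_subset[of x n] by auto
  then show ?thesis by simp
qed

lemma alive_0: "0 \<le> x \<Longrightarrow> alive x 0 = space M"
  by (auto simp: alive_def)

lemma alive_nonneg: "\<omega> \<in> alive x n \<Longrightarrow> 0 \<le> x + walk Y n \<omega>"
  by (auto simp: alive_def)

lemma indicator_alive_split:
  "indicator (alive x n) \<omega> = indicator (alive x (Suc n)) \<omega> + (indicator (dying x n) \<omega> :: real)"
  using dying_subset[of x n] by (auto simp: alive_Suc indicator_def)

lemma prob_dying: "prob (dying x n) = prob (alive x n) - prob (alive x (Suc n))"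
proof -
  have "prob (alive x n - dying x n) = prob (alive x n) - prob (dying x n)"
    by (intro finite_measure_Diff dying_subset) auto
  then show ?thesis by (simp add: alive_Suc)
qed

lemma walk_meas_X [measurable]:
  fixes \<psi> :: "'e \<Rightarrow> real \<Rightarrow> real"
  assumes "\<And>j. \<psi> j \<in> borel_measurable borel"
  shows "(\<lambda>\<omega>. \<psi> (X n \<omega>) (x + walk Y n \<omega>)) \<in> borel_measurable M"
proof -
  have "(\<lambda>\<omega>. \<psi> j (x + walk Y n \<omega>)) \<in> borel_measurable M" for j
  proof -
    have [measurable]: "\<psi> j \<in> borel_measurable borel" by fact
    show ?thesis by measurable
  qed
  from measurable_compose_countable[OF this X_meas[of n]] show ?thesis .
qed

lemma step_expectation:
  fixes \<psi> :: "'e \<Rightarrow> real \<Rightarrow> real"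
  assumes meas [measurable]: "\<And>j. \<psi> j \<in> borel_measurable borel"
    and nonneg: "\<And>j y. 0 \<le> \<psi> j y"
    and int: "\<And>k j y. integrable (F k j) (\<lambda>t. \<psi> j (y + t))"
    and bound: "\<And>k y. 0 \<le> y \<Longrightarrow> step_op \<psi> k y \<le> C"
  shows "integrable M (\<lambda>\<omega>. \<psi> (X (Suc n) \<omega>) (x + walk Y (Suc n) \<omega>) * indicator (alive x n) \<omega>)"
    and "integrable M (\<lambda>\<omega>. step_op \<psi> (X n \<omega>) (x + walk Y n \<omega>) * indicator (alive x n) \<omega>)"
    and "(\<integral>\<omega>. \<psi> (X (Suc n) \<omega>) (x + walk Y (Suc n) \<omega>) * indicator (alive x n) \<omega> \<partial>M) =
      (\<integral>\<omega>. step_op \<psi> (X n \<omega>) (x + walk Y n \<omega>) * indicator (alive x n) \<omega> \<partial>M)"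
proof -
  have [measurable]: "walk Y n \<in> borel_measurable (past M Y X n)" using walk_past by blast
  have R: "(\<lambda>\<omega>. x + walk Y n \<omega>) \<in> borel_measurable (past M Y X n)" by measurable
  have m: "(\<lambda>(r, t). \<psi> j (r + t)) \<in> borel_measurable (borel \<Otimes>\<^sub>M borel)" for j k :: 'e by measurable
  note ns = next_step[where \<phi>="\<lambda>k j r t. \<psi> j (r + t)" and C=C, OF alive_past R m nonneg int]
  have b: "(\<Sum>j\<in>UNIV. P $ X n \<omega> $ j * (\<integral>t. \<psi> j (x + walk Y n \<omega> + t) \<partial>F (X n \<omega>) j)) \<le> C"
    if "\<omega> \<in> alive x n" for \<omega>
    using bound[OF alive_nonneg[OF that], of "X n \<omega>"] by (simp add: step_op_def)
  show "integrable M (\<lambda>\<omega>. \<psi> (X (Suc n) \<omega>) (x + walk Y (Suc n) \<omega>) * indicator (alive x n) \<omega>)"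
    using ns(1)[OF b] by (simp add: walk_Suc add.assoc)
  show "integrable M (\<lambda>\<omega>. step_op \<psi> (X n \<omega>) (x + walk Y n \<omega>) * indicator (alive x n) \<omega>)"
    using ns(2)[OF b] by (simp add: step_op_def)
  show "(\<integral>\<omega>. \<psi> (X (Suc n) \<omega>) (x + walk Y (Suc n) \<omega>) * indicator (alive x n) \<omega> \<partial>M) =
      (\<integral>\<omega>. step_op \<psi> (X n \<omega>) (x + walk Y n \<omega>) * indicator (alive x n) \<omega> \<partial>M)"
    using ns(3)[OF b] by (simp add: step_op_def walk_Suc add.assoc)
qed

lemma integrable_alive:
  fixes \<psi> :: "'e \<Rightarrow> real \<Rightarrow> real"
  assumes meas: "\<And>j. \<psi> j \<in> borel_measurable borel"
    and bound: "\<And>k y. 0 \<le> y \<Longrightarrow> \<bar>\<psi> k y\<bar> \<le> C"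
  shows "integrable M (\<lambda>\<omega>. \<psi> (X n \<omega>) (x + walk Y n \<omega>) * indicator (alive x n) \<omega>)"
proof (rule integrable_const_bound[where B="\<bar>C\<bar>"])
  show "AE \<omega> in M. norm (\<psi> (X n \<omega>) (x + walk Y n \<omega>) * indicator (alive x n) \<omega>) \<le> \<bar>C\<bar>"
  proof (rule AE_I2)
    fix \<omega>
    show "norm (\<psi> (X n \<omega>) (x + walk Y n \<omega>) * indicator (alive x n) \<omega>) \<le> \<bar>C\<bar>"
      using bound[of "x + walk Y n \<omega>" "X n \<omega>"] alive_nonneg[of \<omega> x n]
      by (auto simp: indicator_def)
  qed
qed (use walk_meas_X[OF meas] in measurable)

end

text \<open>The functions \<open>g\<close> and \<open>q\<close> are the two correctors: \<open>drift\<close> is the Poisson equation that makes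
\<open>S\<^sub>n + g (X\<^sub>n)\<close> a martingale, and \<open>var\<close> is the one that makes its square, plus \<open>q (X\<^sub>n)\<close>, a martingale after
subtraction of \<open>v n\<close>. Taking \<open>g \<ge> 0\<close> is a normalisation, under which \<open>exp (- \<theta> g) \<le> 1\<close>.\<close>

locale corrected_walk = additive_walk P F M Y X i
  for P :: "real^'e^'e" and F and M :: "'w measure" and Y X i +
  fixes g q :: "'e \<Rightarrow> real" and v \<alpha> G Q K :: real
  assumes alpha: "0 < \<alpha>" and v_pos: "0 < v"
    and int_pos: "\<And>k j. integrable (F k j) (\<lambda>t. exp (\<alpha> * t))"
    and int_neg: "\<And>k j. integrable (F k j) (\<lambda>t. exp (- \<alpha> * t))"
    and K: "\<And>k j. (\<integral>t. exp (\<alpha> * t) \<partial>F k j) \<le> K" "\<And>k j. (\<integral>t. exp (- \<alpha> * t) \<partial>F k j) \<le> K"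
    and g: "\<And>k. 0 \<le> g k" "\<And>k. g k \<le> G"
    and q: "\<And>k. \<bar>q k\<bar> \<le> Q"
    and drift: "\<And>k. (\<Sum>j\<in>UNIV. P $ k $ j * (\<integral>t. t + g j - g k \<partial>F k j)) = 0"
    and var: "\<And>k. (\<Sum>j\<in>UNIV. P $ k $ j * ((\<integral>t. (t + g j - g k)\<^sup>2 \<partial>F k j) + q j)) = v + q k"
begin

lemma G_nonneg: "0 \<le> G" using g order.trans by blast

lemma Q_nonneg: "0 \<le> Q" using q abs_ge_zero order.trans by blast

lemma K_nonneg: "0 \<le> K"
  by (rule order.trans[OF _ K(1)]) (auto intro!: integral_nonneg_AE)

text \<open>The increments of the martingale \<open>S\<^sub>n + g (X\<^sub>n)\<close>.\<close>

definition incr :: "'e \<Rightarrow> 'e \<Rightarrow> real \<Rightarrow> real" where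
  "incr k j t = t + g j - g k"

lemma incr_meas [measurable]: "incr k j \<in> borel_measurable borel"
  unfolding incr_def by measurable

definition K1 :: real where "K1 = exp (\<alpha> * G) * (2 * K)"

lemma exp_incr_le: "exp (\<alpha> * \<bar>incr k j t\<bar>) \<le> exp (\<alpha> * G) * (exp (\<alpha> * t) + exp (- \<alpha> * t))"
proof -
  have "\<bar>incr k j t\<bar> \<le> G + \<bar>t\<bar>" using g(1)[of k] g(1)[of j] g(2)[of k] g(2)[of j] by (auto simp: incr_def)
  then have "\<alpha> * \<bar>incr k j t\<bar> \<le> \<alpha> * G + \<alpha> * \<bar>t\<bar>" using alpha by (simp flip: distrib_left)
  then have "exp (\<alpha> * \<bar>incr k j t\<bar>) \<le> exp (\<alpha> * G) * exp (\<alpha> * \<bar>t\<bar>)" by (simp flip: exp_add)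
  also have "exp (\<alpha> * \<bar>t\<bar>) \<le> exp (\<alpha> * t) + exp (- \<alpha> * t)" by (simp add: abs_if)
  finally show ?thesis by simp
qed

lemma incr_exp_int: "integrable (F k j) (\<lambda>t. exp (\<alpha> * \<bar>incr k j t\<bar>))" (is ?th1)
  and incr_exp_bound: "(\<integral>t. exp (\<alpha> * \<bar>incr k j t\<bar>) \<partial>F k j) \<le> K1" (is ?th2)
proof -
  have int: "integrable (F k j) (\<lambda>t. exp (\<alpha> * G) * (exp (\<alpha> * t) + exp (- \<alpha> * t)))"
    by (rule integrable_mult_right, rule Bochner_Integration.integrable_add[OF int_pos int_neg])
  show ?th1
    by (rule Bochner_Integration.integrable_bound[OF int]) (use exp_incr_le in auto)
  then have "(\<integral>t. exp (\<alpha> * \<bar>incr k j t\<bar>) \<partial>F k j) \<le> (\<integral>t. exp (\<alpha> * G) * (exp (\<alpha> * t) + exp (- \<alpha> * t)) \<partial>F k j)"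
    by (intro integral_mono int exp_incr_le)
  also have "\<dots> = exp (\<alpha> * G) * ((\<integral>t. exp (\<alpha> * t) \<partial>F k j) + (\<integral>t. exp (- \<alpha> * t) \<partial>F k j))"
    by (subst Bochner_Integration.integral_mult_right_zero, subst Bochner_Integration.integral_add[OF int_pos int_neg]) (rule refl)
  also have "\<dots> \<le> K1" unfolding K1_def using K[of k j] by (intro mult_left_mono) auto
  finally show ?th2 .
qed

lemma K1_nonneg: "0 \<le> K1"
  using K_nonneg by (simp add: K1_def)

lemma int_incr_dominated:
  assumes [measurable]: "f \<in> borel_measurable borel" and "\<And>t. \<bar>f t\<bar> \<le> C * exp (\<alpha> * \<bar>incr k j t\<bar>)"
  shows "integrable (F k j) f" "\<bar>\<integral>t. f t \<partial>F k j\<bar> \<le> C * K1"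
proof -
  have C: "0 \<le> C"
  proof -
    have "0 \<le> C * exp (\<alpha> * \<bar>incr k j 0\<bar>)" using assms(2)[of 0] abs_ge_zero order.trans by blast
    then show ?thesis by (simp add: zero_le_mult_iff)
  qed
  have int: "integrable (F k j) (\<lambda>t. C * exp (\<alpha> * \<bar>incr k j t\<bar>))"
    by (intro integrable_mult_right incr_exp_int)
  show i: "integrable (F k j) f"
    by (rule Bochner_Integration.integrable_bound[OF int])
      (use assms(2) C in \<open>auto simp: abs_mult abs_of_nonneg intro!: AE_I2\<close>)
  have "\<bar>\<integral>t. f t \<partial>F k j\<bar> \<le> (\<integral>t. \<bar>f t\<bar> \<partial>F k j)" by (rule integral_abs_bound)
  also have "\<dots> \<le> (\<integral>t. C * exp (\<alpha> * \<bar>incr k j t\<bar>) \<partial>F k j)"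
    by (intro integral_mono int integrable_abs i assms(2))
  also have "\<dots> \<le> C * K1" using incr_exp_bound[of k j] C by (simp add: mult_left_mono)
  finally show "\<bar>\<integral>t. f t \<partial>F k j\<bar> \<le> C * K1" .
qed

lemma incr_pow_int: "integrable (F k j) (\<lambda>t. incr k j t ^ n)"
proof (rule int_incr_dominated)
  fix t
  have "\<bar>incr k j t ^ n\<bar> = \<bar>incr k j t\<bar> ^ n" by (simp add: power_abs)
  also have "\<dots> \<le> (1 / (\<alpha> / (real n + 1))) ^ n * exp (real n * (\<alpha> / (real n + 1)) * \<bar>incr k j t\<bar>)"
    using alpha by (intro pow_le_exp) auto
  also have "\<dots> \<le> (1 / (\<alpha> / (real n + 1))) ^ n * exp (\<alpha> * \<bar>incr k j t\<bar>)"
    using alpha by (intro mult_left_mono exp_mono mult_right_mono) (auto simp: field_simps)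
  finally show "\<bar>incr k j t ^ n\<bar> \<le> (1 / (\<alpha> / (real n + 1))) ^ n * exp (\<alpha> * \<bar>incr k j t\<bar>)" .
qed measurable

lemma exp_incr_int:
  assumes "0 \<le> \<theta>" "\<theta> \<le> \<alpha>"
  shows "integrable (F k j) (\<lambda>t. exp (- \<theta> * incr k j t))"
proof (rule int_incr_dominated)
  fix t
  have "- \<theta> * incr k j t \<le> \<alpha> * \<bar>incr k j t\<bar>"
  proof -
    have "- \<theta> * incr k j t \<le> \<bar>\<theta> * incr k j t\<bar>" by (simp add: abs_if)
    also have "\<dots> = \<theta> * \<bar>incr k j t\<bar>" using assms by (simp add: abs_mult)
    also have "\<dots> \<le> \<alpha> * \<bar>incr k j t\<bar>" using assms by (intro mult_right_mono) auto
    finally show ?thesis .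
  qed
  then show "\<bar>exp (- \<theta> * incr k j t)\<bar> \<le> 1 * exp (\<alpha> * \<bar>incr k j t\<bar>)" by simp
qed measurable

text \<open>The first factor removes the drift and the second one makes the quadratic term of the expansion
independent of the state. On the killed walk, where \<open>y \<ge> 0\<close>, the function is bounded.\<close>

definition eigenfn :: "real \<Rightarrow> 'e \<Rightarrow> real \<Rightarrow> real" where
  "eigenfn \<theta> k y = exp (- \<theta> * (y + g k)) * (1 + \<theta>\<^sup>2 * q k / 2)"

text \<open>The failure of \<^term>\<open>eigenfn \<theta>\<close> to be an eigenfunction, normalised by \<open>exp (- \<theta> (y + g k))\<close>.\<close>

definition defect :: "real \<Rightarrow> 'e \<Rightarrow> real" where
  "defect \<theta> k = (\<Sum>j\<in>UNIV. P $ k $ j * ((1 + \<theta>\<^sup>2 * q j / 2) * (\<integral>t. exp (- \<theta> * incr k j t) \<partial>F k j)))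
      - (1 + \<theta>\<^sup>2 * v / 2) * (1 + \<theta>\<^sup>2 * q k / 2)"

lemma eigenfn_shift: "eigenfn \<theta> j (y + t) = exp (- \<theta> * (y + g k)) * ((1 + \<theta>\<^sup>2 * q j / 2) * exp (- \<theta> * incr k j t))"
proof -
  have "- \<theta> * (y + t + g j) = - \<theta> * (y + g k) + - \<theta> * incr k j t" by (simp add: incr_def algebra_simps)
  then show ?thesis unfolding eigenfn_def by (simp only: exp_add mult_ac)
qed

lemma eigenfn_int:
  assumes "0 \<le> \<theta>" "\<theta> \<le> \<alpha>"
  shows "integrable (F k j) (\<lambda>t. eigenfn \<theta> j (y + t))"
  unfolding eigenfn_shift[where k=k] by (intro integrable_mult_right exp_incr_int assms)

lemma step_op_eigenfn:
  assumes "0 \<le> \<theta>" "\<theta> \<le> \<alpha>"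
  shows "step_op (eigenfn \<theta>) k y = (1 + \<theta>\<^sup>2 * v / 2) * eigenfn \<theta> k y + exp (- \<theta> * (y + g k)) * defect \<theta> k"
proof -
  have "step_op (eigenfn \<theta>) k y =
      exp (- \<theta> * (y + g k)) * (\<Sum>j\<in>UNIV. P $ k $ j * ((1 + \<theta>\<^sup>2 * q j / 2) * (\<integral>t. exp (- \<theta> * incr k j t) \<partial>F k j)))"
    unfolding step_op_def eigenfn_shift[where k=k] by (simp add: sum_distrib_left mult_ac)
  then show ?thesis by (simp add: defect_def eigenfn_def algebra_simps)
qed

text \<open>The terms of order 1, 2 and 3 in the expansion of the exponential: the linear one vanishes by \<open>drift\<close>,
the quadratic one equals \<open>v + q k\<close> by \<open>var\<close>, and all others are of third order. That third order is
what makes the total error, summed over about \<open>\<theta>\<^sup>-\<^sup>2\<close> steps that are weighted by the small survival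
probabilities, negligible against the main term of order \<open>\<theta>\<close>.\<close>

lemma defect_bound:
  obtains C where "0 \<le> C" "\<And>\<theta> k. 0 \<le> \<theta> \<Longrightarrow> \<theta> \<le> 1 \<Longrightarrow> \<theta> \<le> \<alpha> / 2 \<Longrightarrow> \<bar>defect \<theta> k\<bar> \<le> C * \<theta> ^ 3"
proof -
  define C where "C = (6 / \<alpha>) ^ 3 * K1 + Q / 2 * (6 / \<alpha> * K1) + v * Q / 4"
  have C: "0 \<le> C" unfolding C_def using alpha v_pos Q_nonneg K1_nonneg by auto
  have "\<bar>defect \<theta> k\<bar> \<le> C * \<theta> ^ 3" if th: "0 \<le> \<theta>" "\<theta> \<le> 1" "\<theta> \<le> \<alpha> / 2" for \<theta> k
  proof -
    define E where "E j = (\<integral>t. exp (- \<theta> * incr k j t) \<partial>F k j)" for j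
    define e1 where "e1 j = (\<integral>t. incr k j t \<partial>F k j)" for j
    define e2 where "e2 j = (\<integral>t. (incr k j t)\<^sup>2 \<partial>F k j)" for j
    have F1: "measure (F k j) UNIV = 1" for j using prob_space.prob_space[OF F_prob[of k j]] by simp
    interpret Fk: prob_space "F k j" for j by (rule F_prob)
    have intE: "integrable (F k j) (\<lambda>t. exp (- \<theta> * incr k j t))" for j
      using th by (intro exp_incr_int) auto
    have int1: "integrable (F k j) (incr k j)" for j using incr_pow_int[of k j 1] by simp
    have R3: "\<bar>E j - 1 + \<theta> * e1 j - \<theta>\<^sup>2 / 2 * e2 j\<bar> \<le> (\<theta> * (6 / \<alpha>)) ^ 3 * K1" for j
    proof -
      have "\<bar>\<integral>t. exp (- \<theta> * incr k j t) - (\<Sum>n<3. (- \<theta> * incr k j t) ^ n / fact n) \<partial>F k j\<bar>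
          \<le> (\<theta> * (6 / \<alpha>)) ^ 3 * K1"
        using th alpha by (intro int_incr_dominated exp_taylor_remainder) auto
      also have "(\<lambda>t. exp (- \<theta> * incr k j t) - (\<Sum>n<3. (- \<theta> * incr k j t) ^ n / fact n)) =
          (\<lambda>t. exp (- \<theta> * incr k j t) - 1 + \<theta> * incr k j t - \<theta>\<^sup>2 / 2 * (incr k j t)\<^sup>2)"
        by (auto simp: fun_eq_iff eval_nat_numeral)
      also have "(\<integral>t. exp (- \<theta> * incr k j t) - 1 + \<theta> * incr k j t - \<theta>\<^sup>2 / 2 * (incr k j t)\<^sup>2 \<partial>F k j) =
          E j - 1 + \<theta> * e1 j - \<theta>\<^sup>2 / 2 * e2 j"
        using intE int1 incr_pow_int[of k j 2] by (simp add: E_def e1_def e2_def F1)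
      finally show ?thesis .
    qed
    have R1: "\<bar>E j - 1\<bar> \<le> (\<theta> * (6 / \<alpha>)) * K1" for j
    proof -
      have "\<bar>\<integral>t. exp (- \<theta> * incr k j t) - (\<Sum>n<1. (- \<theta> * incr k j t) ^ n / fact n) \<partial>F k j\<bar>
          \<le> (\<theta> * (6 / \<alpha>)) ^ 1 * K1"
        using th alpha by (intro int_incr_dominated exp_taylor_remainder) auto
      also have "(\<integral>t. exp (- \<theta> * incr k j t) - (\<Sum>n<1. (- \<theta> * incr k j t) ^ n / fact n) \<partial>F k j) = E j - 1"
        using intE by (simp add: E_def F1)
      finally show ?thesis by simp
    qed
    have d1: "(\<Sum>j\<in>UNIV. P $ k $ j * e1 j) = 0"
      using drift[of k] by (simp add: e1_def incr_def)
    have d2: "(\<Sum>j\<in>UNIV. P $ k $ j * (e2 j + q j)) = v + q k"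
      using var[of k] by (simp add: e2_def incr_def)
    have "(\<Sum>j\<in>UNIV. P $ k $ j * (1 - \<theta> * e1 j + \<theta>\<^sup>2 / 2 * (e2 j + q j))) =
        (\<Sum>j\<in>UNIV. P $ k $ j) - \<theta> * (\<Sum>j\<in>UNIV. P $ k $ j * e1 j) + \<theta>\<^sup>2 / 2 * (\<Sum>j\<in>UNIV. P $ k $ j * (e2 j + q j))"
      unfolding sum_distrib_left sum.distrib[symmetric] sum_subtractf[symmetric]
      by (intro sum.cong refl) (simp add: algebra_simps)
    then have S: "(\<Sum>j\<in>UNIV. P $ k $ j * (1 - \<theta> * e1 j + \<theta>\<^sup>2 / 2 * (e2 j + q j))) = 1 + \<theta>\<^sup>2 / 2 * (v + q k)"
      by (simp add: P_sum d1 d2)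
    have defect_eq: "defect \<theta> k = (\<Sum>j\<in>UNIV. P $ k $ j * ((1 + \<theta>\<^sup>2 * q j / 2) * E j - (1 - \<theta> * e1 j + \<theta>\<^sup>2 / 2 * (e2 j + q j))))
        - \<theta> ^ 4 * (v * q k / 4)"
    proof -
      have "(\<Sum>j\<in>UNIV. P $ k $ j * ((1 + \<theta>\<^sup>2 * q j / 2) * E j - (1 - \<theta> * e1 j + \<theta>\<^sup>2 / 2 * (e2 j + q j)))) =
          (\<Sum>j\<in>UNIV. P $ k $ j * ((1 + \<theta>\<^sup>2 * q j / 2) * E j)) - (1 + \<theta>\<^sup>2 / 2 * (v + q k))"
        unfolding S[symmetric] sum_subtractf[symmetric] right_diff_distrib[symmetric] ..
      moreover have "(1 + \<theta>\<^sup>2 * v / 2) * (1 + \<theta>\<^sup>2 * q k / 2) = 1 + \<theta>\<^sup>2 / 2 * (v + q k) + \<theta> ^ 4 * (v * q k / 4)"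
        by (simp add: field_simps eval_nat_numeral)
      ultimately show ?thesis by (simp add: defect_def E_def)
    qed
    moreover have "\<bar>(\<Sum>j\<in>UNIV. P $ k $ j * ((1 + \<theta>\<^sup>2 * q j / 2) * E j - (1 - \<theta> * e1 j + \<theta>\<^sup>2 / 2 * (e2 j + q j))))
        - \<theta> ^ 4 * (v * q k / 4)\<bar> \<le> (\<Sum>j\<in>UNIV. P $ k $ j * (((6 / \<alpha>) ^ 3 * K1 + Q / 2 * (6 / \<alpha> * K1)) * \<theta> ^ 3)) + \<theta> ^ 3 * (v * Q / 4)"
    proof (rule order.trans[OF abs_triangle_ineq4], rule add_mono)
      show "\<bar>\<Sum>j\<in>UNIV. P $ k $ j * ((1 + \<theta>\<^sup>2 * q j / 2) * E j - (1 - \<theta> * e1 j + \<theta>\<^sup>2 / 2 * (e2 j + q j)))\<bar> \<le>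
          (\<Sum>j\<in>UNIV. P $ k $ j * (((6 / \<alpha>) ^ 3 * K1 + Q / 2 * (6 / \<alpha> * K1)) * \<theta> ^ 3))"
      proof (rule order.trans[OF sum_abs], rule sum_mono)
        fix j
        have "(1 + \<theta>\<^sup>2 * q j / 2) * E j - (1 - \<theta> * e1 j + \<theta>\<^sup>2 / 2 * (e2 j + q j)) =
            (E j - 1 + \<theta> * e1 j - \<theta>\<^sup>2 / 2 * e2 j) + \<theta>\<^sup>2 / 2 * (q j * (E j - 1))"
          by (simp add: field_simps)
        also have "\<bar>\<dots>\<bar> \<le> (\<theta> * (6 / \<alpha>)) ^ 3 * K1 + \<theta>\<^sup>2 / 2 * (Q * ((\<theta> * (6 / \<alpha>)) * K1))"
        proof (rule order.trans[OF abs_triangle_ineq], rule add_mono[OF R3])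
          have "\<bar>q j * (E j - 1)\<bar> \<le> Q * ((\<theta> * (6 / \<alpha>)) * K1)"
            unfolding abs_mult by (intro mult_mono q R1 Q_nonneg) auto
          then have "\<theta>\<^sup>2 / 2 * \<bar>q j * (E j - 1)\<bar> \<le> \<theta>\<^sup>2 / 2 * (Q * ((\<theta> * (6 / \<alpha>)) * K1))"
            by (intro mult_left_mono) auto
          moreover have "\<bar>\<theta>\<^sup>2 / 2 * (q j * (E j - 1))\<bar> = \<theta>\<^sup>2 / 2 * \<bar>q j * (E j - 1)\<bar>"
            unfolding abs_mult[of "\<theta>\<^sup>2 / 2"] by simp
          ultimately show "\<bar>\<theta>\<^sup>2 / 2 * (q j * (E j - 1))\<bar> \<le> \<theta>\<^sup>2 / 2 * (Q * ((\<theta> * (6 / \<alpha>)) * K1))"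
            by (simp only:)
        qed
        also have "\<dots> = ((6 / \<alpha>) ^ 3 * K1 + Q / 2 * (6 / \<alpha> * K1)) * \<theta> ^ 3"
          by (simp add: field_simps eval_nat_numeral)
        finally show "\<bar>P $ k $ j * ((1 + \<theta>\<^sup>2 * q j / 2) * E j - (1 - \<theta> * e1 j + \<theta>\<^sup>2 / 2 * (e2 j + q j)))\<bar>
          \<le> P $ k $ j * (((6 / \<alpha>) ^ 3 * K1 + Q / 2 * (6 / \<alpha> * K1)) * \<theta> ^ 3)"
          using P_nonneg[of k j] by (simp add: abs_mult mult_left_mono)
      qed
      have "\<theta> ^ 4 * \<bar>v * q k / 4\<bar> \<le> \<theta> ^ 3 * (v * Q / 4)"
        using th v_pos q[of k] by (intro mult_mono power_decreasing) (auto simp: abs_mult divide_right_mono)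
      then show "\<bar>\<theta> ^ 4 * (v * q k / 4)\<bar> \<le> \<theta> ^ 3 * (v * Q / 4)"
        using th by (simp add: abs_mult)
    qed
    moreover have "(\<Sum>j\<in>UNIV. P $ k $ j * (((6 / \<alpha>) ^ 3 * K1 + Q / 2 * (6 / \<alpha> * K1)) * \<theta> ^ 3)) + \<theta> ^ 3 * (v * Q / 4) = C * \<theta> ^ 3"
    proof -
      have "(\<Sum>j\<in>UNIV. P $ k $ j * c) = c" for c
        unfolding sum_distrib_right[of "\<lambda>j. P $ k $ j" UNIV c, symmetric] P_sum by (rule mult_1)
      then show ?thesis unfolding C_def by (simp only: distrib_right mult.commute[of "\<theta> ^ 3"])
    qed
    ultimately show ?thesis by (simp only:)
  qed
  then show thesis using C that by blast
qed

end

section \<open>Exponential moments of the overshoot\<close>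

context additive_walk
begin

lemma integrable_indicator_events [simp]: "A \<in> sets M \<Longrightarrow> integrable M (indicator A :: _ \<Rightarrow> real)"
  by (intro integrable_real_indicator) (auto simp: emeasure_eq_measure)

definition on_alive :: "('e \<Rightarrow> real \<Rightarrow> real) \<Rightarrow> real \<Rightarrow> nat \<Rightarrow> real" where
  "on_alive \<psi> x n = (\<integral>\<omega>. \<psi> (X n \<omega>) (x + walk Y n \<omega>) * indicator (alive x n) \<omega> \<partial>M)"

definition on_dying :: "('e \<Rightarrow> real \<Rightarrow> real) \<Rightarrow> real \<Rightarrow> nat \<Rightarrow> real" where
  "on_dying \<psi> x n = (\<integral>\<omega>. \<psi> (X (Suc n) \<omega>) (x + walk Y (Suc n) \<omega>) * indicator (dying x n) \<omega> \<partial>M)"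

text \<open>The transfer of mass in one step: what \<open>step_op\<close> assigns to the walks that are alive at time \<open>n\<close> is split
into those that survive the next step and those that die in it.\<close>

lemma balance:
  fixes \<psi> :: "'e \<Rightarrow> real \<Rightarrow> real"
  assumes meas: "\<And>j. \<psi> j \<in> borel_measurable borel"
    and nonneg: "\<And>j y. 0 \<le> \<psi> j y"
    and int: "\<And>k j y. integrable (F k j) (\<lambda>t. \<psi> j (y + t))"
    and bound: "\<And>k y. 0 \<le> y \<Longrightarrow> step_op \<psi> k y \<le> C"
  shows "on_alive \<psi> x (Suc n) + on_dying \<psi> x n = on_alive (step_op \<psi>) x n"
    and "integrable M (\<lambda>\<omega>. \<psi> (X (Suc n) \<omega>) (x + walk Y (Suc n) \<omega>) * indicator (dying x n) \<omega>)"
    and "integrable M (\<lambda>\<omega>. step_op \<psi> (X n \<omega>) (x + walk Y n \<omega>) * indicator (alive x n) \<omega>)"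
proof -
  let ?f = "\<lambda>\<omega>. \<psi> (X (Suc n) \<omega>) (x + walk Y (Suc n) \<omega>)"
  have [measurable]: "?f \<in> borel_measurable M" by (rule walk_meas_X[OF meas])
  note se = step_expectation[where \<psi>=\<psi> and C=C and x=x and n=n, OF meas nonneg int bound]
  have dom: "integrable M (\<lambda>\<omega>. ?f \<omega> * indicator B \<omega>)" if "B \<subseteq> alive x n" and [measurable]: "B \<in> sets M" for B
    by (rule Bochner_Integration.integrable_bound[OF se(1)])
      (use that nonneg in \<open>auto simp: indicator_def intro!: AE_I2\<close>)
  show i: "integrable M (\<lambda>\<omega>. ?f \<omega> * indicator (dying x n) \<omega>)" by (rule dom[OF dying_subset]) simp
  show "integrable M (\<lambda>\<omega>. step_op \<psi> (X n \<omega>) (x + walk Y n \<omega>) * indicator (alive x n) \<omega>)" by (rule se(2))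
  have "on_alive \<psi> x (Suc n) + on_dying \<psi> x n =
      (\<integral>\<omega>. ?f \<omega> * indicator (alive x (Suc n)) \<omega> + ?f \<omega> * indicator (dying x n) \<omega> \<partial>M)"
    unfolding on_alive_def on_dying_def
    by (rule Bochner_Integration.integral_add[symmetric]) (intro dom alive_Suc_subset alive_meas, rule i)
  also have "\<dots> = (\<integral>\<omega>. ?f \<omega> * indicator (alive x n) \<omega> \<partial>M)"
    by (simp only: indicator_alive_split[of x n] distrib_left)
  also have "\<dots> = on_alive (step_op \<psi>) x n" unfolding on_alive_def by (rule se(3))
  finally show "on_alive \<psi> x (Suc n) + on_dying \<psi> x n = on_alive (step_op \<psi>) x n" .
qed

lemma on_alive_mono:
  assumes "integrable M (\<lambda>\<omega>. \<psi> (X n \<omega>) (x + walk Y n \<omega>) * indicator (alive x n) \<omega>)"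
    and "integrable M (\<lambda>\<omega>. \<phi> (X n \<omega>) (x + walk Y n \<omega>) * indicator (alive x n) \<omega>)"
    and "\<And>k y. 0 \<le> y \<Longrightarrow> \<psi> k y \<le> \<phi> k y"
  shows "on_alive \<psi> x n \<le> on_alive \<phi> x n"
  unfolding on_alive_def
proof (rule integral_mono[OF assms(1,2)])
  fix \<omega>
  show "\<psi> (X n \<omega>) (x + walk Y n \<omega>) * indicator (alive x n) \<omega> \<le> \<phi> (X n \<omega>) (x + walk Y n \<omega>) * indicator (alive x n) \<omega>"
    using assms(3)[OF alive_nonneg[of \<omega> x n]] by (auto simp: indicator_def)
qed

lemma on_dying_const: "on_dying (\<lambda>_ _. c) x n = c * prob (dying x n)"
  by (simp add: on_dying_def)

lemma on_alive_bound:
  assumes meas: "\<And>j. \<psi> j \<in> borel_measurable borel"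
    and bound: "\<And>k y. 0 \<le> y \<Longrightarrow> \<bar>\<psi> k y\<bar> \<le> C"
  shows "\<bar>on_alive \<psi> x n\<bar> \<le> C * prob (alive x n)"
proof -
  have i: "integrable M (\<lambda>\<omega>. \<psi> (X n \<omega>) (x + walk Y n \<omega>) * indicator (alive x n) \<omega>)"
    by (rule integrable_alive[OF meas bound])
  have "\<bar>on_alive \<psi> x n\<bar> \<le> (\<integral>\<omega>. \<bar>\<psi> (X n \<omega>) (x + walk Y n \<omega>) * indicator (alive x n) \<omega>\<bar> \<partial>M)"
    unfolding on_alive_def by (rule integral_abs_bound)
  also have "\<dots> \<le> (\<integral>\<omega>. C * indicator (alive x n) \<omega> \<partial>M)"
  proof (rule integral_mono[OF integrable_abs[OF i]])
    fix \<omega>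
    show "\<bar>\<psi> (X n \<omega>) (x + walk Y n \<omega>) * indicator (alive x n) \<omega>\<bar> \<le> C * indicator (alive x n) \<omega>"
      using bound[OF alive_nonneg[of \<omega> x n]] by (auto simp: indicator_def)
  qed simp
  finally show ?thesis by simp
qed

end

context corrected_walk
begin

lemma eigenfn_meas [measurable]: "eigenfn \<theta> k \<in> borel_measurable borel"
  unfolding eigenfn_def by measurable

lemma eigenfn_factor:
  assumes "\<theta>\<^sup>2 * Q \<le> 1"
  shows "1 / 2 \<le> 1 + \<theta>\<^sup>2 * q k / 2" "1 + \<theta>\<^sup>2 * q k / 2 \<le> 3 / 2"
proof -
  have "\<bar>\<theta>\<^sup>2 * q k\<bar> \<le> \<theta>\<^sup>2 * Q" using q[of k] by (simp add: abs_mult mult_left_mono)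
  then have "\<bar>\<theta>\<^sup>2 * q k\<bar> \<le> 1" using assms by linarith
  then show "1 / 2 \<le> 1 + \<theta>\<^sup>2 * q k / 2" "1 + \<theta>\<^sup>2 * q k / 2 \<le> 3 / 2" by linarith+
qed

lemma eigenfn_nonneg: "\<theta>\<^sup>2 * Q \<le> 1 \<Longrightarrow> 0 \<le> eigenfn \<theta> k y"
  unfolding eigenfn_def using eigenfn_factor(1)[of \<theta> k] by simp

lemma eigenfn_le:
  assumes "\<theta>\<^sup>2 * Q \<le> 1" "0 \<le> \<theta>"
  shows "eigenfn \<theta> k y \<le> 3 / 2 * exp (- \<theta> * y)"
proof -
  have "exp (- \<theta> * (y + g k)) \<le> exp (- \<theta> * y)" using g(1)[of k] assms(2) by (simp add: algebra_simps)
  then have "exp (- \<theta> * (y + g k)) * (1 + \<theta>\<^sup>2 * q k / 2) \<le> exp (- \<theta> * y) * (3 / 2)"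
    using eigenfn_factor[OF assms(1), of k] by (intro mult_mono) auto
  then show ?thesis by (simp add: eigenfn_def)
qed

text \<open>On negative levels this is the exponential moment of the overshoot at the rate \<open>\<alpha>\<close> that H1 provides.\<close>

definition decay :: "'e \<Rightarrow> real \<Rightarrow> real" where
  "decay k y = exp (- \<alpha> * y)"

lemma decay_meas [measurable]: "decay k \<in> borel_measurable borel"
  unfolding decay_def by measurable

lemma decay_shift: "decay j (y + t) = exp (- \<alpha> * y) * exp (- \<alpha> * t)"
  unfolding decay_def by (simp add: algebra_simps flip: exp_add)

lemma decay_int: "integrable (F k j) (\<lambda>t. decay j (y + t))"
  unfolding decay_shift by (intro integrable_mult_right int_neg)

lemma step_op_decay: "step_op decay k y \<le> K * exp (- \<alpha> * y)"
proof -
  have "step_op decay k y = exp (- \<alpha> * y) * (\<Sum>j\<in>UNIV. P $ k $ j * (\<integral>t. exp (- \<alpha> * t) \<partial>F k j))"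
    unfolding step_op_def decay_shift by (simp add: sum_distrib_left mult_ac)
  also have "\<dots> \<le> exp (- \<alpha> * y) * (\<Sum>j\<in>UNIV. P $ k $ j * K)"
    by (intro mult_left_mono sum_mono K P_nonneg) auto
  also have "(\<Sum>j\<in>UNIV. P $ k $ j * K) = K"
    unfolding sum_distrib_right[symmetric] P_sum by simp
  finally show ?thesis by (simp add: mult.commute)
qed

lemma step_op_decay_le: "0 \<le> y \<Longrightarrow> step_op decay k y \<le> K"
proof -
  assume "0 \<le> y"
  then have "K * exp (- \<alpha> * y) \<le> K * 1" using alpha K_nonneg by (intro mult_left_mono) auto
  then show ?thesis using step_op_decay[of k y] by simp
qed

lemma on_dying_decay_int:
  "integrable M (\<lambda>\<omega>. decay (X (Suc n) \<omega>) (x + walk Y (Suc n) \<omega>) * indicator (dying x n) \<omega>)"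
  using balance(2)[where \<psi>=decay and C=K, OF decay_meas _ decay_int step_op_decay_le] by (simp add: decay_def)

text \<open>The killed walk spends a bounded expected time near 0, uniformly in its starting level. For small fixed
\<open>\<beta>\<close> the eigenfunction is strictly subharmonic, with a gain of at least \<open>c exp (- \<beta> y)\<close> per step. Freezing
it below \<open>- \<kappa>\<close> makes it bounded and costs at most a constant times
\<open>exp (- (\<alpha> - \<beta>) \<kappa>) exp (- \<alpha> y)\<close>, which is at most half of the gain once \<open>\<kappa>\<close> is large. A bounded
function can only collect a bounded total gain.\<close>

lemma alive_exp_sum_bound:
  obtains \<beta> C where "0 < \<beta>" "\<beta> \<le> \<alpha>" "0 \<le> C" "\<And>x N. 0 \<le> x \<Longrightarrow> (\<Sum>n<N. on_alive (\<lambda>_ y. exp (- \<beta> * y)) x n) \<le> C"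
proof -
  obtain C where C: "0 \<le> C" "\<And>\<theta> k. 0 \<le> \<theta> \<Longrightarrow> \<theta> \<le> 1 \<Longrightarrow> \<theta> \<le> \<alpha> / 2 \<Longrightarrow> \<bar>defect \<theta> k\<bar> \<le> C * \<theta> ^ 3"
    using defect_bound by blast
  \<comment> \<open>Small enough for the eigenfunction to be positive (\<open>\<beta>\<^sup>2 Q \<le> 1\<close>) and for the defect \<open>C \<beta>\<^sup>3\<close> to be at most
     half of the gain \<open>\<beta>\<^sup>2 v / 4\<close>.\<close>
  define \<beta> where "\<beta> = min (min 1 (\<alpha> / 2)) (min (1 / (Q + 1)) (v / (8 * (C + 1))))"
  have b: "0 < \<beta>" "\<beta> \<le> 1" "\<beta> \<le> \<alpha> / 2" "\<beta> \<le> 1 / (Q + 1)" "\<beta> \<le> v / (8 * (C + 1))"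
    using alpha v_pos C(1) Q_nonneg unfolding \<beta>_def by (auto simp del: le_divide_eq_numeral1)
  have bQ: "\<beta>\<^sup>2 * Q \<le> 1"
  proof -
    have "\<beta> * \<beta> \<le> 1 * (1 / (Q + 1))" using b by (intro mult_mono) auto
    then have "\<beta>\<^sup>2 * Q \<le> 1 / (Q + 1) * Q" using Q_nonneg by (intro mult_right_mono) (auto simp: power2_eq_square)
    also have "\<dots> \<le> 1" using Q_nonneg by (simp add: field_simps)
    finally show ?thesis .
  qed
  have Cb: "C * \<beta> \<le> v / 8"
  proof -
    have "C * \<beta> \<le> (C + 1) * (v / (8 * (C + 1)))" using b C(1) by (intro mult_mono) auto
    also have "\<dots> = v / 8" using C(1) by (simp add: field_simps)
    finally show ?thesis .
  qed
  define c where "c = exp (- \<beta> * G) * (\<beta>\<^sup>2 * v / 8)"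
  have c: "0 < c" using b v_pos by (simp add: c_def)
  have gain: "eigenfn \<beta> k y + c * exp (- \<beta> * y) \<le> step_op (eigenfn \<beta>) k y" for k y
  proof -
    define E where "E = exp (- \<beta> * (y + g k))"
    have E: "exp (- \<beta> * G) * exp (- \<beta> * y) \<le> E"
      unfolding E_def using g(2)[of k] b(1) by (simp add: algebra_simps flip: exp_add)
    have "C * \<beta> ^ 3 \<le> \<beta>\<^sup>2 * v / 8"
      using mult_left_mono[OF Cb, of "\<beta>\<^sup>2"] by (simp add: eval_nat_numeral mult_ac)
    then have "- (\<beta>\<^sup>2 * v / 8) \<le> defect \<beta> k" using C(2)[of \<beta> k] b by (simp add: abs_le_iff)
    then have d: "- (E * (\<beta>\<^sup>2 * v / 8)) \<le> E * defect \<beta> k"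
      using mult_left_mono[of "- (\<beta>\<^sup>2 * v / 8)" "defect \<beta> k" E] by (simp add: E_def)
    have "E * (1 / 2) \<le> eigenfn \<beta> k y" unfolding eigenfn_def E_def using eigenfn_factor(1)[OF bQ] by (intro mult_left_mono) auto
    then have "\<beta>\<^sup>2 * v / 2 * (E * (1 / 2)) \<le> \<beta>\<^sup>2 * v / 2 * eigenfn \<beta> k y" using v_pos by (intro mult_left_mono) auto
    moreover have "c * exp (- \<beta> * y) \<le> E * (\<beta>\<^sup>2 * v / 8)"
      using mult_right_mono[OF E, of "\<beta>\<^sup>2 * v / 8"] v_pos by (simp add: c_def mult_ac)
    moreover have "step_op (eigenfn \<beta>) k y = eigenfn \<beta> k y + \<beta>\<^sup>2 * v / 2 * eigenfn \<beta> k y + E * defect \<beta> k"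
      using step_op_eigenfn[of \<beta> k y] b alpha by (simp add: E_def algebra_simps)
    moreover have "\<beta>\<^sup>2 * v / 2 * (E * (1 / 2)) = 2 * (E * (\<beta>\<^sup>2 * v / 8))" by simp
    moreover have "0 \<le> E * (\<beta>\<^sup>2 * v / 8)" using v_pos by (simp add: E_def)
    ultimately show ?thesis using d by linarith
  qed
  \<comment> \<open>The share of the frozen part, chosen such that \<open>3 / 2 r K\<close> is at most half of the gain \<open>c\<close>.\<close>
  define r where "r = c / (3 * (K + 1))"
  have r: "0 < r" "3 / 2 * r * K \<le> c / 2"
  proof -
    show "0 < r" using c K_nonneg by (simp add: r_def)
    have "3 / 2 * r * K \<le> 3 / 2 * r * (K + 1)" using \<open>0 < r\<close> by (intro mult_left_mono) auto
    also have "\<dots> = c / 2"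
    proof -
      have "K + 1 \<noteq> 0" using K_nonneg by simp
      then show ?thesis by (simp add: r_def field_simps)
    qed
    finally show "3 / 2 * r * K \<le> c / 2" .
  qed
  define \<kappa> where "\<kappa> = \<bar>ln r\<bar> / (\<alpha> - \<beta>)"
  have ab: "0 < \<alpha> - \<beta>" using b alpha by simp
  have kappa: "0 \<le> \<kappa>" "exp (- (\<alpha> - \<beta>) * \<kappa>) \<le> r"
  proof -
    show "0 \<le> \<kappa>" using ab by (simp add: \<kappa>_def)
    have "(\<alpha> - \<beta>) * \<kappa> = \<bar>ln r\<bar>" using ab by (simp add: \<kappa>_def)
    then have "- (\<alpha> - \<beta>) * \<kappa> = - \<bar>ln r\<bar>" by (simp only: mult_minus_left)
    also have "\<dots> \<le> ln r" by simp
    finally have "exp (- (\<alpha> - \<beta>) * \<kappa>) \<le> exp (ln r)" by (simp only: exp_le_cancel_iff)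
    then show "exp (- (\<alpha> - \<beta>) * \<kappa>) \<le> r" using r by simp
  qed
  define \<psi> where "\<psi> j y = eigenfn \<beta> j (max y (- \<kappa>))" for j y
  define U where "U = 3 / 2 * exp (\<beta> * \<kappa>)"
  have psi_meas [measurable]: "\<psi> j \<in> borel_measurable borel" for j unfolding \<psi>_def by measurable
  have psi0: "0 \<le> \<psi> j y" for j y unfolding \<psi>_def by (rule eigenfn_nonneg[OF bQ])
  have psiU: "\<psi> j y \<le> U" for j y
  proof -
    have "\<psi> j y \<le> 3 / 2 * exp (- \<beta> * max y (- \<kappa>))" unfolding \<psi>_def using b by (intro eigenfn_le bQ) auto
    also have "\<dots> \<le> U"
    proof -
      have "\<beta> * (- max y (- \<kappa>)) \<le> \<beta> * \<kappa>" using b(1) by (intro mult_left_mono) auto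
      then show ?thesis unfolding U_def by simp
    qed
    finally show ?thesis .
  qed
  have psi_int: "integrable (F k j) (\<lambda>t. \<psi> j (y + t))" for k j y
  proof -
    interpret Fk: prob_space "F k j" by (rule F_prob)
    show ?thesis by (rule Fk.integrable_const_bound[where B=U]) (use psi0 psiU in auto)
  qed
  have step_psi: "step_op \<psi> k y \<le> U" for k y
  proof -
    interpret Fk: prob_space "F k j" for j by (rule F_prob)
    have "step_op \<psi> k y \<le> (\<Sum>j\<in>UNIV. P $ k $ j * U)"
      unfolding step_op_def by (intro sum_mono mult_left_mono Fk.integral_le_const psi_int P_nonneg) (auto simp: psiU)
    also have "\<dots> = U" unfolding sum_distrib_right[symmetric] P_sum by simp
    finally show ?thesis .
  qed
  have psi_gain: "\<psi> k y + c / 2 * exp (- \<beta> * y) \<le> step_op \<psi> k y" if y: "0 \<le> y" for k y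
  proof -
    \<comment> \<open>Below \<open>- \<kappa>\<close> the eigenfunction, of growth \<open>exp (- \<beta> w)\<close>, is a small multiple of \<open>exp (- \<alpha> w)\<close>, since \<open>\<beta> < \<alpha>\<close>.\<close>
    have pt: "eigenfn \<beta> j w - 3 / 2 * r * decay j w \<le> \<psi> j w" for j w
    proof (cases "w < - \<kappa>")
      case False
      then have "\<psi> j w = eigenfn \<beta> j w" by (simp add: \<psi>_def max_def)
      moreover have "0 \<le> 3 / 2 * r * decay j w" using r by (simp add: decay_def)
      ultimately show ?thesis by linarith
    next
      case True
      have "eigenfn \<beta> j w \<le> 3 / 2 * exp (- \<beta> * w)" using b by (intro eigenfn_le bQ) auto
      also have "exp (- \<beta> * w) = decay j w * exp ((\<alpha> - \<beta>) * w)"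
        unfolding decay_def by (simp add: algebra_simps flip: exp_add)
      also have "exp ((\<alpha> - \<beta>) * w) \<le> exp (- (\<alpha> - \<beta>) * \<kappa>)"
        using mult_left_mono[of w "- \<kappa>" "\<alpha> - \<beta>"] True ab by (simp add: algebra_simps)
      also have "\<dots> \<le> r" by (rule kappa)
      finally have "eigenfn \<beta> j w \<le> 3 / 2 * (decay j w * r)" by (simp add: decay_def)
      then show ?thesis using psi0[of j w] by (simp add: mult_ac)
    qed
    have int1: "integrable (F k j) (\<lambda>t. eigenfn \<beta> j (y + t))" for j
      using b alpha by (intro eigenfn_int) auto
    have "step_op (eigenfn \<beta>) k y - 3 / 2 * r * step_op decay k y =
        (\<Sum>j\<in>UNIV. P $ k $ j * (\<integral>t. eigenfn \<beta> j (y + t) - 3 / 2 * r * decay j (y + t) \<partial>F k j))"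
      unfolding step_op_def using int1 decay_int
      by (simp add: sum_distrib_left right_diff_distrib sum_subtractf mult_ac)
    also have "\<dots> \<le> step_op \<psi> k y"
      unfolding step_op_def
    proof (intro sum_mono mult_left_mono P_nonneg)
      fix j show "(\<integral>t. eigenfn \<beta> j (y + t) - 3 / 2 * r * decay j (y + t) \<partial>F k j) \<le> (\<integral>t. \<psi> j (y + t) \<partial>F k j)"
        using int1 decay_int psi_int pt
        by (intro integral_mono Bochner_Integration.integrable_diff integrable_mult_right) auto
    qed
    finally have 1: "step_op (eigenfn \<beta>) k y - 3 / 2 * r * step_op decay k y \<le> step_op \<psi> k y" .
    have "3 / 2 * r * step_op decay k y \<le> 3 / 2 * r * (K * exp (- \<alpha> * y))"
      using r step_op_decay by (intro mult_left_mono) auto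
    also have "\<dots> = (3 / 2 * r * K) * exp (- \<alpha> * y)" by simp
    also have "\<dots> \<le> c / 2 * exp (- \<beta> * y)"
      using r c b y ab by (intro mult_mono) (auto intro!: mult_right_mono)
    finally have 2: "3 / 2 * r * step_op decay k y \<le> c / 2 * exp (- \<beta> * y)" .
    have "\<psi> k y = eigenfn \<beta> k y" using y kappa(1) by (simp add: \<psi>_def)
    then show ?thesis using 1 2 gain[of k y] by linarith
  qed
  have "(\<Sum>n<N. on_alive (\<lambda>_ y. exp (- \<beta> * y)) x n) \<le> 2 * U / c" if x: "0 \<le> x" for x N
  proof -
    define h where "h = on_alive (\<lambda>_ y. exp (- \<beta> * y)) x"
    have exp1: "\<bar>exp (- \<beta> * y)\<bar> \<le> 1" if "0 \<le> y" for y using that b by simp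
    \<comment> \<open>One step of the bounded function: its gain is collected on the surviving walks, and on the dying ones
       it is at most \<open>U\<close>.\<close>
    have step: "c / 2 * h n \<le> (on_alive \<psi> x (Suc n) - on_alive \<psi> x n) + U * (prob (alive x n) - prob (alive x (Suc n)))" for n
    proof -
      have bal: "on_alive \<psi> x (Suc n) + on_dying \<psi> x n = on_alive (step_op \<psi>) x n"
        and idy: "integrable M (\<lambda>\<omega>. \<psi> (X (Suc n) \<omega>) (x + walk Y (Suc n) \<omega>) * indicator (dying x n) \<omega>)"
        and ist: "integrable M (\<lambda>\<omega>. step_op \<psi> (X n \<omega>) (x + walk Y n \<omega>) * indicator (alive x n) \<omega>)"
        using balance[where \<psi>=\<psi> and C=U and x=x and n=n, OF psi_meas psi0 psi_int step_psi] by auto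
      have "on_dying \<psi> x n \<le> on_dying (\<lambda>_ _. U) x n"
        unfolding on_dying_def
        by (intro integral_mono idy) (auto simp: psiU intro!: mult_right_mono)
      then have dy: "on_dying \<psi> x n \<le> U * (prob (alive x n) - prob (alive x (Suc n)))"
        by (simp add: on_dying_const prob_dying)
      have i1: "integrable M (\<lambda>\<omega>. \<psi> (X n \<omega>) (x + walk Y n \<omega>) * indicator (alive x n) \<omega>)"
        by (rule integrable_alive[where C=U]) (use psi0 psiU in auto)
      have i2: "integrable M (\<lambda>\<omega>. exp (- \<beta> * (x + walk Y n \<omega>)) * indicator (alive x n) \<omega>)"
        by (rule integrable_alive[where C=1 and \<psi>="\<lambda>_ y. exp (- \<beta> * y)"]) (use exp1 in auto)
      have "on_alive \<psi> x n + c / 2 * h n = on_alive (\<lambda>k y. \<psi> k y + c / 2 * exp (- \<beta> * y)) x n"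
        unfolding on_alive_def h_def using i1 i2
        by (simp add: distrib_right mult.assoc Bochner_Integration.integral_add integrable_mult_right)
      also have "\<dots> \<le> on_alive (step_op \<psi>) x n"
      proof (rule on_alive_mono[OF _ ist psi_gain])
        show "integrable M (\<lambda>\<omega>. (\<psi> (X n \<omega>) (x + walk Y n \<omega>) + c / 2 * exp (- \<beta> * (x + walk Y n \<omega>))) * indicator (alive x n) \<omega>)"
          using Bochner_Integration.integrable_add[OF i1 integrable_mult_right[OF i2, of "c/2"]]
          by (simp add: distrib_right mult.assoc)
      qed
      finally show ?thesis using bal dy by linarith
    qed
    have "c / 2 * (\<Sum>n<N. h n) \<le> (\<Sum>n<N. (on_alive \<psi> x (Suc n) - on_alive \<psi> x n) + U * (prob (alive x n) - prob (alive x (Suc n))))"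
      unfolding sum_distrib_left by (intro sum_mono step)
    also have "\<dots> = (on_alive \<psi> x N - on_alive \<psi> x 0) + U * (prob (alive x 0) - prob (alive x N))"
      by (induction N) (auto simp: algebra_simps)
    also have "\<dots> \<le> U"
    proof -
      have "\<bar>on_alive \<psi> x N\<bar> \<le> U * prob (alive x N)" by (rule on_alive_bound) (use psi0 psiU in auto)
      moreover have "0 \<le> on_alive \<psi> x 0" unfolding on_alive_def by (intro integral_nonneg_AE) (auto simp: psi0)
      moreover have "U * prob (alive x 0) \<le> U * 1" by (intro mult_left_mono prob_le_1) (simp add: U_def)
      ultimately show ?thesis by (simp add: right_diff_distrib)
    qed
    finally show ?thesis using c by (simp add: h_def field_simps)
  qed
  moreover have "0 \<le> 2 * U / c" using c by (simp add: U_def)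
  ultimately show thesis using that[of \<beta> "2 * U / c"] b alpha by auto
qed

text \<open>Jumping from level \<open>y \<ge> 0\<close> below 0 has, weighted with the exponential of the overshoot, a cost of at most
\<open>K exp (- \<alpha> y)\<close>; summing over the levels visited before death reduces this to
\<open>alive_exp_sum_bound\<close>.\<close>

lemma dying_exp_sum_bound:
  obtains C where "0 \<le> C" "\<And>x N. 0 \<le> x \<Longrightarrow> (\<Sum>n<N. on_dying decay x n) \<le> C"
proof -
  obtain \<beta> C where b: "0 < \<beta>" "\<beta> \<le> \<alpha>" and C: "0 \<le> C"
    "\<And>x N. 0 \<le> x \<Longrightarrow> (\<Sum>n<N. on_alive (\<lambda>_ y. exp (- \<beta> * y)) x n) \<le> C"
    using alive_exp_sum_bound by blast
  have step: "on_dying decay x n \<le> K * on_alive (\<lambda>_ y. exp (- \<beta> * y)) x n" for x n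
  proof -
    have exp0: "0 \<le> decay j y" for j y by (simp add: decay_def)
    have bal: "on_alive decay x (Suc n) + on_dying decay x n = on_alive (step_op decay) x n"
      and ist: "integrable M (\<lambda>\<omega>. step_op decay (X n \<omega>) (x + walk Y n \<omega>) * indicator (alive x n) \<omega>)"
      using balance[where \<psi>=decay and C=K and x=x and n=n, OF decay_meas exp0 decay_int step_op_decay_le] by auto
    have "0 \<le> on_alive decay x (Suc n)" unfolding on_alive_def by (intro integral_nonneg_AE) (auto simp: exp0)
    moreover have "on_alive (step_op decay) x n \<le> on_alive (\<lambda>_ y. K * exp (- \<beta> * y)) x n"
    proof (rule on_alive_mono[OF ist])
      show "integrable M (\<lambda>\<omega>. K * exp (- \<beta> * (x + walk Y n \<omega>)) * indicator (alive x n) \<omega>)"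
        by (rule integrable_alive[where C=K and \<psi>="\<lambda>_ y. K * exp (- \<beta> * y)"])
          (use b K_nonneg in \<open>auto simp: abs_mult mult_left_le\<close>)
      fix k and y :: real assume y: "0 \<le> y"
      have "K * exp (- \<alpha> * y) \<le> K * exp (- \<beta> * y)"
        using y b K_nonneg by (intro mult_left_mono) (auto intro!: mult_right_mono)
      then show "step_op decay k y \<le> K * exp (- \<beta> * y)" using step_op_decay[of k y] by linarith
    qed
    moreover have "on_alive (\<lambda>_ y. K * exp (- \<beta> * y)) x n = K * on_alive (\<lambda>_ y. exp (- \<beta> * y)) x n"
      by (simp add: on_alive_def mult.assoc)
    ultimately show ?thesis using bal by linarith
  qed
  have "(\<Sum>n<N. on_dying decay x n) \<le> K * C" if x: "0 \<le> x" for x N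
  proof -
    have "(\<Sum>n<N. on_dying decay x n) \<le> K * (\<Sum>n<N. on_alive (\<lambda>_ y. exp (- \<beta> * y)) x n)"
      unfolding sum_distrib_left by (intro sum_mono step)
    also have "\<dots> \<le> K * C" by (intro mult_left_mono C(2)[OF x] K_nonneg)
    finally show ?thesis .
  qed
  then show thesis using that[of "K * C"] K_nonneg C(1) by auto
qed

end

section \<open>The generating function of the survival probabilities\<close>

context corrected_walk
begin

text \<open>The martingale \<open>S\<^sub>n + g (X\<^sub>n)\<close> shifted by \<open>x\<close>, as a function of the current state and level; at the time
of death it is the overshoot together with the corrector.\<close>

definition overshoot :: "'e \<Rightarrow> real \<Rightarrow> real" where
  "overshoot k y = y + g k"

text \<open>The reciprocal of the approximate eigenvalue, so that the discounted eigenfunction is nearly a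
martingale.\<close>

definition discount :: "real \<Rightarrow> real" where
  "discount \<theta> = 1 / (1 + \<theta>\<^sup>2 * v / 2)"

definition survival_gf :: "real \<Rightarrow> real \<Rightarrow> real" where
  "survival_gf x s = (\<Sum>n. prob (alive x n) * s ^ n)"

text \<open>With \<open>s = discount \<theta>\<close>, the numerator \<open>(1 - s) \<Sum> s\<^sup>n \<P>(\<tau> > n)\<close> is \<open>1 - \<E>(s\<^sup>\<tau>)\<close>, which is of order \<open>\<theta>\<close>.\<close>

definition scaled_gf :: "real \<Rightarrow> real \<Rightarrow> real" where
  "scaled_gf x \<theta> = (1 - discount \<theta>) * survival_gf x (discount \<theta>) / \<theta>"

text \<open>The harmonic function of the walk killed below 0, at the starting state \<open>i\<close>: level plus corrector, minus
the expectation of the same quantity at the time of death.\<close>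

definition harmonic :: "real \<Rightarrow> real" where
  "harmonic x = x + g i - (\<Sum>n. on_dying overshoot x n)"

lemma overshoot_meas [measurable]: "overshoot k \<in> borel_measurable borel"
  unfolding overshoot_def by measurable

text \<open>At death the level is negative, so any function that \<open>decay\<close> dominates there is under control.\<close>

lemma on_dying_dominated:
  assumes meas: "\<And>j. \<psi> j \<in> borel_measurable borel"
    and dom: "\<And>k y. y < 0 \<Longrightarrow> \<bar>\<psi> k y\<bar> \<le> C * decay k y"
  shows "integrable M (\<lambda>\<omega>. \<psi> (X (Suc n) \<omega>) (x + walk Y (Suc n) \<omega>) * indicator (dying x n) \<omega>)"
    and "\<bar>on_dying \<psi> x n\<bar> \<le> C * on_dying decay x n"
proof -
  let ?f = "\<lambda>\<omega>. \<psi> (X (Suc n) \<omega>) (x + walk Y (Suc n) \<omega>) * indicator (dying x n) \<omega>"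
  let ?e = "\<lambda>\<omega>. C * (decay (X (Suc n) \<omega>) (x + walk Y (Suc n) \<omega>) * indicator (dying x n) \<omega>)"
  have [measurable]: "(\<lambda>\<omega>. \<psi> (X (Suc n) \<omega>) (x + walk Y (Suc n) \<omega>)) \<in> borel_measurable M"
    by (rule walk_meas_X[OF meas])
  have fm: "?f \<in> borel_measurable M" by measurable
  have pt: "\<bar>?f \<omega>\<bar> \<le> ?e \<omega>" for \<omega>
    using dom[of "x + walk Y (Suc n) \<omega>" "X (Suc n) \<omega>"] by (auto simp: indicator_def dying_def)
  have ei: "integrable M ?e" by (intro integrable_mult_right on_dying_decay_int)
  show fi: "integrable M ?f"
    by (rule Bochner_Integration.integrable_bound[OF ei fm]) (use pt in \<open>auto intro!: AE_I2 intro: order.trans[OF _ abs_ge_self]\<close>)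
  have "\<bar>on_dying \<psi> x n\<bar> \<le> (\<integral>\<omega>. \<bar>?f \<omega>\<bar> \<partial>M)"
    unfolding on_dying_def by (rule integral_abs_bound)
  also have "\<dots> \<le> (\<integral>\<omega>. ?e \<omega> \<partial>M)" by (intro integral_mono integrable_abs fi ei pt)
  finally show "\<bar>on_dying \<psi> x n\<bar> \<le> C * on_dying decay x n" by (simp add: on_dying_def)
qed

lemma exp_overshoot_le: "y < 0 \<Longrightarrow> exp (\<alpha> * \<bar>overshoot k y\<bar>) \<le> exp (\<alpha> * G) * decay k y"
proof -
  assume "y < 0"
  then have "\<bar>overshoot k y\<bar> \<le> G - y" using g[of k] by (auto simp: overshoot_def)
  then have "\<alpha> * \<bar>overshoot k y\<bar> \<le> \<alpha> * (G - y)" using alpha by (intro mult_left_mono) auto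
  then show ?thesis by (simp add: decay_def algebra_simps flip: exp_add)
qed

lemma overshoot_le: "y < 0 \<Longrightarrow> \<bar>overshoot k y\<bar> \<le> (1 / \<alpha> * exp (\<alpha> * G)) * decay k y"
proof -
  assume y: "y < 0"
  have "\<bar>overshoot k y\<bar> ^ 1 \<le> (1 / \<alpha>) ^ 1 * exp (real 1 * \<alpha> * \<bar>overshoot k y\<bar>)"
    using alpha by (intro pow_le_exp) auto
  also have "\<dots> \<le> (1 / \<alpha>) * (exp (\<alpha> * G) * decay k y)"
    using exp_overshoot_le[OF y, of k] alpha by (simp add: divide_right_mono)
  finally show ?thesis by simp
qed

lemma eigenfn_overshoot:
  assumes th: "0 \<le> \<theta>" "\<theta> \<le> \<alpha> / 2" and y: "y < 0"
  shows "\<bar>eigenfn \<theta> k y - 1 + \<theta> * overshoot k y\<bar> \<le> (\<theta>\<^sup>2 * (exp (\<alpha> * G) * ((6 / \<alpha>)\<^sup>2 + Q / 2))) * decay k y"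
proof -
  define z where "z = overshoot k y"
  have 1: "\<bar>exp (- \<theta> * z) - 1 + \<theta> * z\<bar> \<le> (\<theta> * (6 / \<alpha>))\<^sup>2 * exp (\<alpha> * \<bar>z\<bar>)"
    using exp_taylor_remainder[of \<alpha> \<theta> 2 z] alpha th by (simp add: eval_nat_numeral algebra_simps)
  have "- \<theta> * z \<le> \<alpha> * \<bar>z\<bar>"
  proof -
    have "- \<theta> * z \<le> \<bar>\<theta> * z\<bar>" by (simp add: abs_if)
    also have "\<dots> = \<theta> * \<bar>z\<bar>" using th by (simp add: abs_mult)
    also have "\<dots> \<le> \<alpha> * \<bar>z\<bar>" using th alpha by (intro mult_right_mono) auto
    finally show ?thesis .
  qed
  then have "exp (- \<theta> * z) * \<bar>q k\<bar> \<le> exp (\<alpha> * \<bar>z\<bar>) * Q" using q by (intro mult_mono) auto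
  then have "\<theta>\<^sup>2 / 2 * (exp (- \<theta> * z) * \<bar>q k\<bar>) \<le> \<theta>\<^sup>2 / 2 * (exp (\<alpha> * \<bar>z\<bar>) * Q)" by (intro mult_left_mono) auto
  moreover have "\<bar>exp (- \<theta> * z) * (\<theta>\<^sup>2 * q k / 2)\<bar> = \<theta>\<^sup>2 / 2 * (exp (- \<theta> * z) * \<bar>q k\<bar>)"
    by (simp add: abs_mult)
  ultimately have 2: "\<bar>exp (- \<theta> * z) * (\<theta>\<^sup>2 * q k / 2)\<bar> \<le> \<theta>\<^sup>2 / 2 * (exp (\<alpha> * \<bar>z\<bar>) * Q)" by simp
  have "eigenfn \<theta> k y - 1 + \<theta> * z = (exp (- \<theta> * z) - 1 + \<theta> * z) + exp (- \<theta> * z) * (\<theta>\<^sup>2 * q k / 2)"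
    by (simp add: eigenfn_def z_def overshoot_def algebra_simps)
  then have "\<bar>eigenfn \<theta> k y - 1 + \<theta> * z\<bar> \<le> (\<theta> * (6 / \<alpha>))\<^sup>2 * exp (\<alpha> * \<bar>z\<bar>) + \<theta>\<^sup>2 / 2 * (exp (\<alpha> * \<bar>z\<bar>) * Q)"
    using 1 2 by linarith
  also have "\<dots> = \<theta>\<^sup>2 * ((6 / \<alpha>)\<^sup>2 + Q / 2) * exp (\<alpha> * \<bar>z\<bar>)"
    unfolding power_mult_distrib by (simp only: distrib_left distrib_right) simp
  also have "\<dots> \<le> \<theta>\<^sup>2 * ((6 / \<alpha>)\<^sup>2 + Q / 2) * (exp (\<alpha> * G) * decay k y)"
    using exp_overshoot_le[OF y, of k] Q_nonneg unfolding z_def by (intro mult_left_mono) auto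
  finally show ?thesis by (simp only: z_def mult_ac)
qed

lemma eigenfn_start:
  assumes "0 \<le> \<theta>" "0 \<le> x"
  shows "\<bar>eigenfn \<theta> k x - 1 + \<theta> * overshoot k x\<bar> \<le> \<theta>\<^sup>2 * ((x + G)\<^sup>2 + Q / 2)"
proof -
  define w where "w = \<theta> * overshoot k x"
  have w: "0 \<le> w" "w \<le> \<theta> * (x + G)" using assms g[of k] by (auto simp: w_def overshoot_def intro!: mult_left_mono)
  have "0 \<le> exp (- w) - 1 + w" using exp_ge_add_one_self[of "- w"] by linarith
  moreover have "exp (- w) - 1 + w \<le> w\<^sup>2"
  proof -
    have "exp (- w) \<le> 1 / (1 + w)" using w exp_ge_add_one_self[of w] by (simp add: exp_minus field_simps)
    also have "\<dots> \<le> 1 - w + w\<^sup>2" using w by (simp add: field_simps power2_eq_square)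
    finally show ?thesis by simp
  qed
  moreover have "w\<^sup>2 \<le> \<theta>\<^sup>2 * (x + G)\<^sup>2" using power_mono[OF w(2) w(1), of 2] by (simp add: power_mult_distrib)
  ultimately have 1: "\<bar>exp (- w) - 1 + w\<bar> \<le> \<theta>\<^sup>2 * (x + G)\<^sup>2" by linarith
  have "exp (- w) * \<bar>q k\<bar> \<le> 1 * Q" using q w by (intro mult_mono) auto
  then have "\<theta>\<^sup>2 / 2 * (exp (- w) * \<bar>q k\<bar>) \<le> \<theta>\<^sup>2 / 2 * Q" by (intro mult_left_mono) auto
  moreover have "\<bar>exp (- w) * (\<theta>\<^sup>2 * q k / 2)\<bar> = \<theta>\<^sup>2 / 2 * (exp (- w) * \<bar>q k\<bar>)" by (simp add: abs_mult)
  ultimately have 2: "\<bar>exp (- w) * (\<theta>\<^sup>2 * q k / 2)\<bar> \<le> \<theta>\<^sup>2 / 2 * Q" by simp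
  have "eigenfn \<theta> k x - 1 + \<theta> * overshoot k x = (exp (- w) - 1 + w) + exp (- w) * (\<theta>\<^sup>2 * q k / 2)"
    by (simp add: eigenfn_def w_def overshoot_def algebra_simps)
  then have "\<bar>eigenfn \<theta> k x - 1 + \<theta> * overshoot k x\<bar> \<le> \<theta>\<^sup>2 * (x + G)\<^sup>2 + \<theta>\<^sup>2 / 2 * Q" using 1 2 by linarith
  then show ?thesis by (simp add: distrib_left)
qed

lemma on_alive_0:
  assumes "0 \<le> x"
  shows "on_alive \<psi> x 0 = \<psi> i x"
proof -
  have "on_alive \<psi> x 0 = (\<integral>\<omega>. \<psi> (X 0 \<omega>) x \<partial>M)"
    unfolding on_alive_def using alive_0[OF assms] by (intro Bochner_Integration.integral_cong) auto
  also have "\<dots> = (\<integral>\<omega>. \<psi> i x \<partial>M)"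
  proof (rule integral_cong_AE)
    show "(\<lambda>\<omega>. \<psi> (X 0 \<omega>) x) \<in> borel_measurable M"
      using measurable_compose[OF X_meas[of 0], of "\<lambda>j. \<psi> j x" borel] by simp
    show "AE \<omega> in M. \<psi> (X 0 \<omega>) x = \<psi> i x" using start by eventually_elim simp
  qed simp
  also have "\<dots> = \<psi> i x" by (simp add: prob_space)
  finally show ?thesis .
qed

lemma discount_bounds:
  assumes "0 < \<theta>"
  shows "0 < discount \<theta>" "discount \<theta> < 1" "discount \<theta> * (1 + \<theta>\<^sup>2 * v / 2) = 1"
proof -
  have "0 < \<theta>\<^sup>2 * v / 2" using assms v_pos by simp
  then show "0 < discount \<theta>" "discount \<theta> < 1" "discount \<theta> * (1 + \<theta>\<^sup>2 * v / 2) = 1"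
    by (auto simp: discount_def field_simps)
qed

lemma summable_survival: "0 \<le> s \<Longrightarrow> s < 1 \<Longrightarrow> summable (\<lambda>n. prob (alive x n) * s ^ n)"
  by (rule summable_bounded_power[where D=1]) auto

lemma summable_dying:
  assumes "0 \<le> x" and C: "\<And>N. (\<Sum>n<N. on_dying decay x n) \<le> C"
  shows "summable (on_dying decay x)" "suminf (on_dying decay x) \<le> C" "0 \<le> on_dying decay x n"
proof -
  have 0: "0 \<le> on_dying decay x n" for n
    unfolding on_dying_def by (intro integral_nonneg_AE) (auto simp: decay_def)
  show "0 \<le> on_dying decay x n" by (rule 0)
  show s: "summable (on_dying decay x)" by (rule summableI_nonneg_bounded[OF 0 C])
  show "suminf (on_dying decay x) \<le> C" by (rule suminf_le_const[OF s C])
qed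

text \<open>Optional stopping for the discounted eigenfunction, in the form of a telescoping sum. The value at death
is split as \<open>1 - \<theta> overshoot\<close> plus a remainder; the discounted masses \<open>\<P>(\<tau> = n + 1)\<close> then add up to
\<open>1 - (1 - s) \<Sum> s\<^sup>n \<P>(\<tau> > n)\<close>.\<close>

lemma survival_gf_identity:
  assumes x: "0 \<le> x" and th: "0 < \<theta>" "\<theta> \<le> \<alpha> / 2" "\<theta>\<^sup>2 * Q \<le> 1"
  defines "s \<equiv> discount \<theta>"
  shows "(1 - s) * survival_gf x s = \<theta> * overshoot i x - \<theta> * (\<Sum>n. on_dying overshoot x n * s ^ Suc n)
    + (\<Sum>n. on_dying (\<lambda>k y. eigenfn \<theta> k y - 1 + \<theta> * overshoot k y) x n * s ^ Suc n)
    - (\<Sum>n. on_alive (\<lambda>k y. exp (- \<theta> * (y + g k)) * defect \<theta> k) x n * s ^ Suc n)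
    - (eigenfn \<theta> i x - 1 + \<theta> * overshoot i x)"
    and "summable (\<lambda>n. on_dying overshoot x n * s ^ Suc n)"
    and "summable (\<lambda>n. on_dying (\<lambda>k y. eigenfn \<theta> k y - 1 + \<theta> * overshoot k y) x n * s ^ Suc n)"
    and "summable (\<lambda>n. on_alive (\<lambda>k y. exp (- \<theta> * (y + g k)) * defect \<theta> k) x n * s ^ Suc n)"
proof -
  note s = discount_bounds[OF th(1), folded s_def]
  have tha: "\<theta> \<le> \<alpha>" using th alpha by simp
  define er where "er k y = eigenfn \<theta> k y - 1 + \<theta> * overshoot k y" for k y
  define rr where "rr k y = exp (- \<theta> * (y + g k)) * defect \<theta> k" for k y
  have er_meas [measurable]: "er j \<in> borel_measurable borel" for j unfolding er_def by measurable
  have rr_meas [measurable]: "rr j \<in> borel_measurable borel" for j unfolding rr_def by measurable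
  obtain C5 where C5: "0 \<le> C5" "\<And>N. (\<Sum>n<N. on_dying decay x n) \<le> C5"
    using dying_exp_sum_bound x by metis
  note sd = summable_dying[OF x C5(2)]
  have sbp: "summable (\<lambda>n. c n * s ^ Suc n)" if "\<And>n. \<bar>c n\<bar> \<le> D" for c :: "nat \<Rightarrow> real" and D
    using summable_mult[OF summable_bounded_power[of c D s], of s] that s by (simp add: mult_ac)
  have yle: "on_dying decay x n \<le> C5" for n
    using C5(2)[of "Suc n"] sum_nonneg[of "{..<n}" "on_dying decay x"] sd(3) by simp
  have sdom: "summable (\<lambda>n. on_dying \<psi> x n * s ^ Suc n)"
    if "\<And>j. \<psi> j \<in> borel_measurable borel" "\<And>k y. y < 0 \<Longrightarrow> \<bar>\<psi> k y\<bar> \<le> C * decay k y" for \<psi> C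
  proof (rule sbp)
    fix n
    have "\<bar>on_dying \<psi> x n\<bar> \<le> C * on_dying decay x n" by (rule on_dying_dominated(2)[OF that])
    also have "\<dots> \<le> \<bar>C\<bar> * C5" using yle[of n] sd(3)[of n] by (intro mult_mono) auto
    finally show "\<bar>on_dying \<psi> x n\<bar> \<le> \<bar>C\<bar> * C5" .
  qed
  show so: "summable (\<lambda>n. on_dying overshoot x n * s ^ Suc n)"
    by (rule sdom[OF overshoot_meas overshoot_le])
  have er_le: "\<bar>er k y\<bar> \<le> (\<theta>\<^sup>2 * (exp (\<alpha> * G) * ((6 / \<alpha>)\<^sup>2 + Q / 2))) * decay k y" if "y < 0" for k y
    unfolding er_def using th that by (intro eigenfn_overshoot) auto
  have se: "summable (\<lambda>n. on_dying er x n * s ^ Suc n)"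
    by (rule sdom[OF er_meas er_le])
  then show "summable (\<lambda>n. on_dying (\<lambda>k y. eigenfn \<theta> k y - 1 + \<theta> * overshoot k y) x n * s ^ Suc n)"
    by (simp add: er_def[abs_def])
  obtain Cd where Cd: "\<And>k. \<bar>defect \<theta> k\<bar> \<le> Cd"
  proof -
    have "\<bar>defect \<theta> k\<bar> \<le> (\<Sum>k\<in>UNIV. \<bar>defect \<theta> k\<bar>)" for k by (intro member_le_sum) auto
    then show thesis by (rule that)
  qed
  have rr_le: "\<bar>rr k y\<bar> \<le> Cd" if "0 \<le> y" for k y
  proof -
    have "exp (- \<theta> * (y + g k)) * \<bar>defect \<theta> k\<bar> \<le> 1 * Cd"
      using that g[of k] th Cd[of k] by (intro mult_mono) auto
    then show ?thesis by (simp add: rr_def abs_mult)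
  qed
  have sr: "summable (\<lambda>n. on_alive rr x n * s ^ Suc n)"
  proof (rule sbp)
    fix n
    have "0 \<le> Cd" using Cd abs_ge_zero order.trans by blast
    have "\<bar>on_alive rr x n\<bar> \<le> Cd * prob (alive x n)" by (rule on_alive_bound[OF rr_meas rr_le])
    also have "\<dots> \<le> Cd * 1" using \<open>0 \<le> Cd\<close> by (intro mult_left_mono) auto
    finally show "\<bar>on_alive rr x n\<bar> \<le> Cd" by simp
  qed
  then show "summable (\<lambda>n. on_alive (\<lambda>k y. exp (- \<theta> * (y + g k)) * defect \<theta> k) x n * s ^ Suc n)"
    by (simp add: rr_def[abs_def])
  have eigenfn_bd: "\<bar>eigenfn \<theta> k y\<bar> \<le> 3 / 2" if "0 \<le> y" for k y
  proof -
    have "eigenfn \<theta> k y \<le> 3 / 2 * exp (- \<theta> * y)" using th by (intro eigenfn_le) auto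
    also have "\<dots> \<le> 3 / 2 * 1" using that th by (intro mult_left_mono) auto
    finally show ?thesis using eigenfn_nonneg[OF th(3), of k y] by simp
  qed
  have step_bd: "step_op (eigenfn \<theta>) k y \<le> (1 + \<theta>\<^sup>2 * v / 2) * (3 / 2) + Cd" if "0 \<le> y" for k y
  proof -
    have "(1 + \<theta>\<^sup>2 * v / 2) * eigenfn \<theta> k y \<le> (1 + \<theta>\<^sup>2 * v / 2) * (3 / 2)"
      using eigenfn_bd[OF that, of k] v_pos by (intro mult_left_mono) auto
    moreover have "step_op (eigenfn \<theta>) k y = (1 + \<theta>\<^sup>2 * v / 2) * eigenfn \<theta> k y + rr k y"
      unfolding rr_def using th tha by (intro step_op_eigenfn) auto
    ultimately show ?thesis using rr_le[OF that, of k] by linarith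
  qed
  define e where "e n = on_alive (eigenfn \<theta>) x n" for n
  define d where "d n = prob (dying x n)" for n
  have ib: "integrable M (\<lambda>\<omega>. eigenfn \<theta> (X n \<omega>) (x + walk Y n \<omega>) * indicator (alive x n) \<omega>)" for n
    by (rule integrable_alive[OF eigenfn_meas eigenfn_bd])
  have ir: "integrable M (\<lambda>\<omega>. rr (X n \<omega>) (x + walk Y n \<omega>) * indicator (alive x n) \<omega>)" for n
    by (rule integrable_alive[OF rr_meas rr_le])
  have step: "e (Suc n) + on_dying (eigenfn \<theta>) x n = (1 + \<theta>\<^sup>2 * v / 2) * e n + on_alive rr x n" for n
  proof -
    have "e (Suc n) + on_dying (eigenfn \<theta>) x n = on_alive (step_op (eigenfn \<theta>)) x n"
      unfolding e_def using th tha
      by (intro balance(1)[OF eigenfn_meas eigenfn_nonneg[OF th(3)] eigenfn_int step_bd]) auto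
    also have "\<dots> = on_alive (\<lambda>k y. (1 + \<theta>\<^sup>2 * v / 2) * eigenfn \<theta> k y + rr k y) x n"
      using th tha by (simp add: step_op_eigenfn rr_def cong: on_alive_def)
    also have "\<dots> = (1 + \<theta>\<^sup>2 * v / 2) * e n + on_alive rr x n"
      unfolding e_def on_alive_def distrib_right mult.assoc
      using ib[of n] ir[of n] by (subst Bochner_Integration.integral_add) auto
    finally show ?thesis .
  qed
  have dy: "on_dying (eigenfn \<theta>) x n = d n - \<theta> * on_dying overshoot x n + on_dying er x n" for n
  proof -
    have i1: "integrable M (\<lambda>\<omega>. overshoot (X (Suc n) \<omega>) (x + walk Y (Suc n) \<omega>) * indicator (dying x n) \<omega>)"
      by (rule on_dying_dominated(1)[OF overshoot_meas overshoot_le])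
    have i2: "integrable M (\<lambda>\<omega>. er (X (Suc n) \<omega>) (x + walk Y (Suc n) \<omega>) * indicator (dying x n) \<omega>)"
      by (rule on_dying_dominated(1)[OF er_meas er_le])
    have "on_dying (eigenfn \<theta>) x n = (\<integral>\<omega>. indicator (dying x n) \<omega>
        - \<theta> * (overshoot (X (Suc n) \<omega>) (x + walk Y (Suc n) \<omega>) * indicator (dying x n) \<omega>)
        + er (X (Suc n) \<omega>) (x + walk Y (Suc n) \<omega>) * indicator (dying x n) \<omega> \<partial>M)"
      unfolding on_dying_def by (intro Bochner_Integration.integral_cong refl) (simp add: er_def algebra_simps)
    also have "\<dots> = d n - \<theta> * on_dying overshoot x n + on_dying er x n"
      unfolding on_dying_def d_def using i1 i2 by simp
    finally show ?thesis .
  qed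
  have e_bd: "\<bar>e n\<bar> \<le> 3 / 2" for n
  proof -
    have "\<bar>e n\<bar> \<le> 3 / 2 * prob (alive x n)" unfolding e_def by (rule on_alive_bound[OF eigenfn_meas eigenfn_bd])
    also have "\<dots> \<le> 3 / 2 * 1" by (intro mult_left_mono) auto
    finally show ?thesis by simp
  qed
  have null: "(\<lambda>n. c n * s ^ n) \<longlonglongrightarrow> 0" if "\<And>n. \<bar>c n\<bar> \<le> D" for c :: "nat \<Rightarrow> real" and D
    using summable_LIMSEQ_zero[OF summable_bounded_power[of c D s]] that s by simp
  \<comment> \<open>The discounted eigenfunction telescopes; it starts from \<open>eigenfn \<theta> i x\<close> and ends at 0, as it is bounded and \<open>s < 1\<close>.\<close>
  have sums1: "(\<lambda>n. e n * s ^ n - e (Suc n) * s ^ Suc n) sums (eigenfn \<theta> i x - 0)"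
    using telescope_sums'[OF null[of e "3 / 2"]] e_bd on_alive_0[OF x, of "eigenfn \<theta>"] by (simp add: e_def)
  have term1: "e n * s ^ n - e (Suc n) * s ^ Suc n =
      (d n * s ^ Suc n - \<theta> * (on_dying overshoot x n * s ^ Suc n) + on_dying er x n * s ^ Suc n) - on_alive rr x n * s ^ Suc n" for n
  proof -
    have "e n = s * ((1 + \<theta>\<^sup>2 * v / 2) * e n)" using s(3) by (simp flip: mult.assoc)
    also have "(1 + \<theta>\<^sup>2 * v / 2) * e n = e (Suc n) + d n - \<theta> * on_dying overshoot x n + on_dying er x n - on_alive rr x n"
      using step[of n] dy[of n] by linarith
    finally have "e n * s ^ n = s * (e (Suc n) + d n - \<theta> * on_dying overshoot x n + on_dying er x n - on_alive rr x n) * s ^ n"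
      by (rule arg_cong[where f="\<lambda>z. z * s ^ n"])
    then show ?thesis by (simp add: algebra_simps)
  qed
  have d_sums: "(\<lambda>n. d n * s ^ Suc n) sums (1 - (1 - s) * survival_gf x s)"
  proof -
    have t: "(\<lambda>n. prob (alive x n) * s ^ n - prob (alive x (Suc n)) * s ^ Suc n) sums (prob (alive x 0) * s ^ 0 - 0)"
      by (rule telescope_sums'[OF null[of "\<lambda>n. prob (alive x n)" 1]]) simp
    have g: "(\<lambda>n. (1 - s) * (prob (alive x n) * s ^ n)) sums ((1 - s) * survival_gf x s)"
      unfolding survival_gf_def using s by (intro sums_mult summable_sums summable_survival) auto
    have "prob (alive x 0) = 1" using alive_0[OF x] by (simp add: prob_space)
    then show ?thesis using sums_diff[OF t g] by (simp add: d_def prob_dying algebra_simps)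
  qed
  have "(\<lambda>n. (d n * s ^ Suc n - \<theta> * (on_dying overshoot x n * s ^ Suc n) + on_dying er x n * s ^ Suc n) - on_alive rr x n * s ^ Suc n)
      sums ((1 - (1 - s) * survival_gf x s) - \<theta> * (\<Sum>n. on_dying overshoot x n * s ^ Suc n)
        + (\<Sum>n. on_dying er x n * s ^ Suc n) - (\<Sum>n. on_alive rr x n * s ^ Suc n))"
    by (intro sums_diff sums_add d_sums sums_mult summable_sums so se sr)
  then have "eigenfn \<theta> i x = (1 - (1 - s) * survival_gf x s) - \<theta> * (\<Sum>n. on_dying overshoot x n * s ^ Suc n)
        + (\<Sum>n. on_dying er x n * s ^ Suc n) - (\<Sum>n. on_alive rr x n * s ^ Suc n)"
    using sums1 unfolding term1 by (simp add: sums_unique2)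
  then show "(1 - s) * survival_gf x s = \<theta> * overshoot i x - \<theta> * (\<Sum>n. on_dying overshoot x n * s ^ Suc n)
    + (\<Sum>n. on_dying (\<lambda>k y. eigenfn \<theta> k y - 1 + \<theta> * overshoot k y) x n * s ^ Suc n)
    - (\<Sum>n. on_alive (\<lambda>k y. exp (- \<theta> * (y + g k)) * defect \<theta> k) x n * s ^ Suc n)
    - (eigenfn \<theta> i x - 1 + \<theta> * overshoot i x)"
    unfolding er_def[abs_def, symmetric] rr_def[abs_def, symmetric] by linarith
qed

lemma survival_gf_nonneg:
  assumes "0 \<le> s" "s < 1"
  shows "0 \<le> survival_gf x s"
  unfolding survival_gf_def using assms by (intro suminf_nonneg summable_survival) auto

text \<open>The errors in \<open>survival_gf_identity\<close> are the remainder at death, of order \<open>\<theta>\<^sup>2\<close> by the overshoot bound,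
the remainder at the start, of order \<open>\<theta>\<^sup>2 (1 + x)\<^sup>2\<close>, and the sum of the defects, at most \<open>\<theta>\<^sup>3\<close> times the
generating function. The last one is expressed through the unknown itself: since \<open>1 - s\<close> is of order
\<open>\<theta>\<^sup>2\<close>, it is of order \<open>\<theta>\<^sup>2\<close> times \<open>scaled_gf x \<theta>\<close>. After division by \<open>\<theta>\<close> it can be absorbed on the left.\<close>

lemma scaled_gf_estimate:
  obtains C \<theta>0 where "0 \<le> C" "0 < \<theta>0"
    "\<And>x \<theta>. 0 \<le> x \<Longrightarrow> 0 < \<theta> \<Longrightarrow> \<theta> \<le> \<theta>0 \<Longrightarrow>
      \<bar>scaled_gf x \<theta> - (overshoot i x - (\<Sum>n. on_dying overshoot x n * discount \<theta> ^ Suc n))\<bar>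
        \<le> C * \<theta> * (1 + (x + G)\<^sup>2 + scaled_gf x \<theta>)"
proof -
  obtain Cd where Cd: "0 \<le> Cd" "\<And>\<theta> k. 0 \<le> \<theta> \<Longrightarrow> \<theta> \<le> 1 \<Longrightarrow> \<theta> \<le> \<alpha> / 2 \<Longrightarrow> \<bar>defect \<theta> k\<bar> \<le> Cd * \<theta> ^ 3"
    using defect_bound by blast
  obtain C5 where C5: "0 \<le> C5" "\<And>x N. 0 \<le> x \<Longrightarrow> (\<Sum>n<N. on_dying decay x n) \<le> C5"
    using dying_exp_sum_bound by blast
  define C4 where "C4 = exp (\<alpha> * G) * ((6 / \<alpha>)\<^sup>2 + Q / 2)"
  have C4: "0 \<le> C4" using Q_nonneg by (simp add: C4_def)
  define \<theta>0 where "\<theta>0 = min (min 1 (\<alpha> / 2)) (1 / (Q + 1))"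
  have t0: "0 < \<theta>0" using alpha Q_nonneg by (auto simp: \<theta>0_def)
  define C where "C = C4 * C5 + Q / 2 + 1 + Cd * (2 / v + 1)"
  have C: "0 \<le> C" using C4 C5 Cd(1) Q_nonneg v_pos by (simp add: C_def)
  have "\<bar>scaled_gf x \<theta> - (overshoot i x - (\<Sum>n. on_dying overshoot x n * discount \<theta> ^ Suc n))\<bar>
        \<le> C * \<theta> * (1 + (x + G)\<^sup>2 + scaled_gf x \<theta>)"
    if x: "0 \<le> x" and th: "0 < \<theta>" "\<theta> \<le> \<theta>0" for x \<theta>
  proof -
    have th': "\<theta> \<le> 1" "\<theta> \<le> \<alpha> / 2" "\<theta> \<le> 1 / (Q + 1)" using th by (auto simp: \<theta>0_def)
    have tQ: "\<theta>\<^sup>2 * Q \<le> 1"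
    proof -
      have "\<theta> * \<theta> \<le> 1 * (1 / (Q + 1))" using th' th by (intro mult_mono) auto
      then have "\<theta>\<^sup>2 * Q \<le> 1 / (Q + 1) * Q" using Q_nonneg by (intro mult_right_mono) (auto simp: power2_eq_square)
      also have "\<dots> \<le> 1" using Q_nonneg by (simp add: field_simps)
      finally show ?thesis .
    qed
    define s where "s = discount \<theta>"
    note s = discount_bounds[OF th(1), folded s_def]
    define H where "H = survival_gf x s"
    have H: "0 \<le> H" unfolding H_def using s by (intro survival_gf_nonneg) auto
    define h where "h = scaled_gf x \<theta>"
    have h: "h = (1 - s) * H / \<theta>" by (simp add: h_def scaled_gf_def s_def H_def)
    have h0: "0 \<le> h" unfolding h using H s th by simp
    define A where "A = (\<Sum>n. on_dying (\<lambda>k y. eigenfn \<theta> k y - 1 + \<theta> * overshoot k y) x n * s ^ Suc n)"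
    define B where "B = (\<Sum>n. on_alive (\<lambda>k y. exp (- \<theta> * (y + g k)) * defect \<theta> k) x n * s ^ Suc n)"
    define D where "D = eigenfn \<theta> i x - 1 + \<theta> * overshoot i x"
    define S where "S = (\<Sum>n. on_dying overshoot x n * s ^ Suc n)"
    note id = survival_gf_identity[OF x th(1) th'(2) tQ, folded s_def, folded A_def B_def D_def S_def H_def]
    note sd = summable_dying[OF x C5(2)[OF x]]
    have A: "\<bar>A\<bar> \<le> \<theta>\<^sup>2 * (C4 * C5)"
    proof -
      have "norm A \<le> (\<Sum>n. (\<theta>\<^sup>2 * C4) * on_dying decay x n)"
        unfolding A_def
      proof (rule norm_suminf_le[OF _ summable_mult[OF sd(1)]])
        fix n
        have "\<bar>on_dying (\<lambda>k y. eigenfn \<theta> k y - 1 + \<theta> * overshoot k y) x n\<bar> \<le> (\<theta>\<^sup>2 * C4) * on_dying decay x n"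
          unfolding C4_def using th th' by (intro on_dying_dominated(2) eigenfn_overshoot) auto
        then have "\<bar>on_dying (\<lambda>k y. eigenfn \<theta> k y - 1 + \<theta> * overshoot k y) x n\<bar> * s ^ Suc n \<le> (\<theta>\<^sup>2 * C4) * on_dying decay x n * 1"
          using s sd(3)[of n] C4 by (intro mult_mono power_le_one) auto
        then show "norm (on_dying (\<lambda>k y. eigenfn \<theta> k y - 1 + \<theta> * overshoot k y) x n * s ^ Suc n) \<le> (\<theta>\<^sup>2 * C4) * on_dying decay x n"
          using s by (simp add: abs_mult)
      qed
      also have "\<dots> = (\<theta>\<^sup>2 * C4) * suminf (on_dying decay x)" by (rule suminf_mult[OF sd(1)])
      also have "\<dots> \<le> (\<theta>\<^sup>2 * C4) * C5" using sd(2) C4 by (intro mult_left_mono) auto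
      finally show ?thesis by simp
    qed
    have B: "\<bar>B\<bar> \<le> Cd * \<theta> ^ 3 * H"
    proof -
      have sm: "summable (\<lambda>n. prob (alive x n) * s ^ n)" using s by (intro summable_survival) auto
      have "norm B \<le> (\<Sum>n. (Cd * \<theta> ^ 3) * (prob (alive x n) * s ^ n))"
        unfolding B_def
      proof (rule norm_suminf_le[OF _ summable_mult[OF sm]])
        fix n
        have "\<bar>on_alive (\<lambda>k y. exp (- \<theta> * (y + g k)) * defect \<theta> k) x n\<bar> \<le> (Cd * \<theta> ^ 3) * prob (alive x n)"
        proof (rule on_alive_bound)
          fix k and y :: real assume y: "0 \<le> y"
          have "exp (- \<theta> * (y + g k)) * \<bar>defect \<theta> k\<bar> \<le> 1 * (Cd * \<theta> ^ 3)"
            using y g[of k] th th' by (intro mult_mono Cd(2)) auto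
          then show "\<bar>exp (- \<theta> * (y + g k)) * defect \<theta> k\<bar> \<le> Cd * \<theta> ^ 3" by (simp add: abs_mult)
        qed measurable
        moreover have "s ^ Suc n \<le> s ^ n" using s by (intro power_decreasing) auto
        ultimately have "\<bar>on_alive (\<lambda>k y. exp (- \<theta> * (y + g k)) * defect \<theta> k) x n\<bar> * s ^ Suc n \<le> (Cd * \<theta> ^ 3) * prob (alive x n) * s ^ n"
          using s Cd(1) th by (intro mult_mono) auto
        then show "norm (on_alive (\<lambda>k y. exp (- \<theta> * (y + g k)) * defect \<theta> k) x n * s ^ Suc n) \<le> (Cd * \<theta> ^ 3) * (prob (alive x n) * s ^ n)"
          using s by (simp add: abs_mult)
      qed
      also have "\<dots> = (Cd * \<theta> ^ 3) * H" unfolding H_def survival_gf_def by (rule suminf_mult[OF sm])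
      finally show ?thesis by simp
    qed
    have D: "\<bar>D\<bar> \<le> \<theta>\<^sup>2 * ((x + G)\<^sup>2 + Q / 2)" unfolding D_def using th x by (intro eigenfn_start) auto
    \<comment> \<open>From \<open>1 - s = s \<theta>\<^sup>2 v / 2\<close>: the generating function is at most a constant times \<open>h / \<theta>\<close>.\<close>
    have H3: "\<theta> ^ 3 * H \<le> \<theta>\<^sup>2 * ((2 / v + 1) * h)"
    proof -
      have "1 - s = s * (\<theta>\<^sup>2 * v / 2)" using s(3) by (simp add: algebra_simps)
      then have "\<theta> * h = s * (\<theta>\<^sup>2 * v / 2) * H" using h th by simp
      then have "(1 + \<theta>\<^sup>2 * v / 2) * (\<theta> * h) = (s * (1 + \<theta>\<^sup>2 * v / 2)) * ((\<theta>\<^sup>2 * v / 2) * H)" by simp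
      then have "(1 + \<theta>\<^sup>2 * v / 2) * (\<theta> * h) = (\<theta>\<^sup>2 * v / 2) * H" using s(3) by simp
      then have "(2 / v) * ((1 + \<theta>\<^sup>2 * v / 2) * (\<theta> * h)) = (2 / v) * ((\<theta>\<^sup>2 * v / 2) * H)" by (simp only:)
      then have "\<theta>\<^sup>2 * H = (2 / v) * ((1 + \<theta>\<^sup>2 * v / 2) * (\<theta> * h))" using v_pos by simp
      also have "\<dots> = \<theta> * ((2 / v + \<theta>\<^sup>2) * h)" using v_pos by (simp add: field_simps)
      also have "\<dots> \<le> \<theta> * ((2 / v + 1) * h)"
        using th th' h0 by (intro mult_left_mono mult_right_mono add_left_mono power_le_one) auto
      finally have "\<theta> * (\<theta>\<^sup>2 * H) \<le> \<theta> * (\<theta> * ((2 / v + 1) * h))" using th by (intro mult_left_mono) auto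
      then show ?thesis by (simp add: eval_nat_numeral mult_ac)
    qed
    have "\<theta> * h = (1 - s) * H" using h th by simp
    then have "\<theta> * (h - (overshoot i x - S)) = A - B - D"
      unfolding right_diff_distrib using id(1) by linarith
    then have "\<theta> * \<bar>h - (overshoot i x - S)\<bar> = \<bar>A - B - D\<bar>" using th by (metis abs_mult abs_of_pos)
    also have "\<dots> \<le> \<theta>\<^sup>2 * (C4 * C5) + Cd * (\<theta>\<^sup>2 * ((2 / v + 1) * h)) + \<theta>\<^sup>2 * ((x + G)\<^sup>2 + Q / 2)"
      using A B D mult_left_mono[OF H3 Cd(1)] by (simp add: mult.assoc abs_if split: if_splits)
    also have "\<dots> = \<theta> * (\<theta> * (C4 * C5 + Q / 2 + (x + G)\<^sup>2 + Cd * (2 / v + 1) * h))"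
      by (simp add: power2_eq_square algebra_simps)
    finally have "\<bar>h - (overshoot i x - S)\<bar> \<le> \<theta> * (C4 * C5 + Q / 2 + (x + G)\<^sup>2 + Cd * (2 / v + 1) * h)"
      using th by simp
    also have "\<dots> \<le> \<theta> * (C * (1 + (x + G)\<^sup>2 + h))"
    proof (intro mult_left_mono)
      have "C4 * C5 + Q / 2 \<le> C * 1" "(x + G)\<^sup>2 \<le> C * (x + G)\<^sup>2" "Cd * (2 / v + 1) * h \<le> C * h"
      proof -
        have n: "0 \<le> C4 * C5" "0 \<le> Cd * (2 / v + 1)" using C4 C5 Cd(1) v_pos by auto
        show "C4 * C5 + Q / 2 \<le> C * 1" using n by (simp add: C_def)
        have "1 \<le> C" using n Q_nonneg by (simp add: C_def)
        then have "1 * (x + G)\<^sup>2 \<le> C * (x + G)\<^sup>2" by (intro mult_right_mono) auto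
        then show "(x + G)\<^sup>2 \<le> C * (x + G)\<^sup>2" by simp
        show "Cd * (2 / v + 1) * h \<le> C * h" using n Q_nonneg h0 by (intro mult_right_mono) (auto simp: C_def)
      qed
      then show "C4 * C5 + Q / 2 + (x + G)\<^sup>2 + Cd * (2 / v + 1) * h \<le> C * (1 + (x + G)\<^sup>2 + h)"
        unfolding distrib_left by linarith
    qed (use th in auto)
    finally show ?thesis by (simp add: h_def S_def s_def mult_ac)
  qed
  then show thesis using that[OF C t0] by blast
qed

end

section \<open>Decay of the survival probabilities and the harmonic function\<close>

context corrected_walk
begin

lemma overshoot_sum_bound:
  obtains C where "0 \<le> C" "\<And>x. 0 \<le> x \<Longrightarrow> summable (\<lambda>n. \<bar>on_dying overshoot x n\<bar>)"
    "\<And>x. 0 \<le> x \<Longrightarrow> (\<Sum>n. \<bar>on_dying overshoot x n\<bar>) \<le> C"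
proof -
  obtain C5 where C5: "0 \<le> C5" "\<And>x N. 0 \<le> x \<Longrightarrow> (\<Sum>n<N. on_dying decay x n) \<le> C5"
    using dying_exp_sum_bound by blast
  define c where "c = 1 / \<alpha> * exp (\<alpha> * G)"
  have c: "0 \<le> c" using alpha by (simp add: c_def)
  have le: "\<bar>on_dying overshoot x n\<bar> \<le> c * on_dying decay x n" for x n
    unfolding c_def by (rule on_dying_dominated(2)[OF overshoot_meas overshoot_le])
  have s: "summable (\<lambda>n. \<bar>on_dying overshoot x n\<bar>)" if x: "0 \<le> x" for x
    by (rule summable_comparison_test'[OF summable_mult[OF summable_dying(1)[OF x C5(2)[OF x]], of c]]) (use le in auto)
  have "(\<Sum>n. \<bar>on_dying overshoot x n\<bar>) \<le> c * C5" if x: "0 \<le> x" for x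
  proof -
    note sd = summable_dying[OF x C5(2)[OF x]]
    have "(\<Sum>n. \<bar>on_dying overshoot x n\<bar>) \<le> (\<Sum>n. c * on_dying decay x n)"
      by (rule suminf_le[OF le s[OF x] summable_mult[OF sd(1)]])
    also have "\<dots> = c * suminf (on_dying decay x)" by (rule suminf_mult[OF sd(1)])
    also have "\<dots> \<le> c * C5" using c sd(2) by (rule mult_left_mono[rotated])
    finally show ?thesis .
  qed
  then show thesis using that[of "c * C5"] s c C5(1) by simp
qed

lemma harmonic_near_identity:
  obtains C where "0 \<le> C" "\<And>x. 0 \<le> x \<Longrightarrow> \<bar>harmonic x - x\<bar> \<le> C"
proof -
  obtain C where C: "0 \<le> C" "\<And>x. 0 \<le> x \<Longrightarrow> summable (\<lambda>n. \<bar>on_dying overshoot x n\<bar>)"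
    "\<And>x. 0 \<le> x \<Longrightarrow> (\<Sum>n. \<bar>on_dying overshoot x n\<bar>) \<le> C"
    using overshoot_sum_bound by blast
  have "\<bar>harmonic x - x\<bar> \<le> G + C" if x: "0 \<le> x" for x
  proof -
    have "\<bar>\<Sum>n. on_dying overshoot x n\<bar> \<le> C"
      using summable_rabs[OF C(2)[OF x]] C(3)[OF x] by linarith
    then show ?thesis using g[of i] unfolding harmonic_def by linarith
  qed
  then show thesis using that[of "G + C"] G_nonneg C(1) by simp
qed

text \<open>For small \<open>\<theta>\<close> the error term of \<open>scaled_gf_estimate\<close> contains at most half of the quantity that is to
be bounded.\<close>

lemma scaled_gf_bound:
  obtains C \<theta>0 where "0 \<le> C" "0 < \<theta>0"
    "\<And>x \<theta>. 0 \<le> x \<Longrightarrow> 0 < \<theta> \<Longrightarrow> \<theta> \<le> \<theta>0 \<Longrightarrow> 0 \<le> scaled_gf x \<theta> \<and> scaled_gf x \<theta> \<le> C * (1 + x)\<^sup>2"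
proof -
  obtain C0 \<theta>0 where C0: "0 \<le> C0" "0 < \<theta>0"
    "\<And>x \<theta>. 0 \<le> x \<Longrightarrow> 0 < \<theta> \<Longrightarrow> \<theta> \<le> \<theta>0 \<Longrightarrow>
      \<bar>scaled_gf x \<theta> - (overshoot i x - (\<Sum>n. on_dying overshoot x n * discount \<theta> ^ Suc n))\<bar>
        \<le> C0 * \<theta> * (1 + (x + G)\<^sup>2 + scaled_gf x \<theta>)"
    using scaled_gf_estimate by blast
  obtain C1 where C1: "0 \<le> C1" "\<And>x. 0 \<le> x \<Longrightarrow> summable (\<lambda>n. \<bar>on_dying overshoot x n\<bar>)"
    "\<And>x. 0 \<le> x \<Longrightarrow> (\<Sum>n. \<bar>on_dying overshoot x n\<bar>) \<le> C1"
    using overshoot_sum_bound by blast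
  define \<theta>1 where "\<theta>1 = min \<theta>0 (1 / (2 * (C0 + 1)))"
  have t1: "0 < \<theta>1" using C0 by (simp add: \<theta>1_def)
  define C where "C = 2 * ((1 + G) + C1 + 1 + (1 + G)\<^sup>2)"
  have "0 \<le> scaled_gf x \<theta> \<and> scaled_gf x \<theta> \<le> C * (1 + x)\<^sup>2"
    if x: "0 \<le> x" and th: "0 < \<theta>" "\<theta> \<le> \<theta>1" for x \<theta>
  proof -
    note s = discount_bounds[OF th(1)]
    have h0: "0 \<le> scaled_gf x \<theta>"
      unfolding scaled_gf_def using s th survival_gf_nonneg[of "discount \<theta>" x] by simp
    have "C0 * \<theta> \<le> (C0 + 1) * (1 / (2 * (C0 + 1)))"
      using th C0 by (intro mult_mono) (auto simp: \<theta>1_def)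
    also have "\<dots> = 1 / 2" using C0(1) by (simp add: field_simps)
    finally have Ct: "C0 * \<theta> \<le> 1 / 2" .
    have S: "\<bar>\<Sum>n. on_dying overshoot x n * discount \<theta> ^ Suc n\<bar> \<le> C1"
    proof -
      have "norm (\<Sum>n. on_dying overshoot x n * discount \<theta> ^ Suc n) \<le> (\<Sum>n. \<bar>on_dying overshoot x n\<bar>)"
      proof (rule norm_suminf_le[OF _ C1(2)[OF x]])
        fix n
        have "\<bar>on_dying overshoot x n\<bar> * discount \<theta> ^ Suc n \<le> \<bar>on_dying overshoot x n\<bar> * 1"
          using s by (intro mult_left_mono power_le_one) auto
        then show "norm (on_dying overshoot x n * discount \<theta> ^ Suc n) \<le> \<bar>on_dying overshoot x n\<bar>"
          using s by (simp add: abs_mult)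
      qed
      then show ?thesis using C1(3)[OF x] by simp
    qed
    have "\<theta> \<le> \<theta>0" using th by (simp add: \<theta>1_def)
    note est = C0(3)[OF x th(1) this]
    have "C0 * \<theta> * (1 + (x + G)\<^sup>2 + scaled_gf x \<theta>) \<le> 1 / 2 * (1 + (x + G)\<^sup>2 + scaled_gf x \<theta>)"
      using Ct h0 by (intro mult_right_mono) auto
    then have "scaled_gf x \<theta> \<le> 2 * (overshoot i x + C1 + (1 + (x + G)\<^sup>2))"
    proof -
      define R where "R = C0 * \<theta> * (1 + (x + G)\<^sup>2 + scaled_gf x \<theta>)"
      define z where "z = (x + G)\<^sup>2"
      have "R \<le> 1 / 2 * (1 + z + scaled_gf x \<theta>)" "0 \<le> z"
        using \<open>C0 * \<theta> * _ \<le> _\<close> by (simp_all add: R_def z_def)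
      moreover have "scaled_gf x \<theta> \<le> overshoot i x + C1 + R"
        using est S unfolding R_def[symmetric] by linarith
      ultimately show ?thesis unfolding z_def[symmetric] by (simp add: field_simps)
    qed
    also have "\<dots> \<le> C * (1 + x)\<^sup>2"
    proof -
      have x1: "1 \<le> (1 + x)\<^sup>2" using x by (simp add: power2_eq_square algebra_simps)
      have x2: "1 + x \<le> (1 + x)\<^sup>2" using x by (simp add: power2_eq_square algebra_simps)
      have xG: "x + G \<le> (1 + G) * (1 + x)" using x G_nonneg by (simp add: algebra_simps)
      have "overshoot i x \<le> (1 + G) * (1 + x)\<^sup>2"
      proof -
        have "overshoot i x \<le> (1 + G) * (1 + x)" using xG g(2)[of i] by (simp add: overshoot_def)
        also have "\<dots> \<le> (1 + G) * (1 + x)\<^sup>2" using x2 G_nonneg by (intro mult_left_mono) auto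
        finally show ?thesis .
      qed
      moreover have "C1 * 1 \<le> C1 * (1 + x)\<^sup>2" using x1 C1 by (intro mult_left_mono) auto
      moreover have "(x + G)\<^sup>2 \<le> (1 + G)\<^sup>2 * (1 + x)\<^sup>2"
        using power_mono[OF xG, of 2] x G_nonneg by (simp add: power_mult_distrib)
      ultimately show ?thesis using x1 unfolding C_def by (simp add: algebra_simps) 
    qed
    finally show ?thesis using h0 by simp
  qed
  moreover have "0 \<le> C" using C1 G_nonneg by (simp add: C_def)
  ultimately show thesis using that[of C \<theta>1] t1 by blast
qed

lemma discount_tendsto: "(discount \<longlongrightarrow> 1) (at_right 0)"
proof -
  have "((\<lambda>\<theta>. 1 / (1 + \<theta>\<^sup>2 * v / 2)) \<longlongrightarrow> 1 / (1 + 0\<^sup>2 * v / 2)) (at_right 0)"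
    by (intro tendsto_intros) auto
  then show ?thesis by (simp add: discount_def[abs_def])
qed

lemma scaled_gf_tendsto:
  assumes x: "0 \<le> x"
  shows "(scaled_gf x \<longlongrightarrow> harmonic x) (at_right 0)"
proof -
  obtain C0 \<theta>0 where C0: "0 \<le> C0" "0 < \<theta>0"
    "\<And>x \<theta>. 0 \<le> x \<Longrightarrow> 0 < \<theta> \<Longrightarrow> \<theta> \<le> \<theta>0 \<Longrightarrow>
      \<bar>scaled_gf x \<theta> - (overshoot i x - (\<Sum>n. on_dying overshoot x n * discount \<theta> ^ Suc n))\<bar>
        \<le> C0 * \<theta> * (1 + (x + G)\<^sup>2 + scaled_gf x \<theta>)"
    using scaled_gf_estimate by blast
  obtain C1 where "0 \<le> C1" and C1: "\<And>x. 0 \<le> x \<Longrightarrow> summable (\<lambda>n. \<bar>on_dying overshoot x n\<bar>)"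
    and "\<And>x. 0 \<le> x \<Longrightarrow> (\<Sum>n. \<bar>on_dying overshoot x n\<bar>) \<le> C1"
    using overshoot_sum_bound by blast
  obtain C2 \<theta>2 where "0 \<le> C2" and C2: "0 < \<theta>2"
    "\<And>x \<theta>. 0 \<le> x \<Longrightarrow> 0 < \<theta> \<Longrightarrow> \<theta> \<le> \<theta>2 \<Longrightarrow> 0 \<le> scaled_gf x \<theta> \<and> scaled_gf x \<theta> \<le> C2 * (1 + x)\<^sup>2"
    using scaled_gf_bound by blast
  define B where "B = 1 + (x + G)\<^sup>2 + C2 * (1 + x)\<^sup>2"
  define main where "main \<theta> = overshoot i x - (\<Sum>n. on_dying overshoot x n * discount \<theta> ^ Suc n)" for \<theta>
  have small: "\<forall>\<^sub>F \<theta> in at_right 0. 0 < \<theta> \<and> \<theta> < min \<theta>0 \<theta>2"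
    using eventually_at_right_real[of 0 "min \<theta>0 \<theta>2"] C0(2) C2(1) by (simp add: greaterThanLessThan_iff)
  have "((\<lambda>\<theta>. scaled_gf x \<theta> - main \<theta>) \<longlongrightarrow> 0) (at_right 0)"
  proof (rule Lim_null_comparison)
    have "((\<lambda>\<theta>. C0 * \<theta> * B) \<longlongrightarrow> C0 * 0 * B) (at_right 0)" by (intro tendsto_intros)
    then show "((\<lambda>\<theta>. C0 * \<theta> * B) \<longlongrightarrow> 0) (at_right 0)" by simp
    show "\<forall>\<^sub>F \<theta> in at_right 0. norm (scaled_gf x \<theta> - main \<theta>) \<le> C0 * \<theta> * B"
      using small
    proof eventually_elim
      case (elim \<theta>)
      have "norm (scaled_gf x \<theta> - main \<theta>) \<le> C0 * \<theta> * (1 + (x + G)\<^sup>2 + scaled_gf x \<theta>)"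
        using C0(3)[OF x, of \<theta>] elim by (simp add: main_def)
      also have "\<dots> \<le> C0 * \<theta> * B"
        unfolding B_def using C0(1) elim C2(2)[OF x, of \<theta>] by (intro mult_left_mono add_left_mono) auto
      finally show ?case .
    qed
  qed
  moreover have "(main \<longlongrightarrow> harmonic x) (at_right 0)"
  proof -
    have "((\<lambda>\<theta>. \<Sum>n. on_dying overshoot x n * discount \<theta> ^ Suc n) \<longlongrightarrow> (\<Sum>n. on_dying overshoot x n)) (at_right 0)"
    proof (rule tannerys_theorem[THEN conjunct2, THEN conjunct2])
      fix n
      have "((\<lambda>\<theta>. on_dying overshoot x n * discount \<theta> ^ Suc n) \<longlongrightarrow> on_dying overshoot x n * 1 ^ Suc n) (at_right 0)"
        by (intro tendsto_mult tendsto_const tendsto_power discount_tendsto)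
      then show "((\<lambda>\<theta>. on_dying overshoot x n * discount \<theta> ^ Suc n) \<longlongrightarrow> on_dying overshoot x n) (at_right 0)" by simp
    next
      show "summable (\<lambda>n. \<bar>on_dying overshoot x n\<bar>)" by (rule C1[OF x])
      have "\<forall>\<^sub>F p in at_top \<times>\<^sub>F at_right 0. True \<and> 0 < snd p \<and> snd p < min \<theta>0 \<theta>2"
        using eventually_prodI[OF eventually_True[of at_top] small] by (simp add: split_def)
      then show "\<forall>\<^sub>F (n, \<theta>) in at_top \<times>\<^sub>F at_right 0. norm (on_dying overshoot x n * discount \<theta> ^ Suc n) \<le> \<bar>on_dying overshoot x n\<bar>"
      proof (rule eventually_mono)
        fix p :: "nat \<times> real" assume p: "True \<and> 0 < snd p \<and> snd p < min \<theta>0 \<theta>2"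
        obtain n \<theta> where pn: "p = (n, \<theta>)" by (cases p) auto
        have s: "0 < discount \<theta>" "discount \<theta> < 1" using discount_bounds[of \<theta>] p pn by auto
        have "\<bar>on_dying overshoot x n\<bar> * discount \<theta> ^ Suc n \<le> \<bar>on_dying overshoot x n\<bar> * 1"
          using s by (intro mult_left_mono power_le_one) auto
        then show "case p of (n, \<theta>) \<Rightarrow> norm (on_dying overshoot x n * discount \<theta> ^ Suc n) \<le> \<bar>on_dying overshoot x n\<bar>"
          using s by (simp add: pn abs_mult)
      qed
    qed simp
    then have "(main \<longlongrightarrow> overshoot i x - (\<Sum>n. on_dying overshoot x n)) (at_right 0)"
      unfolding main_def by (intro tendsto_intros)
    then show ?thesis by (simp add: harmonic_def overshoot_def)
  qed
  ultimately have "((\<lambda>\<theta>. (scaled_gf x \<theta> - main \<theta>) + main \<theta>) \<longlongrightarrow> 0 + harmonic x) (at_right 0)"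
    by (rule tendsto_add)
  then show ?thesis by simp
qed

lemma decseq_survival: "decseq (\<lambda>n. prob (alive x n))"
  by (intro decseq_SucI finite_measure_mono alive_Suc_subset) auto

text \<open>The parameter \<open>\<theta>\<close> is expressed through \<open>s\<close>, so that \<open>scaled_gf_tendsto\<close> becomes the hypothesis of the
Tauberian theorem.\<close>

lemma survival_asymp:
  assumes x: "0 \<le> x"
  shows "(\<lambda>n. sqrt (real n) * prob (alive x n)) \<longlonglongrightarrow> sqrt (2 / v) * harmonic x / sqrt pi"
proof -
  \<comment> \<open>The inverse function of \<open>discount\<close>.\<close>
  define T where "T s = sqrt (2 / v * (1 / s - 1))" for s :: real
  have ev: "\<forall>\<^sub>F s :: real in at_left 1. 0 < s \<and> s < 1"
    using eventually_at_left_real[of 0 1] by (simp add: greaterThanLessThan_iff)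
  have T: "0 < T s" "discount (T s) = s" if s: "0 < s" "s < 1" for s
  proof -
    have "1 < 1 / s" using s by simp
    then have pos: "0 < 2 / v * (1 / s - 1)" using v_pos by simp
    then show "0 < T s" by (simp add: T_def)
    have "(T s)\<^sup>2 = 2 / v * (1 / s - 1)" unfolding T_def using pos by simp
    then have "(T s)\<^sup>2 * v / 2 = 1 / s - 1" using v_pos by (simp add: field_simps)
    then have "1 + (T s)\<^sup>2 * v / 2 = 1 / s" by linarith
    then show "discount (T s) = s" by (simp add: discount_def)
  qed
  have "(T \<longlongrightarrow> sqrt (2 / v * (1 / 1 - 1))) (at_left 1)"
    unfolding T_def by (intro tendsto_intros) auto
  then have "(T \<longlongrightarrow> 0) (at_left 1)" by simp
  moreover have "\<forall>\<^sub>F s in at_left 1. T s \<in> {0<..} \<and> T s \<noteq> 0"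
    using ev by eventually_elim (use T in force)
  ultimately have "filterlim T (at_right 0) (at_left 1)" by (simp add: filterlim_at)
  then have "((\<lambda>s. scaled_gf x (T s)) \<longlongrightarrow> harmonic x) (at_left 1)"
    by (rule filterlim_compose[OF scaled_gf_tendsto[OF x]])
  moreover have "((\<lambda>s. sqrt (2 / v * (1 / s))) \<longlongrightarrow> sqrt (2 / v * (1 / 1))) (at_left (1::real))"
    by (intro tendsto_intros) auto
  ultimately have "((\<lambda>s. scaled_gf x (T s) * sqrt (2 / v * (1 / s))) \<longlongrightarrow> harmonic x * sqrt (2 / v * (1 / 1))) (at_left 1)"
    by (rule tendsto_mult)
  moreover have "\<forall>\<^sub>F s in at_left 1. scaled_gf x (T s) * sqrt (2 / v * (1 / s)) = sqrt (1 - s) * (\<Sum>n. prob (alive x n) * s ^ n)"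
    using ev
  proof eventually_elim
    case (elim s)
    have "2 / v * (1 / s - 1) = 2 / v * (1 / s) * (1 - s)" using elim by (simp add: field_simps)
    then have Ts: "T s = sqrt (2 / v * (1 / s)) * sqrt (1 - s)" unfolding T_def by (simp only: real_sqrt_mult)
    have ne: "sqrt (2 / v * (1 / s)) \<noteq> 0" "sqrt (1 - s) \<noteq> 0" using elim v_pos by auto
    have "scaled_gf x (T s) * sqrt (2 / v * (1 / s)) = (1 - s) / sqrt (1 - s) * survival_gf x s"
      unfolding scaled_gf_def T(2)[OF elim[THEN conjunct1] elim[THEN conjunct2]] using ne by (simp add: Ts)
    also have "(1 - s) / sqrt (1 - s) = sqrt (1 - s)" using elim by (intro real_div_sqrt) auto
    finally show ?case by (simp add: survival_gf_def)
  qed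
  ultimately have "((\<lambda>s. sqrt (1 - s) * (\<Sum>n. prob (alive x n) * s ^ n)) \<longlongrightarrow> harmonic x * sqrt (2 / v * (1 / 1))) (at_left 1)"
    by (rule Lim_transform_eventually)
  from tauberian_inv_sqrt[OF _ decseq_survival this] show ?thesis by (simp add: mult.commute)
qed

text \<open>A dominating function for the average over \<open>x\<close>. Choosing \<open>\<theta>\<^sup>2 v / 2 = 1 / n\<close> gives \<open>1 - s = 1 / (n + 1)\<close> and
\<open>s\<^sup>n \<ge> 1 / e\<close>, so the first \<open>n + 1\<close> terms of the generating function already bound \<open>\<P>(\<tau> > n)\<close>.\<close>

lemma survival_bound:
  obtains C where "0 \<le> C" "\<And>x n. 0 \<le> x \<Longrightarrow> sqrt (real n) * prob (alive x n) \<le> C * (1 + x)\<^sup>2"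
proof -
  obtain C \<theta>0 where C: "0 \<le> C" "0 < \<theta>0"
    "\<And>x \<theta>. 0 \<le> x \<Longrightarrow> 0 < \<theta> \<Longrightarrow> \<theta> \<le> \<theta>0 \<Longrightarrow> 0 \<le> scaled_gf x \<theta> \<and> scaled_gf x \<theta> \<le> C * (1 + x)\<^sup>2"
    using scaled_gf_bound by blast
  \<comment> \<open>From this index on, the choice of \<open>\<theta>\<close> below is admissible; before it, probabilities are at most 1.\<close>
  define N where "N = nat \<lceil>2 / (v * \<theta>0\<^sup>2)\<rceil> + 1"
  have "sqrt (real n) * prob (alive x n) \<le> (sqrt N + sqrt (2 / v) * exp 1 * C) * (1 + x)\<^sup>2"
    if x: "0 \<le> x" for x n
  proof (cases "n \<le> N")
    case True
    have x1: "1 \<le> (1 + x)\<^sup>2" using x by (simp add: power2_eq_square algebra_simps)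
    have "sqrt (real n) * prob (alive x n) \<le> sqrt N * 1" using True by (intro mult_mono) auto
    also have "\<dots> \<le> sqrt N * (1 + x)\<^sup>2" using x1 by (intro mult_left_mono) auto
    also have "\<dots> \<le> (sqrt N + sqrt (2 / v) * exp 1 * C) * (1 + x)\<^sup>2"
      using C(1) v_pos by (intro mult_right_mono) auto
    finally show ?thesis .
  next
    case False
    then have n: "N < n" "0 < real n" by (auto simp: N_def)
    define \<theta> where "\<theta> = sqrt (2 / (v * n))"
    define s where "s = discount \<theta>"
    have th: "0 < \<theta>" using n v_pos by (simp add: \<theta>_def)
    have th2: "\<theta>\<^sup>2 = 2 / (v * n)" unfolding \<theta>_def using n v_pos by simp
    have "\<theta> \<le> \<theta>0"
    proof -
      have "2 / (v * \<theta>0\<^sup>2) \<le> real n" using n(1) unfolding N_def by linarith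
      then have "\<theta>\<^sup>2 \<le> \<theta>0\<^sup>2" unfolding th2 using n C(2) v_pos by (simp add: field_simps)
      then show ?thesis by (rule power2_le_imp_le) (use C(2) in simp)
    qed
    note h = C(3)[OF x th this]
    have s: "s = 1 / (1 + 1 / n)" using n v_pos by (simp add: s_def discount_def th2)
    have s01: "0 < s" "s < 1" using discount_bounds[OF th] by (auto simp: s_def)
    have s1: "(1 - s) * (real n + 1) = 1" using n by (simp add: s field_simps)
    have sn: "exp (- 1) \<le> s ^ n"
    proof -
      have "(1 + 1 / n) ^ n \<le> exp (1 / n) ^ n" using n exp_ge_add_one_self[of "1 / n"] by (intro power_mono) auto
      also have "\<dots> = exp 1" using n by (simp flip: exp_of_nat_mult)
      finally have "inverse (exp 1) \<le> inverse ((1 + 1 / real n) ^ n)" using n by (intro le_imp_inverse_le) (auto intro!: zero_less_power add_pos_nonneg)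
      then show ?thesis by (simp add: s exp_minus power_one_over inverse_eq_divide)
    qed
    have "(real n + 1) * (exp (- 1) * prob (alive x n)) = (\<Sum>k\<le>n. exp (- 1) * prob (alive x n))" by simp
    also have "\<dots> \<le> (\<Sum>k\<le>n. prob (alive x k) * s ^ k)"
    proof (rule sum_mono)
      fix k assume "k \<in> {..n}"
      then have k: "k \<le> n" by simp
      have "s ^ n \<le> s ^ k" using s01 by (intro power_decreasing k) auto
      then have "exp (- 1) \<le> s ^ k" using sn by linarith
      moreover have "prob (alive x n) \<le> prob (alive x k)" using decseqD[OF decseq_survival k] .
      ultimately have "exp (- 1) * prob (alive x n) \<le> s ^ k * prob (alive x k)"
        using s01 by (intro mult_mono) auto
      then show "exp (- 1) * prob (alive x n) \<le> prob (alive x k) * s ^ k" by (simp add: mult.commute)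
    qed
    also have "\<dots> \<le> survival_gf x s"
      unfolding survival_gf_def using s01 by (intro sum_le_suminf summable_survival) auto
    finally have "(1 - s) * ((real n + 1) * (exp (- 1) * prob (alive x n))) \<le> (1 - s) * survival_gf x s"
      using s01 by (intro mult_left_mono) auto
    then have "exp (- 1) * prob (alive x n) \<le> (1 - s) * survival_gf x s"
      using s1 by (simp flip: mult.assoc)
    also have "\<dots> = \<theta> * scaled_gf x \<theta>" using th by (simp add: scaled_gf_def s_def)
    also have "\<dots> \<le> \<theta> * (C * (1 + x)\<^sup>2)" using h th by (intro mult_left_mono) auto
    finally have "exp 1 * (exp (- 1) * prob (alive x n)) \<le> exp 1 * (\<theta> * (C * (1 + x)\<^sup>2))" by (intro mult_left_mono) auto
    then have p: "prob (alive x n) \<le> exp 1 * (\<theta> * (C * (1 + x)\<^sup>2))" by (simp add: exp_minus field_simps)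
    have "sqrt n * prob (alive x n) \<le> sqrt n * (exp 1 * (\<theta> * (C * (1 + x)\<^sup>2)))"
      using p by (intro mult_left_mono) auto
    also have "\<dots> = (sqrt n * \<theta>) * exp 1 * C * (1 + x)\<^sup>2" by simp
    also have "sqrt n * \<theta> = sqrt (2 / v)" unfolding \<theta>_def using n v_pos by (simp flip: real_sqrt_mult)
    also have "sqrt (2 / v) * exp 1 * C * (1 + x)\<^sup>2 \<le> (sqrt N + sqrt (2 / v) * exp 1 * C) * (1 + x)\<^sup>2"
      by (intro mult_right_mono) auto
    finally show ?thesis .
  qed
  moreover have "0 \<le> sqrt N + sqrt (2 / v) * exp 1 * C" using C(1) v_pos by auto
  ultimately show thesis using that by blast
qed

end

section \<open>The Laplace transform of the minimum and the mixing of the chain\<close>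

lemma exponential_density_tail:
  assumes l: "0 < l" and a: "0 \<le> a"
  shows "(\<integral>\<^sup>+x. ennreal (exponential_density l x) * indicator {a..} x \<partial>lborel) = ennreal (exp (- l * a))"
proof -
  have "(\<integral>\<^sup>+x. ennreal (exponential_density l x) * indicator {a..} x \<partial>lborel) =
      (\<integral>\<^sup>+x. ennreal (l * exp (- l * x)) * indicator {a..} x \<partial>lborel)"
    using a by (intro nn_integral_cong) (auto simp: exponential_density_def indicator_def mult.commute)
  also have "\<dots> = ennreal (0 - (- exp (- l * a)))"
  proof (rule nn_integral_FTC_atLeast)
    have "filterlim (\<lambda>x. - l * x) at_bot at_top"
      using l by (simp add: filterlim_tendsto_pos_mult_at_top[OF tendsto_const _ filterlim_ident] filterlim_uminus_at_bot)
    then have "((\<lambda>x. - exp (- l * x)) \<longlongrightarrow> - 0) at_top"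
      by (intro tendsto_minus filterlim_compose[OF exp_at_bot])
    then show "((\<lambda>x. - exp (- l * x)) \<longlongrightarrow> 0) at_top" by simp
    show "DERIV (\<lambda>x. - exp (- l * x)) x :> l * exp (- l * x)" for x
      by (auto intro!: derivative_eq_intros)
  qed (use l in auto)
  finally show ?thesis by simp
qed

lemma exponential_density_moment:
  assumes "0 < l"
  shows "has_bochner_integral lborel (\<lambda>x. exponential_density l x * x ^ k) (fact k / l ^ k)"
proof (rule has_bochner_integral_nn_integral)
  show "AE x in lborel. 0 \<le> exponential_density l x * x ^ k"
    using assms by (intro AE_I2) (auto simp: erlang_density_def)
  show "(\<integral>\<^sup>+x. ennreal (exponential_density l x * x ^ k) \<partial>lborel) = ennreal (fact k / l ^ k)"
    using nn_integral_erlang_ith_moment[OF assms, of 0 k] by simp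
qed (use assms in auto)

context additive_walk
begin

lemma running_min_ge_iff: "- x \<le> running_min Y n \<omega> \<longleftrightarrow> (\<forall>k\<le>n. 0 \<le> x + walk Y k \<omega>)"
proof -
  have "- x \<le> running_min Y n \<omega> \<longleftrightarrow> (\<forall>k\<in>{0..n}. - x \<le> walk Y k \<omega>)"
    unfolding running_min_def by (subst Min_ge_iff) auto
  also have "\<dots> \<longleftrightarrow> (\<forall>k\<le>n. 0 \<le> x + walk Y k \<omega>)"
  proof -
    have "- x \<le> w \<longleftrightarrow> 0 \<le> x + w" for w :: real by linarith
    then show ?thesis by auto
  qed
  finally show ?thesis .
qed

lemma alive_eq_running_min: "alive x n = {\<omega> \<in> space M. - running_min Y n \<omega> \<le> x}"
  by (simp only: alive_def running_min_ge_iff[symmetric] minus_le_iff[of x])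

lemma running_min_le_0: "running_min Y n \<omega> \<le> 0"
proof -
  have "running_min Y n \<omega> \<le> walk Y 0 \<omega>" unfolding running_min_def
    by (rule Min_le, simp, rule imageI, simp)
  then show ?thesis by simp
qed

lemma running_min_antimono: "running_min Y (Suc n) \<omega> \<le> running_min Y n \<omega>"
  unfolding running_min_def by (intro Min_antimono) auto

lemma running_min_past:
  assumes "n \<le> m"
  shows "running_min Y n \<in> borel_measurable (past M Y X m)"
proof -
  have "(\<lambda>\<omega>. Min ((\<lambda>k. walk Y k \<omega>) ` {0..n})) \<in> borel_measurable (past M Y X m)"
    using assms by (intro borel_measurable_Min walk_past) auto
  then show ?thesis by (simp add: running_min_def[abs_def])
qed

lemma running_min_meas [measurable]: "running_min Y n \<in> borel_measurable M"
  using meas_past[OF running_min_past[OF order.refl]] .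

lemma prob_alive_meas [measurable]: "(\<lambda>x. prob (alive x n)) \<in> borel_measurable borel"
proof (rule borel_measurable_mono)
  show "mono (\<lambda>x. prob (alive x n))"
    by (intro monoI finite_measure_mono) (auto simp: alive_eq_running_min)
qed

text \<open>\<open>exp (l m)\<close> is the tail at \<open>- m\<close> of the exponential distribution with parameter \<open>l\<close>; exchange the
two integrals.\<close>

lemma exp_running_min_integral:
  assumes l: "0 < l"
  shows "(\<integral>\<omega>. exp (l * running_min Y n \<omega>) \<partial>M) = (\<integral>x. exponential_density l x * prob (alive x n) \<partial>lborel)"
proof -
  have ed0: "0 \<le> exponential_density l x" for x using l by (rule exponential_density_nonneg)
  interpret L: pair_sigma_finite M lborel ..
  have "(\<integral>\<^sup>+\<omega>. ennreal (exp (l * running_min Y n \<omega>)) \<partial>M) =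
      (\<integral>\<^sup>+\<omega>. \<integral>\<^sup>+x. ennreal (exponential_density l x) * indicator {\<omega> \<in> space M. - running_min Y n \<omega> \<le> x} \<omega> \<partial>lborel \<partial>M)"
  proof (rule nn_integral_cong)
    fix \<omega> assume w: "\<omega> \<in> space M"
    have "(\<integral>\<^sup>+x. ennreal (exponential_density l x) * indicator {\<omega> \<in> space M. - running_min Y n \<omega> \<le> x} \<omega> \<partial>lborel)
        = (\<integral>\<^sup>+x. ennreal (exponential_density l x) * indicator {- running_min Y n \<omega>..} x \<partial>lborel)"
      using w by (intro nn_integral_cong) (auto simp: indicator_def)
    also have "\<dots> = ennreal (exp (- l * (- running_min Y n \<omega>)))"
      using running_min_le_0[of n \<omega>] by (intro exponential_density_tail l) auto
    finally show "ennreal (exp (l * running_min Y n \<omega>)) =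
      (\<integral>\<^sup>+x. ennreal (exponential_density l x) * indicator {\<omega> \<in> space M. - running_min Y n \<omega> \<le> x} \<omega> \<partial>lborel)" by simp
  qed
  also have "\<dots> = (\<integral>\<^sup>+x. \<integral>\<^sup>+\<omega>. ennreal (exponential_density l x) * indicator {\<omega> \<in> space M. - running_min Y n \<omega> \<le> x} \<omega> \<partial>M \<partial>lborel)"
    by (rule L.Fubini'[symmetric]) measurable
  also have "\<dots> = (\<integral>\<^sup>+x. ennreal (exponential_density l x * prob (alive x n)) \<partial>lborel)"
    by (intro nn_integral_cong)
      (simp add: nn_integral_cmult emeasure_eq_measure ennreal_mult ed0 flip: alive_eq_running_min)
  finally have eq: "(\<integral>\<^sup>+\<omega>. ennreal (exp (l * running_min Y n \<omega>)) \<partial>M) = \<dots>" .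
  have "(\<integral>\<omega>. exp (l * running_min Y n \<omega>) \<partial>M) = enn2real (\<integral>\<^sup>+\<omega>. ennreal (exp (l * running_min Y n \<omega>)) \<partial>M)"
    by (rule integral_eq_nn_integral) auto
  also have "\<dots> = enn2real (\<integral>\<^sup>+x. ennreal (exponential_density l x * prob (alive x n)) \<partial>lborel)" by (simp only: eq)
  also have "\<dots> = (\<integral>x. exponential_density l x * prob (alive x n) \<partial>lborel)"
    by (rule integral_eq_nn_integral[symmetric]) (auto simp: ed0)
  finally show ?thesis .
qed

text \<open>A variable that is determined by the first \<open>n\<close> steps only sees the powers of \<open>P\<close> afterwards.\<close>

lemma n_step_expectation:
  assumes Z: "\<And>m. n \<le> m \<Longrightarrow> Z \<in> borel_measurable (past M Y X m)" and Z01: "\<And>\<omega>. 0 \<le> Z \<omega> \<and> Z \<omega> \<le> (1 :: real)"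
  shows "(\<integral>\<omega>. Z \<omega> * indicator {\<omega>. X (n + k) \<omega> = j} \<omega> \<partial>M) =
    (\<Sum>e\<in>UNIV. (\<integral>\<omega>. Z \<omega> * indicator {\<omega>. X n \<omega> = e} \<omega> \<partial>M) * n_step P k $ e $ j)"
proof (induction k arbitrary: j)
  case 0
  have "(\<Sum>e\<in>UNIV. (\<integral>\<omega>. Z \<omega> * indicator {\<omega>. X n \<omega> = e} \<omega> \<partial>M) * n_step P 0 $ e $ j) =
      (\<Sum>e\<in>{j}. (\<integral>\<omega>. Z \<omega> * indicator {\<omega>. X n \<omega> = e} \<omega> \<partial>M) * n_step P 0 $ e $ j)"
    by (intro sum.mono_neutral_right) (auto simp: mat_def)
  then show ?case by (simp add: mat_def)
next
  case (Suc k)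
  have Zm [measurable]: "Z \<in> borel_measurable M" using meas_past[OF Z[of n]] by simp
  have iZ: "integrable M (\<lambda>\<omega>. Z \<omega> * indicator {\<omega>. X m \<omega> = e} \<omega>)" for m e
  proof (rule integrable_const_bound[where B=1])
    have "(\<lambda>\<omega>. Z \<omega> * indicator {e} (X m \<omega>)) \<in> borel_measurable M" by measurable
    then show "(\<lambda>\<omega>. Z \<omega> * indicator {\<omega>. X m \<omega> = e} \<omega>) \<in> borel_measurable M"
      by (simp add: indicator_def)
  qed (use Z01 in \<open>auto simp: indicator_def\<close>)
  \<comment> \<open>The truncation leaves \<open>Z\<close> unchanged and makes the function nonnegative and bounded on the whole line,
     as the one-step formula requires.\<close>
  define \<phi> where "\<phi> k' j' r t = (if j' = j then max 0 (min 1 r) else 0)" for k' j' :: 'e and r t :: real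
  have sp: "space M \<in> sets (past M Y X (n + k))" using sets.top[of "past M Y X (n + k)"] by simp
  have m: "case_prod (\<phi> k' j') \<in> borel_measurable (borel \<Otimes>\<^sub>M borel)" for k' j'
    unfolding \<phi>_def by measurable
  have in1: "integrable (F k' j') (\<phi> k' j' r)" for k' j' r
  proof -
    interpret Fk: prob_space "F k' j'" by (rule F_prob)
    show ?thesis unfolding \<phi>_def by simp
  qed
  have sm: "(\<Sum>j'\<in>UNIV. P $ e $ j' * (\<integral>t. \<phi> e j' r t \<partial>F e j')) = P $ e $ j * max 0 (min 1 r)" for e r
  proof -
    have F1: "measure (F e j') UNIV = 1" for j' using prob_space.prob_space[OF F_prob[of e j']] by simp
    have "(\<Sum>j'\<in>UNIV. P $ e $ j' * (\<integral>t. \<phi> e j' r t \<partial>F e j')) = (\<Sum>j'\<in>{j}. P $ e $ j' * (\<integral>t. \<phi> e j' r t \<partial>F e j'))"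
      by (intro sum.mono_neutral_right) (auto simp: \<phi>_def)
    then show ?thesis by (simp add: \<phi>_def F1)
  qed
  have P1: "P $ e $ j' \<le> 1" for e j'
    using P_sum[of e] member_le_sum[of j' UNIV "\<lambda>j. P $ e $ j"] P_nonneg by auto
  have step: "(\<integral>\<omega>. \<phi> (X (n + k) \<omega>) (X (Suc (n + k)) \<omega>) (Z \<omega>) (Y (Suc (n + k)) \<omega>) * indicator (space M) \<omega> \<partial>M) =
      (\<integral>\<omega>. (\<Sum>j'\<in>UNIV. P $ X (n + k) \<omega> $ j' * (\<integral>t. \<phi> (X (n + k) \<omega>) j' (Z \<omega>) t \<partial>F (X (n + k) \<omega>) j')) * indicator (space M) \<omega> \<partial>M)"
  proof (rule next_step(3)[OF sp Z m _ in1])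
    show "0 \<le> \<phi> k' j' r t" for k' j' r t by (simp add: \<phi>_def)
    show "(\<Sum>j'\<in>UNIV. P $ X (n + k) \<omega> $ j' * (\<integral>t. \<phi> (X (n + k) \<omega>) j' (Z \<omega>) t \<partial>F (X (n + k) \<omega>) j')) \<le> 1" for \<omega>
      unfolding sm using Z01[of \<omega>] P1[of "X (n + k) \<omega>" j] P_nonneg[of "X (n + k) \<omega>" j] by (simp add: mult_le_one)
  qed simp
  have "(\<integral>\<omega>. Z \<omega> * indicator {\<omega>. X (n + Suc k) \<omega> = j} \<omega> \<partial>M) =
      (\<integral>\<omega>. \<phi> (X (n + k) \<omega>) (X (Suc (n + k)) \<omega>) (Z \<omega>) (Y (Suc (n + k)) \<omega>) * indicator (space M) \<omega> \<partial>M)"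
    by (intro Bochner_Integration.integral_cong refl) (use Z01 in \<open>auto simp: \<phi>_def indicator_def max_def min_def dest: antisym\<close>)
  also have "\<dots> = (\<integral>\<omega>. (\<Sum>e\<in>UNIV. P $ e $ j * (Z \<omega> * indicator {\<omega>. X (n + k) \<omega> = e} \<omega>)) \<partial>M)"
    unfolding step
  proof (intro Bochner_Integration.integral_cong refl)
    fix \<omega> assume "\<omega> \<in> space M"
    have "(\<Sum>e\<in>UNIV. P $ e $ j * (Z \<omega> * indicator {\<omega>. X (n + k) \<omega> = e} \<omega>)) =
        (\<Sum>e\<in>{X (n + k) \<omega>}. P $ e $ j * (Z \<omega> * indicator {\<omega>. X (n + k) \<omega> = e} \<omega>))"
      by (intro sum.mono_neutral_right) (auto simp: indicator_def)
    moreover have "max 0 (min 1 (Z \<omega>)) = Z \<omega>" using Z01[of \<omega>] by simp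
    ultimately show "(\<Sum>j'\<in>UNIV. P $ X (n + k) \<omega> $ j' * (\<integral>t. \<phi> (X (n + k) \<omega>) j' (Z \<omega>) t \<partial>F (X (n + k) \<omega>) j')) * indicator (space M) \<omega> =
        (\<Sum>e\<in>UNIV. P $ e $ j * (Z \<omega> * indicator {\<omega>. X (n + k) \<omega> = e} \<omega>))"
      unfolding sm using \<open>\<omega> \<in> space M\<close> by simp
  qed
  also have "\<dots> = (\<Sum>e\<in>UNIV. P $ e $ j * (\<integral>\<omega>. Z \<omega> * indicator {\<omega>. X (n + k) \<omega> = e} \<omega> \<partial>M))"
    using iZ by simp
  also have "\<dots> = (\<Sum>e\<in>UNIV. P $ e $ j * (\<Sum>e'\<in>UNIV. (\<integral>\<omega>. Z \<omega> * indicator {\<omega>. X n \<omega> = e'} \<omega> \<partial>M) * n_step P k $ e' $ e))"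
    by (simp only: Suc.IH)
  also have "\<dots> = (\<Sum>e\<in>UNIV. \<Sum>e'\<in>UNIV. (\<integral>\<omega>. Z \<omega> * indicator {\<omega>. X n \<omega> = e'} \<omega> \<partial>M) * (n_step P k $ e' $ e * P $ e $ j))"
    unfolding sum_distrib_left by (intro sum.cong refl) simp
  also have "\<dots> = (\<Sum>e'\<in>UNIV. \<Sum>e\<in>UNIV. (\<integral>\<omega>. Z \<omega> * indicator {\<omega>. X n \<omega> = e'} \<omega> \<partial>M) * (n_step P k $ e' $ e * P $ e $ j))"
    by (rule sum.swap)
  also have "\<dots> = (\<Sum>e'\<in>UNIV. (\<integral>\<omega>. Z \<omega> * indicator {\<omega>. X n \<omega> = e'} \<omega> \<partial>M) * n_step P (Suc k) $ e' $ j)"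
    using n_step_add[of P k 1] by (simp add: sum_distrib_left matrix_matrix_mult_def)
  finally show ?case .
qed

text \<open>With \<open>a n = \<E>(exp (l m\<^sub>n))\<close>: replacing \<open>m\<^sub>n\<^sub>+\<^sub>k\<close> by \<open>m\<^sub>n\<close> costs at most \<open>a n - a (n + k)\<close>, which is
\<open>o(1 / sqrt n)\<close> because both terms are asymptotic to \<open>L / sqrt n\<close>. In the remaining \<open>k\<close> steps the
chain reaches \<open>j\<close> with a probability within \<open>d\<close> of \<open>\<nu> $ j\<close>, whatever its state at time \<open>n\<close>.\<close>

lemma mixing_transfer:
  assumes irr: "irreducible_matrix P" "aperiodic_matrix P" and nu: "invariant_probability P \<nu>"
    and l: "0 < l"
    and lim: "(\<lambda>n. sqrt (real n) * (\<integral>\<omega>. exp (l * running_min Y n \<omega>) \<partial>M)) \<longlonglongrightarrow> L"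
  shows "(\<lambda>n. sqrt (real n) * (\<integral>\<omega>. exp (l * running_min Y n \<omega>) * indicator {\<omega>. X n \<omega> = j} \<omega> \<partial>M)) \<longlonglongrightarrow> \<nu> $ j * L"
proof -
  define Z where "Z n \<omega> = exp (l * running_min Y n \<omega>)" for n \<omega>
  define a where "a n = (\<integral>\<omega>. Z n \<omega> \<partial>M)" for n
  define b where "b n = (\<integral>\<omega>. Z n \<omega> * indicator {\<omega>. X n \<omega> = j} \<omega> \<partial>M)" for n
  have lima: "(\<lambda>n. sqrt (real n) * a n) \<longlonglongrightarrow> L" using lim by (simp add: a_def Z_def)
  have Zp: "Z n \<in> borel_measurable (past M Y X m)" if "n \<le> m" for n m
  proof -
    have [measurable]: "running_min Y n \<in> borel_measurable (past M Y X m)" by (rule running_min_past[OF that])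
    show ?thesis unfolding Z_def by measurable
  qed
  have Zm [measurable]: "Z n \<in> borel_measurable M" for n unfolding Z_def by measurable
  have Z01: "0 \<le> Z n \<omega> \<and> Z n \<omega> \<le> 1" for n \<omega>
    using running_min_le_0[of n \<omega>] l by (auto simp: Z_def mult_nonneg_nonpos)
  have iZ: "integrable M (Z n)" for n
    by (rule integrable_const_bound[where B=1]) (use Z01 in auto)
  have indm: "(\<lambda>\<omega>. indicator {\<omega>. X m \<omega> = e} \<omega> :: real) \<in> borel_measurable M" for m e
  proof -
    have "(\<lambda>\<omega>. indicator {e} (X m \<omega>) :: real) \<in> borel_measurable M" by measurable
    then show ?thesis by (simp add: indicator_def)
  qed
  have iZi: "integrable M (\<lambda>\<omega>. Z n \<omega> * indicator {\<omega>. X m \<omega> = e} \<omega>)" for n m e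
    by (rule integrable_const_bound[where B=1])
      (use Z01 indm in \<open>auto simp: indicator_def intro!: borel_measurable_times\<close>)
  have Zdec: "Z (n + k) \<omega> \<le> Z n \<omega>" for n k \<omega>
  proof (induction k)
    case (Suc k)
    have "Z (Suc (n + k)) \<omega> \<le> Z (n + k) \<omega>"
      unfolding Z_def using l running_min_antimono[of "n + k" \<omega>] by simp
    then show ?case using Suc by simp
  qed simp
  have a0: "0 \<le> a n" for n unfolding a_def using Z01 by (intro integral_nonneg_AE) auto
  have sum_a: "(\<Sum>e\<in>UNIV. (\<integral>\<omega>. Z n \<omega> * indicator {\<omega>. X n \<omega> = e} \<omega> \<partial>M)) = a n" for n
  proof -
    have "(\<Sum>e\<in>UNIV. Z n \<omega> * indicator {\<omega>. X n \<omega> = e} \<omega>) = Z n \<omega>" for \<omega>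
    proof -
      have "(\<Sum>e\<in>UNIV. Z n \<omega> * indicator {\<omega>. X n \<omega> = e} \<omega>) = (\<Sum>e\<in>{X n \<omega>}. Z n \<omega> * indicator {\<omega>. X n \<omega> = e} \<omega>)"
        by (intro sum.mono_neutral_right) (auto simp: indicator_def)
      then show ?thesis by simp
    qed
    then show ?thesis using iZi by (simp add: a_def flip: Bochner_Integration.integral_sum)
  qed
  have key: "\<bar>b (n + k) - \<nu> $ j * a n\<bar> \<le> (a n - a (n + k)) + d * a n"
    if d: "\<And>e. \<bar>n_step P k $ e $ j - \<nu> $ j\<bar> \<le> d" for n k d
  proof -
    define c where "c e = (\<integral>\<omega>. Z n \<omega> * indicator {\<omega>. X n \<omega> = e} \<omega> \<partial>M)" for e
    have c0: "0 \<le> c e" for e unfolding c_def using Z01 by (intro integral_nonneg_AE) auto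
    define b' where "b' = (\<integral>\<omega>. Z n \<omega> * indicator {\<omega>. X (n + k) \<omega> = j} \<omega> \<partial>M)"
    have b': "b' = (\<Sum>e\<in>UNIV. c e * n_step P k $ e $ j)"
      unfolding b'_def c_def by (rule n_step_expectation[OF Zp Z01])
    have "b' - \<nu> $ j * a n = (\<Sum>e\<in>UNIV. c e * (n_step P k $ e $ j - \<nu> $ j))"
      unfolding b' sum_a[symmetric] c_def[symmetric]
      by (simp add: right_diff_distrib sum_subtractf sum_distrib_left mult.commute)
    also have "\<bar>\<dots>\<bar> \<le> (\<Sum>e\<in>UNIV. c e * d)"
      by (rule order.trans[OF sum_abs], rule sum_mono) (use c0 d in \<open>auto simp: abs_mult intro!: mult_left_mono\<close>)
    also have "(\<Sum>e\<in>UNIV. c e * d) = d * a n"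
      unfolding sum_a[symmetric] c_def[symmetric] by (simp add: sum_distrib_left mult.commute)
    finally have 1: "\<bar>b' - \<nu> $ j * a n\<bar> \<le> d * a n" .
    have "b' - b (n + k) = (\<integral>\<omega>. (Z n \<omega> - Z (n + k) \<omega>) * indicator {\<omega>. X (n + k) \<omega> = j} \<omega> \<partial>M)"
      unfolding b'_def b_def left_diff_distrib using iZi by simp
    moreover have "0 \<le> (\<integral>\<omega>. (Z n \<omega> - Z (n + k) \<omega>) * indicator {\<omega>. X (n + k) \<omega> = j} \<omega> \<partial>M)"
      using Zdec by (intro integral_nonneg_AE) auto
    moreover have "(\<integral>\<omega>. (Z n \<omega> - Z (n + k) \<omega>) * indicator {\<omega>. X (n + k) \<omega> = j} \<omega> \<partial>M) \<le> (\<integral>\<omega>. Z n \<omega> - Z (n + k) \<omega> \<partial>M)"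
    proof (rule integral_mono)
      show "integrable M (\<lambda>\<omega>. (Z n \<omega> - Z (n + k) \<omega>) * indicator {\<omega>. X (n + k) \<omega> = j} \<omega>)"
        unfolding left_diff_distrib by (intro Bochner_Integration.integrable_diff iZi)
      show "integrable M (\<lambda>\<omega>. Z n \<omega> - Z (n + k) \<omega>)" by (intro Bochner_Integration.integrable_diff iZ)
      show "(Z n \<omega> - Z (n + k) \<omega>) * indicator {\<omega>. X (n + k) \<omega> = j} \<omega> \<le> Z n \<omega> - Z (n + k) \<omega>" for \<omega>
        using Zdec[of n k \<omega>] by (auto simp: indicator_def)
    qed
    moreover have "(\<integral>\<omega>. Z n \<omega> - Z (n + k) \<omega> \<partial>M) = a n - a (n + k)"
      unfolding a_def by (intro Bochner_Integration.integral_diff iZ)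
    ultimately show ?thesis using 1 by linarith
  qed
  have L0: "0 \<le> L" by (rule tendsto_lowerbound[OF lima]) (auto simp: a0)
  have "(\<lambda>n. sqrt (real n) * b n) \<longlonglongrightarrow> \<nu> $ j * L"
  proof (rule LIMSEQ_I)
    fix r :: real assume r: "0 < r"
    define d where "d = r / (4 * (L + 1))"
    have d: "0 < d" "d * L < r / 2"
    proof -
      show "0 < d" using r L0 by (simp add: d_def)
      have "d * L \<le> d * (L + 1)" using \<open>0 < d\<close> by (intro mult_left_mono) auto
      also have "\<dots> = r / 4" using L0 by (simp add: d_def field_simps)
      also have "\<dots> < r / 2" using r by simp
      finally show "d * L < r / 2" .
    qed
    have "\<forall>e. \<forall>\<^sub>F k in sequentially. \<bar>n_step P k $ e $ j - \<nu> $ j\<bar> < d"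
      using tendstoD[OF n_step_tendsto_invariant[OF stoch irr nu] d(1)] by (simp add: dist_real_def)
    then have "\<forall>\<^sub>F k in sequentially. \<forall>e. \<bar>n_step P k $ e $ j - \<nu> $ j\<bar> < d"
      by (intro eventually_all_finite) simp
    then obtain k where "\<forall>e. \<bar>n_step P k $ e $ j - \<nu> $ j\<bar> < d"
      using eventually_happens[of _ sequentially] by auto
    then have k: "\<bar>n_step P k $ e $ j - \<nu> $ j\<bar> \<le> d" for e by (simp add: less_imp_le)
    have s1: "(\<lambda>n. sqrt (real (n + k)) * a (n + k)) \<longlonglongrightarrow> L" by (rule LIMSEQ_ignore_initial_segment[OF lima])
    have s2: "(\<lambda>n. sqrt (real (n + k)) * a n) \<longlonglongrightarrow> L"
    proof -
      have "(\<lambda>n. real k / real n) \<longlonglongrightarrow> 0" by (rule lim_const_over_n)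
      then have "(\<lambda>n. sqrt (1 + real k / real n) * (sqrt (real n) * a n)) \<longlonglongrightarrow> sqrt (1 + 0) * L"
        by (intro tendsto_mult lima tendsto_real_sqrt tendsto_add tendsto_const)
      moreover have "\<forall>\<^sub>F n in sequentially. sqrt (1 + real k / real n) * (sqrt (real n) * a n) = sqrt (real (n + k)) * a n"
        using eventually_gt_at_top[of 0]
      proof eventually_elim
        case (elim n)
        have "sqrt (1 + real k / real n) * sqrt (real n) = sqrt ((1 + real k / real n) * real n)" by (simp only: real_sqrt_mult)
        also have "(1 + real k / real n) * real n = real (n + k)" using elim by (simp add: field_simps)
        finally show ?case by (simp flip: mult.assoc)
      qed
      ultimately show ?thesis using Lim_transform_eventually by fastforce
    qed
    have "(\<lambda>n. (sqrt (real (n + k)) * a n - sqrt (real (n + k)) * a (n + k)) + d * (sqrt (real (n + k)) * a n)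
        + \<bar>\<nu> $ j * (sqrt (real (n + k)) * a n) - \<nu> $ j * L\<bar>) \<longlonglongrightarrow> (L - L) + d * L + \<bar>\<nu> $ j * L - \<nu> $ j * L\<bar>"
      by (intro tendsto_intros s1 s2)
    then have "\<forall>\<^sub>F n in sequentially. (sqrt (real (n + k)) * a n - sqrt (real (n + k)) * a (n + k)) + d * (sqrt (real (n + k)) * a n)
        + \<bar>\<nu> $ j * (sqrt (real (n + k)) * a n) - \<nu> $ j * L\<bar> < r"
      by (rule order_tendstoD(2)) (use d(2) r in simp)
    then have "\<forall>\<^sub>F n in sequentially. norm (sqrt (real (n + k)) * b (n + k) - \<nu> $ j * L) < r"
    proof eventually_elim
      case (elim n)
      have "sqrt (real (n + k)) * \<bar>b (n + k) - \<nu> $ j * a n\<bar> \<le> sqrt (real (n + k)) * ((a n - a (n + k)) + d * a n)"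
        using key[OF k, of n] by (intro mult_left_mono) auto
      moreover have "\<bar>sqrt (real (n + k)) * b (n + k) - \<nu> $ j * (sqrt (real (n + k)) * a n)\<bar> =
          sqrt (real (n + k)) * \<bar>b (n + k) - \<nu> $ j * a n\<bar>"
      proof -
        have "sqrt (real (n + k)) * b (n + k) - \<nu> $ j * (sqrt (real (n + k)) * a n) =
            sqrt (real (n + k)) * (b (n + k) - \<nu> $ j * a n)" by (simp add: right_diff_distrib)
        then show ?thesis by (simp only: abs_mult abs_of_nonneg[OF real_sqrt_ge_zero[OF of_nat_0_le_iff]])
      qed
      ultimately show ?case using elim unfolding real_norm_def by (simp add: algebra_simps)
    qed
    then obtain N where "\<And>n. n \<ge> N \<Longrightarrow> norm (sqrt (real (n + k)) * b (n + k) - \<nu> $ j * L) < r"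
      by (auto simp: eventually_sequentially)
    then have "norm (sqrt (real n) * b n - \<nu> $ j * L) < r" if "n \<ge> N + k" for n
      using that by (metis add_le_imp_le_diff le_add_diff_inverse2 le_add2 order.trans)
    then show "\<exists>no. \<forall>n\<ge>no. norm (sqrt (real n) * b n - \<nu> $ j * L) < r" by blast
  qed
  then show ?thesis by (simp add: b_def Z_def)
qed

end

section \<open>The limiting profile\<close>

context corrected_walk
begin

definition profile :: "real \<Rightarrow> real" where
  "profile l = (\<integral>x. exponential_density l x * harmonic x \<partial>lborel)"

lemma harmonic_nonneg:
  assumes "0 \<le> x"
  shows "0 \<le> harmonic x"
proof -
  have "0 \<le> sqrt (2 / v) * harmonic x / sqrt pi"
    by (rule tendsto_lowerbound[OF survival_asymp[OF assms]]) auto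
  then have "0 \<le> (sqrt (2 / v) / sqrt pi) * harmonic x" by simp
  moreover have "0 < sqrt (2 / v) / sqrt pi" using v_pos by simp
  ultimately show ?thesis using zero_le_mult_iff[of "sqrt (2 / v) / sqrt pi" "harmonic x"] by linarith
qed

text \<open>Dominated convergence of the averages over the starting level, with \<open>survival_asymp\<close> for the pointwise
limit and \<open>survival_bound\<close> for the domination.\<close>

lemma profile_asymp:
  assumes l: "0 < l"
  shows "integrable lborel (\<lambda>x. exponential_density l x * harmonic x)" (is ?int)
    and "(\<lambda>n. sqrt (real n) * (\<integral>\<omega>. exp (l * running_min Y n \<omega>) \<partial>M)) \<longlonglongrightarrow> sqrt (2 / v) * profile l / sqrt pi" (is ?lim)
proof -
  have ed0: "0 \<le> exponential_density l x" for x using l by (rule exponential_density_nonneg)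
  have edn: "exponential_density l x = 0" if "x < 0" for x using that by (simp add: erlang_density_def)
  obtain C where C: "0 \<le> C" "\<And>x n. 0 \<le> x \<Longrightarrow> sqrt (real n) * prob (alive x n) \<le> C * (1 + x)\<^sup>2"
    using survival_bound by blast
  define c where "c = sqrt (2 / v) / sqrt pi"
  have c: "0 < c" using v_pos by (simp add: c_def)
  define f where "f n x = exponential_density l x * (sqrt (real n) * prob (alive x n))" for n x
  define L where "L x = exponential_density l x * (c * harmonic x)" for x
  define w where "w x = C * (exponential_density l x * x ^ 0 + 2 * (exponential_density l x * x ^ 1) + exponential_density l x * x ^ 2)" for x
  have fm: "f n \<in> borel_measurable lborel" for n unfolding f_def by measurable
  have lim: "(\<lambda>n. f n x) \<longlonglongrightarrow> L x" for x
  proof (cases "x < 0")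
    case True
    then show ?thesis by (simp add: f_def L_def edn)
  next
    case False
    then have "(\<lambda>n. sqrt (real n) * prob (alive x n)) \<longlonglongrightarrow> c * harmonic x"
      using survival_asymp[of x] by (simp add: c_def)
    then show ?thesis unfolding f_def L_def by (rule tendsto_mult_left)
  qed
  have Lm: "L \<in> borel_measurable lborel"
    by (rule borel_measurable_LIMSEQ_metric[of f, OF fm]) (use lim in auto)
  have mom: "integrable lborel (\<lambda>x. exponential_density l x * x ^ k)" for k
    using exponential_density_moment[OF l, of k] by (simp add: has_bochner_integral_iff)
  have wi: "integrable lborel w"
    unfolding w_def by (intro integrable_mult_right Bochner_Integration.integrable_add mom)
  have bd: "norm (f n x) \<le> w x" for n x
  proof (cases "x < 0")
    case True
    then show ?thesis by (simp add: f_def w_def edn)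
  next
    case False
    then have "sqrt (real n) * prob (alive x n) \<le> C * (1 + x)\<^sup>2" by (intro C(2)) auto
    then have "f n x \<le> exponential_density l x * (C * (1 + x)\<^sup>2)"
      unfolding f_def by (intro mult_left_mono ed0)
    also have "\<dots> = w x" by (simp add: w_def power2_eq_square algebra_simps)
    finally have "f n x \<le> w x" .
    moreover have "0 \<le> f n x" unfolding f_def by (intro mult_nonneg_nonneg ed0) auto
    ultimately show ?thesis by simp
  qed
  have Li: "integrable lborel L"
    by (rule integrable_dominated_convergence[where s=f, OF Lm fm wi]) (use lim bd in auto)
  have Llim: "(\<lambda>n. \<integral>x. f n x \<partial>lborel) \<longlonglongrightarrow> (\<integral>x. L x \<partial>lborel)"
    by (rule integral_dominated_convergence[where s=f, OF Lm fm wi]) (use lim bd in auto)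
  have Leq: "L x = c * (exponential_density l x * harmonic x)" for x by (simp add: L_def)
  show ?int
  proof -
    have "integrable lborel (\<lambda>x. (1 / c) * L x)" by (intro integrable_mult_right Li)
    then show ?thesis using c by (simp add: Leq)
  qed
  have "(\<integral>x. f n x \<partial>lborel) = sqrt (real n) * (\<integral>\<omega>. exp (l * running_min Y n \<omega>) \<partial>M)" for n
    unfolding exp_running_min_integral[OF l] f_def
    by (simp add: mult.left_commute flip: Bochner_Integration.integral_mult_right_zero)
  moreover have "(\<integral>x. L x \<partial>lborel) = sqrt (2 / v) * profile l / sqrt pi"
    unfolding Leq profile_def by (simp add: c_def)
  ultimately show ?lim using Llim by simp
qed

text \<open>\<open>harmonic\<close> is nonnegative as a limit and at least 1 beyond a fixed level, because it stays within
bounded distance of the identity.\<close>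

lemma profile_pos:
  assumes l: "0 < l"
  shows "0 < profile l"
proof -
  have ed0: "0 \<le> exponential_density l x" for x using l by (rule exponential_density_nonneg)
  obtain C where C: "0 \<le> C" "\<And>x. 0 \<le> x \<Longrightarrow> \<bar>harmonic x - x\<bar> \<le> C" using harmonic_near_identity by blast
  have ti: "has_bochner_integral lborel (\<lambda>x. exponential_density l x * indicator {C + 1..} x) (exp (- l * (C + 1)))"
  proof (rule has_bochner_integral_nn_integral)
    have "(\<integral>\<^sup>+x. ennreal (exponential_density l x * indicator {C + 1..} x) \<partial>lborel) =
      (\<integral>\<^sup>+x. ennreal (exponential_density l x) * indicator {C + 1..} x \<partial>lborel)"
      by (intro nn_integral_cong) (auto simp: indicator_def)
    then show "(\<integral>\<^sup>+x. ennreal (exponential_density l x * indicator {C + 1..} x) \<partial>lborel) = ennreal (exp (- l * (C + 1)))"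
      using exponential_density_tail[OF l, of "C + 1"] C(1) by simp
  qed (use ed0 in \<open>auto intro!: AE_I2\<close>)
  have "(\<integral>x. exponential_density l x * indicator {C + 1..} x \<partial>lborel) \<le> profile l"
    unfolding profile_def
  proof (rule integral_mono)
    show "integrable lborel (\<lambda>x. exponential_density l x * indicator {C + 1..} x)" using ti by (simp add: has_bochner_integral_iff)
    show "integrable lborel (\<lambda>x. exponential_density l x * harmonic x)" by (rule profile_asymp(1)[OF l])
    fix x :: real
    show "exponential_density l x * indicator {C + 1..} x \<le> exponential_density l x * harmonic x"
    proof (cases "x < 0")
      case False
      then have "indicator {C + 1..} x \<le> harmonic x"
        using C(2)[of x] harmonic_nonneg[of x] by (auto simp: indicator_def abs_le_iff)
      then show ?thesis by (intro mult_left_mono ed0)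
    qed (simp add: erlang_density_def)
  qed
  moreover have "(\<integral>x. exponential_density l x * indicator {C + 1..} x \<partial>lborel) = exp (- l * (C + 1))"
    using ti by (simp add: has_bochner_integral_iff)
  ultimately show ?thesis using exp_gt_zero[of "- l * (C + 1)"] by linarith
qed

text \<open>An exponential variable of parameter \<open>l\<close> has mean \<open>1 / l\<close>, and \<open>harmonic\<close> differs from the identity by a
bounded amount.\<close>

lemma profile_tendsto: "((\<lambda>l. l * profile l) \<longlongrightarrow> 1) (at_right 0)"
proof -
  obtain C where C: "0 \<le> C" "\<And>x. 0 \<le> x \<Longrightarrow> \<bar>harmonic x - x\<bar> \<le> C" using harmonic_near_identity by blast
  have est: "\<bar>l * profile l - 1\<bar> \<le> l * C" if l: "0 < l" for l
  proof -
    have ed0: "0 \<le> exponential_density l x" for x using l by (rule exponential_density_nonneg)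
    have m0: "integrable lborel (exponential_density l)" "(\<integral>x. exponential_density l x \<partial>lborel) = 1"
      using exponential_density_moment[OF l, of 0] by (simp_all add: has_bochner_integral_iff)
    have m1: "integrable lborel (\<lambda>x. exponential_density l x * x)" "(\<integral>x. exponential_density l x * x \<partial>lborel) = 1 / l"
      using exponential_density_moment[OF l, of 1] by (simp_all add: has_bochner_integral_iff)
    note pint = profile_asymp(1)[OF l]
    have di: "integrable lborel (\<lambda>x. exponential_density l x * harmonic x - exponential_density l x * x)"
      by (intro Bochner_Integration.integrable_diff pint m1)
    have "profile l - 1 / l = (\<integral>x. exponential_density l x * harmonic x - exponential_density l x * x \<partial>lborel)"
      unfolding profile_def m1(2)[symmetric] by (intro Bochner_Integration.integral_diff[symmetric] pint m1)
    also have "\<bar>\<dots>\<bar> \<le> (\<integral>x. \<bar>exponential_density l x * harmonic x - exponential_density l x * x\<bar> \<partial>lborel)"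
      by (rule integral_abs_bound)
    also have "\<dots> \<le> (\<integral>x. C * exponential_density l x \<partial>lborel)"
    proof (rule integral_mono)
      show "integrable lborel (\<lambda>x. \<bar>exponential_density l x * harmonic x - exponential_density l x * x\<bar>)"
        by (intro integrable_abs di)
      show "integrable lborel (\<lambda>x. C * exponential_density l x)" by (intro integrable_mult_right m0)
      fix x :: real
      show "\<bar>exponential_density l x * harmonic x - exponential_density l x * x\<bar> \<le> C * exponential_density l x"
      proof (cases "x < 0")
        case False
        have "\<bar>exponential_density l x * (harmonic x - x)\<bar> = exponential_density l x * \<bar>harmonic x - x\<bar>"
          using ed0[of x] by (simp add: abs_mult)
        also have "\<dots> \<le> exponential_density l x * C" using False by (intro mult_left_mono C(2) ed0) auto
        finally show ?thesis by (simp add: right_diff_distrib mult.commute)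
      qed (simp add: erlang_density_def)
    qed
    also have "\<dots> = C" using m0 by simp
    finally have "l * \<bar>profile l - 1 / l\<bar> \<le> l * C" using l by (intro mult_left_mono) auto
    moreover have "l * profile l - 1 = l * (profile l - 1 / l)" using l by (simp add: field_simps)
    ultimately show ?thesis using l by (simp add: abs_mult)
  qed
  have "((\<lambda>l. l * profile l - 1) \<longlongrightarrow> 0) (at_right 0)"
  proof (rule Lim_null_comparison)
    have "((\<lambda>l. l * C) \<longlongrightarrow> 0 * C) (at_right 0)" by (intro tendsto_intros)
    then show "((\<lambda>l. l * C) \<longlongrightarrow> 0) (at_right 0)" by simp
    have "\<forall>\<^sub>F l :: real in at_right 0. l \<in> {0<..<1}" by (rule eventually_at_right_real) simp
    then show "\<forall>\<^sub>F l in at_right 0. norm (l * profile l - 1) \<le> l * C"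
      by eventually_elim (use est in auto)
  qed
  then show ?thesis by (simp add: LIM_zero_iff)
qed

theorem minimum_profile:
  assumes irr: "irreducible_matrix P" "aperiodic_matrix P" and nu: "invariant_probability P \<nu>"
  shows "\<exists>h. (\<forall>l>0. \<forall>j. (\<lambda>n. sqrt (real n) * (\<integral>\<omega>. exp (l * running_min Y n \<omega>) * indicator {\<omega>. X n \<omega> = j} \<omega> \<partial>M))
        \<longlonglongrightarrow> \<nu> $ j * h l / sqrt pi) \<and> (\<forall>l>0. 0 < h l) \<and> ((\<lambda>l. l * h l) \<longlongrightarrow> sqrt (2 / v)) (at_right 0)"
proof (intro exI[of _ "\<lambda>l. sqrt (2 / v) * profile l"] conjI allI impI)
  fix l :: real and j assume l: "0 < l"
  show "(\<lambda>n. sqrt (real n) * (\<integral>\<omega>. exp (l * running_min Y n \<omega>) * indicator {\<omega>. X n \<omega> = j} \<omega> \<partial>M))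
        \<longlonglongrightarrow> \<nu> $ j * (sqrt (2 / v) * profile l) / sqrt pi"
    using mixing_transfer[OF irr nu l profile_asymp(2)[OF l], of j] by simp
next
  fix l :: real assume l: "0 < l"
  show "0 < sqrt (2 / v) * profile l" using profile_pos[OF l] v_pos by simp
next
  have "((\<lambda>l. sqrt (2 / v) * (l * profile l)) \<longlongrightarrow> sqrt (2 / v) * 1) (at_right 0)"
    by (intro tendsto_mult tendsto_const profile_tendsto)
  then show "((\<lambda>l. l * (sqrt (2 / v) * profile l)) \<longlongrightarrow> sqrt (2 / v)) (at_right 0)"
    by (simp add: mult.left_commute)
qed

end

section \<open>Nondegeneracy of the variance\<close>

context additive_walk
begin

text \<open>The degenerate case: if the martingale increments have mean square 0, the walk telescopes to a
function of the chain.\<close>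

lemma coboundary_walk:
  assumes zero: "\<And>k j. P $ k $ j * (\<integral>t. (t + g j - g k)\<^sup>2 \<partial>F k j) = 0"
    and int: "\<And>k j. integrable (F k j) (\<lambda>t. (t + g j - g k)\<^sup>2)"
  shows "AE \<omega> in M. \<forall>n. walk Y n \<omega> = g i - g (X n \<omega>)"
proof -
  have "AE \<omega> in M. Y (Suc n) \<omega> + g (X (Suc n) \<omega>) - g (X n \<omega>) = 0" for n
  proof -
    define \<phi> where "\<phi> k j r t = ennreal ((t + g j - g k)\<^sup>2)" for k j and r t :: real
    have pm: "case_prod (\<phi> k j) \<in> borel_measurable (borel \<Otimes>\<^sub>M borel)" for k j
      unfolding \<phi>_def by measurable
    have sp: "space M \<in> sets (past M Y X n)" using sets.top[of "past M Y X n"] by simp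
    have z: "ennreal (P $ k $ j) * (\<integral>\<^sup>+t. \<phi> k j r t \<partial>F k j) = 0" for k j r
    proof -
      have "(\<integral>\<^sup>+t. \<phi> k j r t \<partial>F k j) = ennreal (\<integral>t. (t + g j - g k)\<^sup>2 \<partial>F k j)"
        unfolding \<phi>_def by (intro nn_integral_eq_integral int) auto
      then show ?thesis using zero[of k j] by (simp add: P_nonneg flip: ennreal_mult)
    qed
    have "(\<integral>\<^sup>+\<omega>. \<phi> (X n \<omega>) (X (Suc n) \<omega>) 0 (Y (Suc n) \<omega>) * indicator (space M) \<omega> \<partial>M) = 0"
      using next_step_nn[where \<phi>=\<phi> and R="\<lambda>_. 0" and B="space M" and n=n, OF sp _ pm] by (simp add: z)
    moreover have "(\<lambda>\<omega>. \<phi> (X n \<omega>) (X (Suc n) \<omega>) 0 (Y (Suc n) \<omega>)) \<in> borel_measurable M"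
    proof -
      have [measurable]: "(\<lambda>\<omega>. g (X m \<omega>)) \<in> borel_measurable M" for m
        using measurable_compose[OF X_meas[of m], of g borel] by simp
      show ?thesis unfolding \<phi>_def by measurable
    qed
    ultimately have "AE \<omega> in M. \<phi> (X n \<omega>) (X (Suc n) \<omega>) 0 (Y (Suc n) \<omega>) * indicator (space M) \<omega> = 0"
      by (subst (asm) nn_integral_0_iff_AE) auto
    then show ?thesis
      using AE_space by eventually_elim (auto simp: \<phi>_def)
  qed
  then have "AE \<omega> in M. \<forall>n. Y (Suc n) \<omega> + g (X (Suc n) \<omega>) - g (X n \<omega>) = 0" by (simp add: AE_all_countable)
  then show ?thesis
    using start
  proof eventually_elim
    case (elim \<omega>)
    show ?case
    proof
      fix n show "walk Y n \<omega> = g i - g (X n \<omega>)"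
      proof (induction n)
        case 0 show ?case using elim by simp
      next
        case (Suc n)
        have "Y (Suc n) \<omega> + g (X (Suc n) \<omega>) - g (X n \<omega>) = 0" using elim by blast
        then show ?case using Suc by (simp add: walk_Suc)
      qed
    qed
  qed
qed

text \<open>On \<open>X\<^sub>n = j\<close> such a walk sits at a single point, and a point is a Lebesgue null set.\<close>

lemma coboundary_no_ac_component:
  assumes "AE \<omega> in M. walk Y n \<omega> = g i - g (X n \<omega>)"
  shows "\<not> has_ac_component (distr (restrict_space M {\<omega> \<in> space M. X n \<omega> = j}) borel (walk Y n))"
proof
  let ?\<Omega> = "{\<omega> \<in> space M. X n \<omega> = j}"
  let ?\<mu> = "distr (restrict_space M ?\<Omega>) borel (walk Y n)"
  let ?p = "g i - g j"
  assume "has_ac_component ?\<mu>"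
  then obtain \<mu>a \<mu>s where a: "sets \<mu>a = sets borel" "sets \<mu>s = sets borel"
    "\<And>A. A \<in> sets borel \<Longrightarrow> emeasure ?\<mu> A = emeasure \<mu>a A + emeasure \<mu>s A"
    "absolutely_continuous lborel \<mu>a" "emeasure \<mu>a UNIV \<noteq> 0"
    unfolding has_ac_component_def by blast
  have Om: "?\<Omega> \<in> sets M" by measurable
  have wm: "walk Y n \<in> measurable (restrict_space M ?\<Omega>) borel"
    by (intro measurable_restrict_space1 walk_meas)
  have "emeasure ?\<mu> (UNIV - {?p}) = emeasure (restrict_space M ?\<Omega>) (walk Y n -` (UNIV - {?p}) \<inter> space (restrict_space M ?\<Omega>))"
    by (rule emeasure_distr[OF wm]) simp
  also have "\<dots> = emeasure M (walk Y n -` (UNIV - {?p}) \<inter> space (restrict_space M ?\<Omega>))"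
    by (rule emeasure_restrict_space) (use Om in \<open>auto simp: space_restrict_space\<close>)
  also have "\<dots> = 0"
  proof -
    have "AE \<omega> in M. \<omega> \<notin> walk Y n -` (UNIV - {?p}) \<inter> space (restrict_space M ?\<Omega>)"
      using assms by eventually_elim (auto simp: space_restrict_space)
    moreover have "walk Y n -` (UNIV - {?p}) \<inter> space (restrict_space M ?\<Omega>) \<in> sets M"
    proof -
      have "walk Y n -` (UNIV - {?p}) \<inter> space (restrict_space M ?\<Omega>) = {\<omega> \<in> space M. X n \<omega> = j \<and> walk Y n \<omega> \<noteq> ?p}"
        by (auto simp: space_restrict_space)
      then show ?thesis by simp
    qed
    ultimately show ?thesis using AE_iff_null_sets null_setsD1 by blast
  qed
  finally have "emeasure \<mu>a (UNIV - {?p}) = 0" using a(3)[of "UNIV - {?p}"] by simp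
  moreover have "emeasure \<mu>a {?p} = 0"
  proof -
    have "{?p} \<in> null_sets lborel" by (simp add: null_sets_def)
    then have "{?p} \<in> null_sets \<mu>a" using a(4) by (auto simp: absolutely_continuous_def)
    then show ?thesis by auto
  qed
  moreover have "emeasure \<mu>a UNIV \<le> emeasure \<mu>a (UNIV - {?p}) + emeasure \<mu>a {?p}"
  proof -
    have "emeasure \<mu>a ((UNIV - {?p}) \<union> {?p}) \<le> emeasure \<mu>a (UNIV - {?p}) + emeasure \<mu>a {?p}"
      by (rule emeasure_subadditive) (simp_all add: a(1))
    then show ?thesis by (simp add: Un_commute)
  qed
  ultimately show False using a(5) by simp
qed

end

section \<open>The limit theorem\<close>

lemma exp_moment_powers:
  fixes \<mu> :: "real measure"
  assumes a: "0 < a" and int: "integrable \<mu> (\<lambda>t. exp (a * t))" "integrable \<mu> (\<lambda>t. exp (- a * t))"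
    and s: "sets \<mu> = sets borel"
  shows "integrable \<mu> (\<lambda>t. t ^ n)"
proof -
  have [measurable_cong]: "sets \<mu> = sets borel" by (rule s)
  define c where "c = a / (real n + 1)"
  have c: "0 < c" using a by (simp add: c_def)
  have "integrable \<mu> (\<lambda>t. (1 / c) ^ n * (exp (a * t) + exp (- a * t)))"
    by (rule integrable_mult_right, rule Bochner_Integration.integrable_add[OF int])
  then show ?thesis
  proof (rule Bochner_Integration.integrable_bound)
    show "AE t in \<mu>. norm (t ^ n) \<le> norm ((1 / c) ^ n * (exp (a * t) + exp (- a * t)))"
    proof (rule AE_I2)
      fix t
      have "\<bar>t\<bar> ^ n \<le> (1 / c) ^ n * exp (real n * c * \<bar>t\<bar>)" using c by (intro pow_le_exp) auto
      also have "exp (real n * c * \<bar>t\<bar>) \<le> exp (a * \<bar>t\<bar>)"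
      proof -
        have "real n * c \<le> a" using a by (simp add: c_def field_simps)
        then show ?thesis by (simp add: mult_right_mono)
      qed
      also have "exp (a * \<bar>t\<bar>) \<le> exp (a * t) + exp (- a * t)" by (simp add: abs_if)
      finally have "\<bar>t\<bar> ^ n \<le> (1 / c) ^ n * (exp (a * t) + exp (- a * t))" using c by simp
      then show "norm (t ^ n) \<le> norm ((1 / c) ^ n * (exp (a * t) + exp (- a * t)))"
        using c by (simp add: power_abs)
    qed
  qed measurable
qed

text \<open>Let \<open>v\<close> be the stationary mean of the squared martingale increments. As \<open>l\<close> tends to 0, the limit of
\<open>sqrt n\<close> times the expectation behaves like \<open>sqrt (2 / (pi v)) \<nu>\<^sub>j / l\<close>. The statement divides \<open>H\<close> by
\<open>sqrt pi\<close> and has a further \<open>pi\<close> under the root, so its constant \<open>\<sigma>2\<close> is \<open>v / pi\<close>.\<close>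

theorem theorem1p1:
  fixes P :: "real^'e^'e" and \<nu> :: "real^'e"
    and F :: "'e \<Rightarrow> 'e \<Rightarrow> real measure"
    and M :: "'e \<Rightarrow> 'w measure"
    and Y :: "nat \<Rightarrow> 'w \<Rightarrow> real" and X :: "nat \<Rightarrow> 'w \<Rightarrow> 'e"
  assumes "stochastic_matrix P" and "irreducible_matrix P" and "aperiodic_matrix P"
    and "invariant_probability P \<nu>"
    and "\<And>i j. prob_space (F i j)" and "\<And>i j. sets (F i j) = sets borel"
    and "\<And>i. markov_walk P F (M i) Y X i"
    and "H1 F" and "H2 M Y X" and "H3 P \<nu> F"
  shows "\<exists>\<sigma>2>0. \<exists>H :: 'e \<Rightarrow> 'e \<Rightarrow> real \<Rightarrow> real. \<forall>i j.
    (\<forall>l>0.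
      (\<lambda>n. sqrt (real n) *
         (LINT \<omega>|M i. exp (l * running_min Y n \<omega>) * indicator {\<omega>. X n \<omega> = j} \<omega>))
        \<longlonglongrightarrow> H i j l / sqrt pi) \<and>
    (\<forall>l>0. H i j l > 0) \<and>
    ((\<lambda>l. l * H i j l) \<longlongrightarrow> sqrt (2 / (pi * \<sigma>2)) * \<nu> $ j) (at_right 0)"
proof -
  have aw: "additive_walk P F (M i) Y X i" for i
    by (intro additive_walk.intro assms)
  have P0: "0 \<le> P $ k $ j" and P1: "(\<Sum>j\<in>UNIV. P $ k $ j) = 1" for k j
    using assms(1) by (auto simp: stochastic_matrix_def)
  have nu1: "(\<Sum>k\<in>UNIV. \<nu> $ k) = 1" using assms(4) by (simp add: invariant_probability_def)
  have nu_pos: "0 < \<nu> $ k" for k by (rule invariant_probability_pos[OF assms(1-4)])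
  obtain \<alpha> where alpha: "0 < \<alpha>"
    and cint: "\<And>z k j. \<bar>Re z\<bar> \<le> \<alpha> \<Longrightarrow> integrable (F k j) (\<lambda>t. exp (z * complex_of_real t))"
    using assms(8) unfolding H1_def by blast
  have rint: "integrable (F k j) (\<lambda>t. exp (a * t))" if "\<bar>a\<bar> \<le> \<alpha>" for a k j
    using integrable_norm[OF cint[of "complex_of_real a" k j]] that by (simp add: norm_exp_eq_Re)
  have int_pos: "integrable (F k j) (\<lambda>t. exp (\<alpha> * t))" and int_neg: "integrable (F k j) (\<lambda>t. exp (- \<alpha> * t))" for k j
    using alpha by (intro rint; simp)+
  have pow_int: "integrable (F k j) (\<lambda>t. t ^ n)" for k j n
    by (rule exp_moment_powers[OF alpha int_pos int_neg assms(6)])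
  have t_int: "integrable (F k j) (\<lambda>t. t)" for k j using pow_int[of k j 1] by simp
  have F1: "measure (F k j) (space (F k j)) = 1" for k j
    by (rule prob_space.prob_space[OF assms(5)])
  have const_int: "integrable (F k j) (\<lambda>t. c :: real)" for c k j
  proof -
    interpret prob_space "F k j" by (rule assms(5))
    show ?thesis by simp
  qed
  define \<mu> :: "real^'e" where "\<mu> = (\<chi> k. \<Sum>j\<in>UNIV. P $ k $ j * (\<integral>t. t \<partial>F k j))"
  have "(\<Sum>k\<in>UNIV. \<nu> $ k * \<mu> $ k) = 0"
  proof -
    have "(\<Sum>k\<in>UNIV. \<nu> $ k * \<mu> $ k) = (\<Sum>k\<in>UNIV. \<Sum>j\<in>UNIV. \<nu> $ k * P $ k $ j * (\<integral>t. t \<partial>F k j))"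
      by (simp add: \<mu>_def sum_distrib_left mult.assoc)
    also have "\<dots> = (\<Sum>(k, j)\<in>UNIV \<times> UNIV. \<nu> $ k * P $ k $ j * (\<integral>t. t \<partial>F k j))"
      by (rule sum.cartesian_product)
    also have "\<dots> = 0" using assms(10) by (simp only: H3_def UNIV_Times_UNIV)
    finally show ?thesis .
  qed
  from poisson_equation[OF assms(1-4) this] obtain g0 where g0: "g0 - P *v g0 = \<mu>" by blast
  \<comment> \<open>Adding a constant to a solution of the Poisson equation gives another one, here a nonnegative one.\<close>
  define g where "g k = g0 $ k + norm g0" for k
  have g: "0 \<le> g k" "g k \<le> 2 * norm g0" for k
    using component_le_norm_cart[of g0 k] by (auto simp: g_def abs_le_iff)
  have drift: "(\<Sum>j\<in>UNIV. P $ k $ j * (\<integral>t. t + g j - g k \<partial>F k j)) = 0" for k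
  proof -
    have "(\<integral>t. t + g j - g k \<partial>F k j) = (\<integral>t. t \<partial>F k j) + g0 $ j - g0 $ k" for j
      using t_int const_int by (simp add: g_def F1)
    then have "(\<Sum>j\<in>UNIV. P $ k $ j * (\<integral>t. t + g j - g k \<partial>F k j)) = \<mu> $ k + (P *v g0) $ k - (\<Sum>j\<in>UNIV. P $ k $ j) * g0 $ k"
      by (simp add: \<mu>_def matrix_vector_mult_def distrib_left right_diff_distrib sum.distrib sum_subtractf sum_distrib_right)
    also have "\<dots> = 0" using arg_cong[OF g0, of "\<lambda>u. u $ k"] by (simp add: P1)
    finally show ?thesis .
  qed
  define w where "w k = (\<Sum>j\<in>UNIV. P $ k $ j * (\<integral>t. (t + g j - g k)\<^sup>2 \<partial>F k j))" for k
  have sq_int: "integrable (F k j) (\<lambda>t. (t + g j - g k)\<^sup>2)" for k j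
  proof -
    have "(\<lambda>t. (t + g j - g k)\<^sup>2) = (\<lambda>t. t ^ 2 + (2 * (g j - g k) * t + (g j - g k)\<^sup>2))"
      by (auto simp: power2_eq_square algebra_simps)
    then show ?thesis using pow_int[of k j 2] t_int[of k j] const_int by simp
  qed
  have sq0: "0 \<le> P $ k $ j * (\<integral>t. (t + g j - g k)\<^sup>2 \<partial>F k j)" for k j
    by (intro mult_nonneg_nonneg P0 integral_nonneg_AE) auto
  have w0: "0 \<le> w k" for k unfolding w_def by (intro sum_nonneg sq0)
  define v where "v = (\<Sum>k\<in>UNIV. \<nu> $ k * w k)"
  \<comment> \<open>If \<open>v = 0\<close>, all increments of the martingale vanish, as \<open>\<nu>\<close> charges every state.\<close>
  have v_pos: "0 < v"
  proof (rule ccontr)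
    assume "\<not> 0 < v"
    moreover have n: "0 \<le> \<nu> $ k * w k" for k using nu_pos[of k] w0[of k] by simp
    moreover have "0 \<le> v" unfolding v_def by (intro sum_nonneg n)
    ultimately have "v = 0" by linarith
    then have "\<nu> $ k * w k = 0" for k using n by (simp add: v_def sum_nonneg_eq_0_iff)
    then have "w k = 0" for k using nu_pos[of k] by (metis less_irrefl mult_eq_0_iff)
    then have z: "P $ k $ j * (\<integral>t. (t + g j - g k)\<^sup>2 \<partial>F k j) = 0" for k j
      using sq0 by (simp add: w_def sum_nonneg_eq_0_iff)
    obtain n i j where ac: "has_ac_component (distr (restrict_space (M i) {\<omega> \<in> space (M i). X n \<omega> = j}) borel (walk Y n))"
      using assms(9) by (auto simp: H2_def)
    interpret additive_walk P F "M i" Y X i by (rule aw)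
    have "AE \<omega> in M i. walk Y n \<omega> = g i - g (X n \<omega>)"
      using coboundary_walk[of g, OF z sq_int] by eventually_elim blast
    from coboundary_no_ac_component[OF this] ac show False by blast
  qed
  have "(\<Sum>k\<in>UNIV. \<nu> $ k * (\<chi> k. w k - v) $ k) = 0"
    by (simp add: right_diff_distrib sum_subtractf v_def nu1 flip: sum_distrib_right)
  from poisson_equation[OF assms(1-4) this] obtain q0 where q0: "q0 - P *v q0 = (\<chi> k. w k - v)" by blast
  have var: "(\<Sum>j\<in>UNIV. P $ k $ j * ((\<integral>t. (t + g j - g k)\<^sup>2 \<partial>F k j) + q0 $ j)) = v + q0 $ k" for k
  proof -
    have "(\<Sum>j\<in>UNIV. P $ k $ j * ((\<integral>t. (t + g j - g k)\<^sup>2 \<partial>F k j) + q0 $ j)) = w k + (P *v q0) $ k"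
      by (simp add: w_def matrix_vector_mult_def distrib_left sum.distrib)
    also have "\<dots> = v + q0 $ k" using arg_cong[OF q0, of "\<lambda>u. u $ k"] by simp
    finally show ?thesis .
  qed
  define K where "K = (\<Sum>k\<in>UNIV. \<Sum>j\<in>UNIV. (\<integral>t. exp (\<alpha> * t) \<partial>F k j) + (\<integral>t. exp (- \<alpha> * t) \<partial>F k j))"
  have K: "(\<integral>t. exp (\<alpha> * t) \<partial>F k j) \<le> K" "(\<integral>t. exp (- \<alpha> * t) \<partial>F k j) \<le> K" for k j
  proof -
    let ?s = "\<lambda>k j. (\<integral>t. exp (\<alpha> * t) \<partial>F k j) + (\<integral>t. exp (- \<alpha> * t) \<partial>F k j)"
    have n: "0 \<le> (\<integral>t. exp (a * t) \<partial>F k j)" for a k j by (intro integral_nonneg_AE) auto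
    have "?s k j \<le> (\<Sum>j\<in>UNIV. ?s k j)" by (intro member_le_sum[of j UNIV "?s k"] add_nonneg_nonneg n) auto
    also have "\<dots> \<le> K" unfolding K_def
      by (intro member_le_sum[of k UNIV "\<lambda>k. \<Sum>j\<in>UNIV. ?s k j"] sum_nonneg add_nonneg_nonneg n) auto
    finally have "?s k j \<le> K" .
    then show "(\<integral>t. exp (\<alpha> * t) \<partial>F k j) \<le> K" "(\<integral>t. exp (- \<alpha> * t) \<partial>F k j) \<le> K"
      using n[where a=\<alpha> and k=k and j=j] n[where a="- \<alpha>" and k=k and j=j] by linarith+
  qed
  have cw: "corrected_walk P F (M i) Y X i g (\<lambda>k. q0 $ k) v \<alpha> (2 * norm g0) (norm q0) K" for i
    by (intro corrected_walk.intro aw corrected_walk_axioms.intro alpha v_pos int_pos int_neg K g drift var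
        component_le_norm_cart)
  define good where "good i h \<longleftrightarrow>
      (\<forall>l>0. \<forall>j. (\<lambda>n. sqrt (real n) * (LINT \<omega>|M i. exp (l * running_min Y n \<omega>) * indicator {\<omega>. X n \<omega> = j} \<omega>))
        \<longlonglongrightarrow> \<nu> $ j * h l / sqrt pi) \<and> (\<forall>l>0. 0 < h l) \<and> ((\<lambda>l. l * h l) \<longlongrightarrow> sqrt (2 / v)) (at_right 0)"
    for i and h :: "real \<Rightarrow> real"
  have "\<exists>h. good i h" for i
    unfolding good_def by (rule corrected_walk.minimum_profile[OF cw assms(2-4)])
  then obtain h' where "\<And>i. good i (h' i)" by metis
  note h = this[unfolded good_def]
  show ?thesis
  proof (intro exI[of _ "v / pi"] conjI exI[of _ "\<lambda>i j l. \<nu> $ j * h' i l"] allI impI)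
    show "0 < v / pi" using v_pos by simp
    fix i j
    show "(\<lambda>n. sqrt (real n) * (LINT \<omega>|M i. exp (l * running_min Y n \<omega>) * indicator {\<omega>. X n \<omega> = j} \<omega>))
        \<longlonglongrightarrow> \<nu> $ j * h' i l / sqrt pi" if "0 < l" for l
      using h[of i] that by blast
    show "0 < \<nu> $ j * h' i l" if "0 < l" for l
      using h[of i] that nu_pos[of j] by simp
    have "((\<lambda>l. \<nu> $ j * (l * h' i l)) \<longlongrightarrow> \<nu> $ j * sqrt (2 / v)) (at_right 0)"
      using h[of i] by (intro tendsto_mult tendsto_const) blast
    then show "((\<lambda>l. l * (\<nu> $ j * h' i l)) \<longlongrightarrow> sqrt (2 / (pi * (v / pi))) * \<nu> $ j) (at_right 0)"
      by (simp add: mult_ac)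
  qed
qed

end
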